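(* Assume the standing setting with $I=\mathbb{R}$, and that $X$ a.s. has no negative jumps. Suppose there exist $Q\in[0,\infty)$ and a map $\phi:(Q,\infty)\to(0,\infty)$ such that $$\mathbb{P}_x[e^{-qT_\ell^-};T_\ell^-<\zeta]=e^{-\phi(q)(x-\ell)}\quad\text{for all }\ell\le x\text{ in }\mathbb{R}\text{ and all }q\in(Q,\infty).$$ Then, under the probabilities $(\mathbb{P}_x)_{x\in\mathbb{R}}$, $X$ is a possibly killed spectrally positive Lévy process in the filtration $\mathcal{F}$ (i.e. adapted, with increments independent of the past relative to $\mathcal{F}$), and, writing its Laplace exponent as $\psi-p$ (with $\psi(0)=0$, $p\ge0$ the killing rate), one has $\psi^{-1}(p+q)=\phi(q)$ for all $q\in(Q,\infty)$, where $\psi^{-1}$ is the right-continuous inverse of $\psi$. In particular the laws of $X$ under $\mathbb{P}_x$, $x\in\mathbb{R}$, are uniquely determined by $\phi$.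
   Context: Standing setting: $I\subset\mathbb{R}$ is an interval unbounded above. $X=(X_t)_{t\in[0,\zeta)}$ is a process under complete probability measures $(\mathbb{P}_x)_{x\in I}$ (whose domains all contain $\mathcal{F}_\infty$), adapted to a filtration $\mathcal{F}=(\mathcal{F}_t)_{t\ge0}$ that is complete in the sense that each $\mathcal{F}_t$ contains every set differing from an event of $\mathcal{F}_t$ by a set that is $\mathbb{P}_x$-null for all $x\in I$. The lifetime $\zeta$ is an $\mathcal{F}$-stopping time with $\zeta>0$ a.s., and $X_t:=\infty$ (cemetery) for $t\ge\zeta$. "a.s." means $\mathbb{P}_x$-a.s. for every $x\in I$, and "negligible" means $\mathbb{P}_x$-null for every $x$. Assumptions: paths of $X$ are càdlàg in $I$ on $[0,\zeta)$; on $\{0<\zeta<\infty\}$ the limit $X_{\zeta-}$ exists in $I\cup\{\infty\}$ a.s. (set $X_{\zeta-}:=\infty$ when it does not exist); $x\mapsto\mathbb{P}_x(t<\zeta,X_t\in A)$ is universally measurable for Borel $A\subset I$; normality: $X_0=x$ $\mathbb{P}_x$-a.s.; strong Markov: for every $\mathcal{F}$-stopping time $S$ and measurable $H\ge0$, $\mathbb{P}_x[H(X_{S+\cdot})\mid\mathcal{F}_S]=\mathbb{P}_{X_S}[H(X)]$ $\mathbb{P}_x$-a.s. on $\{S<\zeta\}$; quasi left-continuity: if $\mathcal{F}$-stopping times $T_n$ increase a.s. to $T$ then $X_{T_n}\to X_T$ a.s. on $\{T<\zeta\}$; non-announceability: for every a.s. nondecreasing sequence $(T_n)$ of $\mathcal{F}$-stopping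 times, the event $\{T_n<\zeta\ \forall n\}\cap\{\lim_n T_n=\zeta\}\cap\{\zeta<\infty,X_{\zeta-}<\infty\}$ is negligible. Notation: $\mathbb{P}_x[Y;A]:=\mathbb{E}_x[Y\mathbf{1}_A]$; for $\ell\in I$, $T_\ell^-:=\inf\{t\in[0,\zeta):X_t\le\ell\}$ ($\inf\emptyset=\infty$). A spectrally positive Lévy process is a Lévy process with no negative jumps that is not a subordinator (negative drifts are allowed); its Laplace exponent $\psi$ is given by $\psi(z)=\log\mathbb{E}_0[e^{-zX_1}]=-\gamma z+\frac{\sigma^2}{2}z^2+\int_{(0,\infty)}(e^{-zh}+zh\mathbf{1}_{(0,1]}(h)-1)\,\mathsf{m}(dh)$, $z\ge0$, for unique $\gamma\in\mathbb{R}$, $\sigma\ge0$ and measure $\mathsf{m}$ on $(0,\infty)$ with $\int(h^2\wedge1)\mathsf{m}(dh)<\infty$; $\psi(0)=0$. A possibly killed such process with killing rate $p\ge0$ is such a process sent to the cemetery at an independent exponential time of rate $p$ (no killing if $p=0$); its Laplace exponent is $\psi-p$. $\psi^{-1}$ denotes the right-continuous inverse of $\psi$. *)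

theory Defs
  imports "HOL-Probability.Probability"
begin

text \<open>Paths are recorded on the time set [0,\<infinity>) with values in ereal; the value \<infinity>
  plays the role of the cemetery. Here the state space is I = \<real>.\<close>

definition path_space :: "(real \<Rightarrow> ereal) measure" where
  "path_space = Pi\<^sub>M {0..} (\<lambda>_. borel)"

definition path_of :: "(real \<Rightarrow> 'a \<Rightarrow> ereal) \<Rightarrow> 'a \<Rightarrow> (real \<Rightarrow> ereal)" where
  "path_of X \<omega> = restrict (\<lambda>s. X s \<omega>) {0..}"

text \<open>The shifted path s \<mapsto> X_{S+s} (used on the event S < zeta, where S is finite).\<close>
definition shifted_path ::
  "(real \<Rightarrow> 'a \<Rightarrow> ereal) \<Rightarrow> ('a \<Rightarrow> ennreal) \<Rightarrow> 'a \<Rightarrow> (real \<Rightarrow> ereal)" where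
  "shifted_path X S \<omega> = restrict (\<lambda>s. X (enn2real (S \<omega>) + s) \<omega>) {0..}"

definition F_infty :: "'a set \<Rightarrow> (real \<Rightarrow> 'a measure) \<Rightarrow> 'a measure" where
  "F_infty \<Omega> F = sigma \<Omega> (\<Union>t\<in>{0..}. sets (F t))"

definition stopping_timeF :: "(real \<Rightarrow> 'a measure) \<Rightarrow> ('a \<Rightarrow> ennreal) \<Rightarrow> bool" where
  "stopping_timeF F S \<longleftrightarrow> (\<forall>t\<ge>0. {\<omega>\<in>space (F t). S \<omega> \<le> ennreal t} \<in> sets (F t))"

definition F_at :: "'a set \<Rightarrow> (real \<Rightarrow> 'a measure) \<Rightarrow> ('a \<Rightarrow> ennreal) \<Rightarrow> 'a measure" where
  "F_at \<Omega> F S = sigma \<Omega>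
     {A \<in> sets (F_infty \<Omega> F). \<forall>t\<ge>0. {\<omega>\<in>A. S \<omega> \<le> ennreal t} \<in> sets (F t)}"

definition X_at :: "(real \<Rightarrow> 'a \<Rightarrow> ereal) \<Rightarrow> ('a \<Rightarrow> ennreal) \<Rightarrow> ('a \<Rightarrow> ennreal) \<Rightarrow> 'a \<Rightarrow> ereal" where
  "X_at X \<zeta> S \<omega> = (if S \<omega> < \<zeta> \<omega> then X (enn2real (S \<omega>)) \<omega> else \<infinity>)"

definition zeta_minus :: "(real \<Rightarrow> 'a \<Rightarrow> ereal) \<Rightarrow> ('a \<Rightarrow> ennreal) \<Rightarrow> 'a \<Rightarrow> ereal" where
  "zeta_minus X \<zeta> \<omega> =
     (if \<exists>l. l \<noteq> -\<infinity> \<and> ((\<lambda>s. X s \<omega>) \<longlongrightarrow> l) (at_left (enn2real (\<zeta> \<omega>)))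
      then Lim (at_left (enn2real (\<zeta> \<omega>))) (\<lambda>s. X s \<omega>) else \<infinity>)"

definition negligible :: "(real \<Rightarrow> 'a measure) \<Rightarrow> 'a set \<Rightarrow> bool" where
  "negligible P N \<longleftrightarrow> (\<forall>x. N \<in> null_sets (P x))"

definition universally_measurable :: "(real \<Rightarrow> real) \<Rightarrow> bool" where
  "universally_measurable f \<longleftrightarrow>
     (\<forall>\<mu>::real measure. finite_measure \<mu> \<and> sets \<mu> = sets borel \<longrightarrow> f \<in> borel_measurable (completion \<mu>))"

definition standing_setting ::
  "'a set \<Rightarrow> (real \<Rightarrow> 'a measure) \<Rightarrow> (real \<Rightarrow> 'a measure) \<Rightarrow> ('a \<Rightarrow> ennreal)
     \<Rightarrow> (real \<Rightarrow> 'a \<Rightarrow> ereal) \<Rightarrow> bool" where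
  "standing_setting \<Omega> F P \<zeta> X \<longleftrightarrow>
    \<comment> \<open>filtration\<close>
    (\<forall>t\<ge>0. space (F t) = \<Omega>) \<and>
    (\<forall>s t. 0 \<le> s \<and> s \<le> t \<longrightarrow> sets (F s) \<subseteq> sets (F t)) \<and>
    \<comment> \<open>complete probability measures whose domains contain F_\<infinity>\<close>
    (\<forall>x. prob_space (P x) \<and> complete_measure (P x) \<and> space (P x) = \<Omega>
         \<and> sets (F_infty \<Omega> F) \<subseteq> sets (P x)) \<and>
    \<comment> \<open>completeness of the filtration\<close>
    (\<forall>t\<ge>0. \<forall>A B. A \<in> sets (F t) \<and> B \<subseteq> \<Omega> \<and> negligible P ((A - B) \<union> (B - A))
        \<longrightarrow> B \<in> sets (F t)) \<and>
    \<comment> \<open>adaptedness\<close>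
    (\<forall>t\<ge>0. X t \<in> borel_measurable (F t)) \<and>
    \<comment> \<open>lifetime: stopping time, positive a.s.\<close>
    stopping_timeF F \<zeta> \<and>
    (\<forall>x. AE \<omega> in P x. 0 < \<zeta> \<omega>) \<and>
    \<comment> \<open>values in I = \<real> before zeta, cemetery \<infinity> from zeta on\<close>
    (\<forall>\<omega>\<in>\<Omega>. \<forall>t\<ge>0. (ennreal t < \<zeta> \<omega> \<longrightarrow> \<bar>X t \<omega>\<bar> \<noteq> \<infinity>) \<and>
                      (\<zeta> \<omega> \<le> ennreal t \<longrightarrow> X t \<omega> = \<infinity>)) \<and>
    \<comment> \<open>cadlag paths on [0,zeta)\<close>
    (\<forall>\<omega>\<in>\<Omega>. \<forall>t\<ge>0. ennreal t < \<zeta> \<omega> \<longrightarrow>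
        continuous (at_right t) (\<lambda>s. real_of_ereal (X s \<omega>)) \<and>
        (0 < t \<longrightarrow> (\<exists>l. ((\<lambda>s. real_of_ereal (X s \<omega>)) \<longlongrightarrow> l) (at_left t)))) \<and>
    \<comment> \<open>existence of X_{zeta-} in I \<union> {\<infinity>} a.s. on {0 < zeta < \<infinity>}\<close>
    (\<forall>x. AE \<omega> in P x. 0 < \<zeta> \<omega> \<and> \<zeta> \<omega> < \<infinity> \<longrightarrow>
        (\<exists>l. l \<noteq> -\<infinity> \<and> ((\<lambda>s. X s \<omega>) \<longlongrightarrow> l) (at_left (enn2real (\<zeta> \<omega>))))) \<and>
    \<comment> \<open>universal measurability of x \<mapsto> P_x(t < zeta, X_t \<in> A)\<close>
    (\<forall>t\<ge>0. \<forall>A\<in>sets borel. universally_measurable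
        (\<lambda>x. measure (P x) {\<omega>\<in>\<Omega>. ennreal t < \<zeta> \<omega> \<and> X t \<omega> \<in> ereal ` A})) \<and>
    \<comment> \<open>normality\<close>
    (\<forall>x. AE \<omega> in P x. X 0 \<omega> = ereal x) \<and>
    \<comment> \<open>strong Markov property: some version C of P_x[H(X_{S+.}) 1_{S<zeta} | F_S]
        agrees a.s. on {S < zeta} with P_{X_S}[H(X)]\<close>
    (\<forall>S. stopping_timeF F S \<longrightarrow>
       (\<forall>H \<in> borel_measurable path_space. \<forall>x.
          \<exists>C \<in> borel_measurable (F_at \<Omega> F S).
            (\<forall>A \<in> sets (F_at \<Omega> F S).
               (\<integral>\<^sup>+\<omega>. C \<omega> * indicator A \<omega> \<partial>P x) =
               (\<integral>\<^sup>+\<omega>. H (shifted_path X S \<omega>) * indicator {\<omega>. S \<omega> < \<zeta> \<omega>} \<omega>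
                         * indicator A \<omega> \<partial>P x)) \<and>
            (AE \<omega> in P x. S \<omega> < \<zeta> \<omega> \<longrightarrow>
               C \<omega> = (\<integral>\<^sup>+\<omega>'. H (path_of X \<omega>') \<partial>P (real_of_ereal (X_at X \<zeta> S \<omega>)))))) \<and>
    \<comment> \<open>quasi left-continuity\<close>
    (\<forall>(T::'a \<Rightarrow> ennreal) Ts. (\<forall>n. stopping_timeF F (Ts n)) \<longrightarrow>
       (\<forall>x. AE \<omega> in P x. incseq (\<lambda>n. Ts n \<omega>) \<and> (\<lambda>n. Ts n \<omega>) \<longlonglongrightarrow> T \<omega>) \<longrightarrow>
       (\<forall>x. AE \<omega> in P x. T \<omega> < \<zeta> \<omega> \<longrightarrow>
            (\<lambda>n. X_at X \<zeta> (Ts n) \<omega>) \<longlonglongrightarrow> X_at X \<zeta> T \<omega>)) \<and>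
    \<comment> \<open>non-announceability of zeta on {zeta < \<infinity>, X_{zeta-} < \<infinity>}\<close>
    (\<forall>Ts. (\<forall>n. stopping_timeF F (Ts n)) \<longrightarrow>
       (\<forall>x. AE \<omega> in P x. incseq (\<lambda>n. Ts n \<omega>)) \<longrightarrow>
       negligible P {\<omega>\<in>\<Omega>. (\<forall>n. Ts n \<omega> < \<zeta> \<omega>) \<and> (\<lambda>n. Ts n \<omega>) \<longlonglongrightarrow> \<zeta> \<omega> \<and>
                              \<zeta> \<omega> < \<infinity> \<and> zeta_minus X \<zeta> \<omega> < \<infinity>})"

definition no_negative_jumps ::
  "(real \<Rightarrow> 'a measure) \<Rightarrow> ('a \<Rightarrow> ennreal) \<Rightarrow> (real \<Rightarrow> 'a \<Rightarrow> ereal) \<Rightarrow> bool" where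
  "no_negative_jumps P \<zeta> X \<longleftrightarrow>
     (\<forall>x. AE \<omega> in P x. \<forall>t>0. ennreal t < \<zeta> \<omega> \<longrightarrow>
        Lim (at_left t) (\<lambda>s. real_of_ereal (X s \<omega>)) \<le> real_of_ereal (X t \<omega>))"

definition T_minus :: "(real \<Rightarrow> 'a \<Rightarrow> ereal) \<Rightarrow> ('a \<Rightarrow> ennreal) \<Rightarrow> real \<Rightarrow> 'a \<Rightarrow> ennreal" where
  "T_minus X \<zeta> l \<omega> = Inf {ennreal t |t. 0 \<le> t \<and> ennreal t < \<zeta> \<omega> \<and> X t \<omega> \<le> ereal l}"

definition passage_hyp ::
  "(real \<Rightarrow> 'a measure) \<Rightarrow> ('a \<Rightarrow> ennreal) \<Rightarrow> (real \<Rightarrow> 'a \<Rightarrow> ereal) \<Rightarrow> real \<Rightarrow> (real \<Rightarrow> real) \<Rightarrow> bool" where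
  "passage_hyp P \<zeta> X Q \<phi> \<longleftrightarrow>
     0 \<le> Q \<and> (\<forall>q>Q. 0 < \<phi> q) \<and>
     (\<forall>l x q. l \<le> x \<and> Q < q \<longrightarrow>
        (\<integral>\<^sup>+\<omega>. ennreal (exp (- q * enn2real (T_minus X \<zeta> l \<omega>)))
               * indicator {\<omega>. T_minus X \<zeta> l \<omega> < \<zeta> \<omega>} \<omega> \<partial>P x)
        = ennreal (exp (- \<phi> q * (x - l))))"

text \<open>Laplace exponent of a spectrally positive Levy process, Levy-Khintchine form on z \<ge> 0.\<close>
definition sp_laplace_exponent :: "(real \<Rightarrow> real) \<Rightarrow> bool" where
  "sp_laplace_exponent \<psi> \<longleftrightarrow>
     (\<exists>(\<gamma>::real) (\<sigma>::real) (m::real measure).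
        0 \<le> \<sigma> \<and> sets m = sets borel \<and> emeasure m {..0} = 0 \<and>
        (\<integral>\<^sup>+h. ennreal (min (h\<^sup>2) 1) \<partial>m) < \<infinity> \<and>
        (\<forall>z\<ge>0. \<psi> z = - \<gamma> * z + \<sigma>\<^sup>2 / 2 * z\<^sup>2 +
            (\<integral>h. exp (- z * h) + z * h * indicator {0<..1} h - 1 \<partial>m)))"

text \<open>Under (P_x), X is a possibly killed spectrally positive Levy process in the filtration F,
  with Laplace exponent psi - p: there are one-dimensional laws mu_t of a spectrally positive
  Levy process (not a subordinator) with Laplace exponent psi such that, for s,t \<ge> 0, A \<in> F_s
  and Borel B,
  P_x(A, s+t < zeta, X_{s+t} - X_s \<in> B) = P_x(A, s < zeta) e^{-pt} mu_t(B),
  i.e. the increments are independent of the past, stationary with law mu_t, and killing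
  occurs at an independent exponential time of rate p.\<close>
definition killed_sp_levy ::
  "'a set \<Rightarrow> (real \<Rightarrow> 'a measure) \<Rightarrow> (real \<Rightarrow> 'a measure) \<Rightarrow> ('a \<Rightarrow> ennreal)
     \<Rightarrow> (real \<Rightarrow> 'a \<Rightarrow> ereal) \<Rightarrow> (real \<Rightarrow> real) \<Rightarrow> real \<Rightarrow> bool" where
  "killed_sp_levy \<Omega> F P \<zeta> X \<psi> p \<longleftrightarrow>
     0 \<le> p \<and> sp_laplace_exponent \<psi> \<and>
     (\<exists>\<mu>::real \<Rightarrow> real measure.
        (\<forall>t\<ge>0. prob_space (\<mu> t) \<and> sets (\<mu> t) = sets borel \<and>
           (\<forall>z\<ge>0. (\<integral>\<^sup>+y. ennreal (exp (- z * y)) \<partial>\<mu> t) = ennreal (exp (t * \<psi> z)))) \<and>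
        \<not> (\<forall>t\<ge>0. emeasure (\<mu> t) {..<0} = 0) \<and>
        (\<forall>x s t A B. 0 \<le> s \<and> 0 \<le> t \<and> A \<in> sets (F s) \<and> B \<in> sets borel \<longrightarrow>
           measure (P x) (A \<inter> {\<omega>. ennreal (s + t) < \<zeta> \<omega> \<and>
                 real_of_ereal (X (s + t) \<omega>) - real_of_ereal (X s \<omega>) \<in> B})
           = measure (P x) (A \<inter> {\<omega>. ennreal s < \<zeta> \<omega>}) * exp (- p * t) * measure (\<mu> t) B))"

definition rc_inverse :: "(real \<Rightarrow> real) \<Rightarrow> real \<Rightarrow> real" where
  "rc_inverse \<psi> y = Inf {z. 0 \<le> z \<and> y < \<psi> z}"

end

theory Submission
  imports Defs "HOL-Complex_Analysis.Complex_Analysis" "HOL-Real_Asymp.Real_Asymp"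
begin

text \<open>
  Markov's property at a fixed time t turns the hypothesis on the first passage times into
  E_x[exp (- phi(q) X_t); t < zeta] = exp (q t - phi(q) x): the contribution of paths that have passed a
  level l before t vanishes as l tends to minus infinity, because phi is strictly increasing. Since a
  measure is determined by its Laplace transform near a point, the law of X_t - X_0 on {t < zeta} does
  not depend on the starting point, so the increments are stationary and independent of the past and
  their laws form a convolution semigroup with exponentially decaying mass.

  The Levy-Khintchine form of the exponent is obtained from the measures n mu_{1/n}, which, weighted by
  (u - 1)^2 with u = exp (- y), converge weakly along a subsequence. The limit does not charge negative
  increments: the probability that no increment over a grid of mesh 1/n is below -e factorises, and it
  tends to the survival probability because the paths have no negative jumps.
\<close>

section \<open>Laplace transforms\<close>

text \<open>The transforms are two-sided and known only at the points \<open>\<phi> q\<close>. It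
  suffices that \<open>\<phi>\<close> is strictly increasing and sequentially continuous: its values
  then accumulate inside a strip where the transforms are finite. The regularity of
  \<open>\<phi>\<close> is read off from the passage from 0 to -1, whose transform is exp (- phi q)
  and whose duration is almost surely positive.

  The hypothesis speaks of an infimum over uncountably many times. Quasi left-continuity and
  non-announceability serve to replace it, almost surely, by a stopping time that inspects rational
  times only.

  The weight (u - 1)^2 is chosen because its rescaled mass tends to a second difference of the
  exponent, psi 2 - 2 psi 1, so that tightness is a matter of moments. In the weak limit, mass at u
  = 1 is the Gaussian part. Mass at u = 0 would be an upward jump of infinite size; it is excluded
  because psi tends to 0 at 0.\<close>

lemma multiplicative_bounded_imp_exp:
  fixes f :: "real \<Rightarrow> real"
  assumes pos: "\<And>t. 0 \<le> t \<Longrightarrow> 0 < f t"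
    and mult: "\<And>s t. 0 \<le> s \<Longrightarrow> 0 \<le> t \<Longrightarrow> f (s + t) = f s * f t"
    and bdd: "\<And>t. 0 \<le> t \<Longrightarrow> t \<le> 1 \<Longrightarrow> f t \<le> M"
    and t: "0 \<le> t"
  shows "f t = exp (t * ln (f 1))"
proof -
  \<comment> \<open>Subtracting the linear candidate leaves an additive function that vanishes at 1.
    It has period 1, so a bound on the unit interval is a bound everywhere.\<close>
  define d where "d t = ln (f t) - t * ln (f 1)" for t
  have d_add: "d (s + t) = d s + d t" if "0 \<le> s" "0 \<le> t" for s t
    using pos[of s] pos[of t] that by (simp add: d_def mult ln_mult algebra_simps)
  have d1: "d 1 = 0" by (simp add: d_def)
  have d0: "d 0 = 0" using d_add[of 0 0] by simp
  have d_mult: "d (of_nat n * t) = of_nat n * d t" if "0 \<le> t" for n t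
    using that by (induction n) (simp_all add: d0 d_add distrib_right)
  define K where "K = \<bar>ln M\<bar> + \<bar>ln (f 1)\<bar>"
  have bound01: "d t \<le> K" if "0 \<le> t" "t \<le> 1" for t
  proof -
    have "ln (f t) \<le> ln M" using bdd[OF that] pos[OF that(1)] by simp
    moreover have "- (t * ln (f 1)) \<le> \<bar>ln (f 1)\<bar>"
      using that mult_left_le_one_le[of "\<bar>ln (f 1)\<bar>" t] by (smt (verit) mult_minus_right mult_nonneg_nonneg)
    ultimately show ?thesis unfolding d_def K_def by linarith
  qed
  have bound: "d t \<le> K" if "0 \<le> t" for t
  proof -
    define n where "n = nat \<lfloor>t\<rfloor>"
    have n: "of_nat n \<le> t" "t - of_nat n \<le> 1" using that unfolding n_def by linarith+
    have "d t = d (of_nat n * 1 + (t - of_nat n))" by simp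
    also have "\<dots> = d (t - of_nat n)" using n d_mult[of 1 n] d1 by (subst d_add) auto
    finally show ?thesis using bound01 n by auto
  qed
  \<comment> \<open>A positive value of \<open>d\<close> would be multiplied by n at the point n * t
    and so would exceed the global bound \<open>K\<close>.\<close>
  have nonpos: "d t \<le> 0" if "0 \<le> t" for t
  proof (rule ccontr)
    assume "\<not> d t \<le> 0"
    then obtain n :: nat where "K < of_nat n * d t"
      using reals_Archimedean3[of "d t"] by (auto simp: not_le)
    moreover have "of_nat n * d t \<le> K" using bound[of "of_nat n * t"] that d_mult by auto
    ultimately show False by simp
  qed
  \<comment> \<open>The values at t and at n - t add up to \<open>d\<close> at the integer n, which
    is 0; both are nonpositive, so both vanish.\<close>
  define n where "n = nat \<lceil>t\<rceil>"
  have n: "t \<le> of_nat n" unfolding n_def by linarith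
  have "0 = d (t + (of_nat n - t))" using d_mult[of 1 n] d1 by simp
  also have "\<dots> = d t + d (of_nat n - t)" using n t by (intro d_add) auto
  finally have "d t = 0" using nonpos[OF t] nonpos[of "of_nat n - t"] n by simp
  then have "ln (f t) = t * ln (f 1)" unfolding d_def by simp
  then show ?thesis using exp_ln[OF pos[OF t]] by simp
qed

text \<open>For y \<ge> 0 the edge a dominates, for y < 0 the edge b. The margin r between s and the
  edges pays for the factor exp (|y| r), which arises from summing the norms of an exponential
  series.\<close>

lemma exp_tilt_le:
  fixes a b r s y :: real
  assumes "a + r \<le> s" "s + r \<le> b" "0 \<le> r"
  shows "exp (\<bar>y\<bar> * r - s * y) \<le> exp (- a * y) + exp (- b * y)"
proof (cases "0 \<le> y")
  case True
  have "\<bar>y\<bar> * r - s * y \<le> - a * y"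
    using True mult_right_mono[OF assms(1) True] by (simp add: algebra_simps)
  then show ?thesis by (smt (verit) exp_le_cancel_iff exp_gt_zero)
next
  case False
  then have "\<bar>y\<bar> * r - s * y \<le> - b * y"
    using mult_right_mono[OF assms(2), of "- y"] by (simp add: algebra_simps)
  then show ?thesis by (smt (verit) exp_le_cancel_iff exp_gt_zero)
qed

lemma integrable_laplace_between:
  fixes M :: "real measure"
  assumes [measurable_cong]: "sets M = sets borel"
    and int: "integrable M (\<lambda>y. exp (- a * y))" "integrable M (\<lambda>y. exp (- b * y))"
    and "a \<le> Re w" "Re w \<le> b"
  shows "integrable M (\<lambda>y. exp (- w * complex_of_real y))"
proof (rule Bochner_Integration.integrable_bound)
  show "integrable M (\<lambda>y. exp (- a * y) + exp (- b * y))" using int by (rule Bochner_Integration.integrable_add)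
  show "AE y in M. norm (exp (- w * complex_of_real y)) \<le> norm (exp (- a * y) + exp (- b * y))"
  proof (rule AE_I2)
    fix y
    show "norm (exp (- w * complex_of_real y)) \<le> norm (exp (- a * y) + exp (- b * y))"
      using exp_tilt_le[of a 0 "Re w" b y] assms(4,5) by simp
  qed
qed measurable

text \<open>Around each point of the strip the exponential series in w - w0 may be integrated term
  by term, so the transform is a power series there.\<close>

lemma laplace_transform_holomorphic:
  fixes M :: "real measure"
  assumes S[measurable_cong]: "sets M = sets borel"
    and int: "integrable M (\<lambda>y. exp (- a * y))" "integrable M (\<lambda>y. exp (- b * y))"
  shows "(\<lambda>w. \<integral>y. exp (- w * complex_of_real y) \<partial>M) holomorphic_on {w. a < Re w \<and> Re w < b}"
proof -
  let ?g = "\<lambda>w. \<integral>y. exp (- w * complex_of_real y) \<partial>M"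
  have "?g field_differentiable at w0" if w0: "a < Re w0" "Re w0 < b" for w0
  proof -
    define d where "d = min (Re w0 - a) (b - Re w0)"
    have d: "0 < d" "a + d \<le> Re w0" "Re w0 + d \<le> b" using w0 by (auto simp: d_def)
    define c where "c n = (\<integral>y. (- complex_of_real y) ^ n / fact n * exp (- w0 * complex_of_real y) \<partial>M)" for n
    have "(\<lambda>n. c n * (w - w0) ^ n) sums ?g w" if w: "w \<in> ball w0 d" for w
    proof -
      define r where "r = norm (w - w0)"
      have r: "0 \<le> r" "r < d" using w by (auto simp: r_def dist_norm norm_minus_commute)
      define f where "f n y = (- complex_of_real y) ^ n / fact n * exp (- w0 * complex_of_real y) * (w - w0) ^ n" for n y
      have f_eq: "f n y = exp (- w0 * complex_of_real y) * ((- complex_of_real y * (w - w0)) ^ n /\<^sub>R fact n)" for n y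
        unfolding f_def power_mult_distrib by (simp add: scaleR_conv_of_real divide_inverse mult_ac)
      have f_sums: "(\<lambda>n. f n y) sums exp (- w * complex_of_real y)" for y
      proof -
        have "(\<lambda>n. f n y) sums (exp (- w0 * complex_of_real y) * exp (- complex_of_real y * (w - w0)))"
          unfolding f_eq by (intro sums_mult exp_converges)
        also have "exp (- w0 * complex_of_real y) * exp (- complex_of_real y * (w - w0)) = exp (- w * complex_of_real y)"
          by (simp flip: exp_add add: algebra_simps)
        finally show ?thesis .
      qed
      have norm_f: "norm (f n y) = exp (- Re w0 * y) * ((\<bar>y\<bar> * r) ^ n /\<^sub>R fact n)" for n y
        unfolding f_eq by (simp add: norm_mult norm_power norm_divide r_def power_mult_distrib)
      \<comment> \<open>Taking norms moves r = |w - w0| into the exponent. As r stays below the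
        distance d to the edges of the strip, the two edge exponentials still dominate the
        sum.\<close>
      have norm_sums: "(\<lambda>n. norm (f n y)) sums exp (\<bar>y\<bar> * r - Re w0 * y)" for y
      proof -
        have "(\<lambda>n. norm (f n y)) sums (exp (- Re w0 * y) * exp (\<bar>y\<bar> * r))"
          unfolding norm_f by (intro sums_mult exp_converges)
        then show ?thesis by (simp flip: exp_add add: algebra_simps)
      qed
      have dom: "exp (\<bar>y\<bar> * r - Re w0 * y) \<le> exp (- a * y) + exp (- b * y)" for y
        using r d by (intro exp_tilt_le) auto
      have intab: "integrable M (\<lambda>y. exp (- a * y) + exp (- b * y))"
        using int by (rule Bochner_Integration.integrable_add)
      have part: "(\<Sum>n<N. norm (f n y)) \<le> exp (- a * y) + exp (- b * y)" for N y
      proof -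
        have "(\<Sum>n<N. norm (f n y)) \<le> (\<Sum>n. norm (f n y))"
          by (intro sum_le_suminf sums_summable[OF norm_sums]) auto
        also have "\<dots> = exp (\<bar>y\<bar> * r - Re w0 * y)" using norm_sums by (simp add: sums_iff)
        finally show ?thesis using dom[of y] by linarith
      qed
      have [measurable]: "f n \<in> borel_measurable M" for n unfolding f_def by measurable
      have intf: "integrable M (f n)" for n
      proof (rule Bochner_Integration.integrable_bound[OF intab])
        show "AE y in M. norm (f n y) \<le> norm (exp (- a * y) + exp (- b * y))"
        proof (rule AE_I2)
          fix y
          have "norm (f n y) \<le> (\<Sum>k<Suc n. norm (f k y))" by (simp add: sum_nonneg)
          then show "norm (f n y) \<le> norm (exp (- a * y) + exp (- b * y))" using part[where y=y and N="Suc n"] by simp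
        qed
      qed measurable
      have "(\<lambda>n. integral\<^sup>L M (f n)) sums (\<integral>y. (\<Sum>n. f n y) \<partial>M)"
      proof (rule sums_integral)
        show "integrable M (f n)" for n by (rule intf)
        show "AE y in M. summable (\<lambda>n. norm (f n y))" using sums_summable[OF norm_sums] by auto
        show "summable (\<lambda>n. \<integral>y. norm (f n y) \<partial>M)"
        proof (rule summableI_nonneg_bounded)
          fix N
          have "(\<Sum>n<N. \<integral>y. norm (f n y) \<partial>M) = (\<integral>y. (\<Sum>n<N. norm (f n y)) \<partial>M)"
            using intf by (subst Bochner_Integration.integral_sum) auto
          also have "\<dots> \<le> (\<integral>y. exp (- a * y) + exp (- b * y) \<partial>M)"
            using intf by (intro integral_mono intab part Bochner_Integration.integrable_sum integrable_norm) auto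
          finally show "(\<Sum>n<N. \<integral>y. norm (f n y) \<partial>M) \<le> (\<integral>y. exp (- a * y) + exp (- b * y) \<partial>M)" .
        qed auto
      qed
      moreover have "integral\<^sup>L M (f n) = c n * (w - w0) ^ n" for n
        unfolding f_def c_def by (rule integral_mult_left_zero)
      moreover have "(\<Sum>n. f n y) = exp (- w * complex_of_real y)" for y
        using f_sums by (simp add: sums_iff)
      ultimately show ?thesis by simp
    qed
    then have "?g holomorphic_on ball w0 d" by (rule power_series_holomorphic)
    then show ?thesis using d(1) by (simp add: holomorphic_on_imp_differentiable_at)
  qed
  then show ?thesis unfolding holomorphic_on_def by (auto intro: field_differentiable_at_within)
qed

text \<open>The identity theorem spreads the equality from a sequence accumulating at
  \<open>c0\<close> to the whole strip. On the vertical line through \<open>c0\<close> it becomes an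
  equality of characteristic functions.\<close>

lemma laplace_transform_unique:
  fixes M N :: "real measure"
  assumes S[measurable_cong]: "sets M = sets borel" "sets N = sets borel"
    and intM: "integrable M (\<lambda>y. exp (- a * y))" "integrable M (\<lambda>y. exp (- b * y))"
    and intN: "integrable N (\<lambda>y. exp (- a * y))" "integrable N (\<lambda>y. exp (- b * y))"
    and c0: "a < c0" "c0 < b"
    and c: "c \<longlonglongrightarrow> c0" "\<And>n. c n \<noteq> c0" "\<And>n. a < c n" "\<And>n. c n < b"
    and eq: "\<And>n. (\<integral>y. exp (- c n * y) \<partial>M) = (\<integral>y. exp (- c n * y) \<partial>N)"
    and pos: "0 < (\<integral>y. exp (- c0 * y) \<partial>M)"
  shows "M = N"
proof -
  let ?S = "{w. a < Re w \<and> Re w < b}"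
  let ?g = "\<lambda>M w. \<integral>y. exp (- w * complex_of_real y) \<partial>M"
  have real_g: "?g K (complex_of_real z) = complex_of_real (\<integral>y. exp (- z * y) \<partial>K)" for K z
  proof -
    have "?g K (complex_of_real z) = (\<integral>y. complex_of_real (exp (- z * y)) \<partial>K)"
      by (intro Bochner_Integration.integral_cong) (simp_all flip: exp_of_real)
    then show ?thesis by (simp add: integral_complex_of_real)
  qed
  have hol: "(\<lambda>w. ?g M w - ?g N w) holomorphic_on ?S"
    by (intro holomorphic_on_diff laplace_transform_holomorphic S intM intN)
  have openS: "open ?S"
    by (simp add: Collect_conj_eq open_Int open_halfspace_Re_gt open_halfspace_Re_lt)
  have convS: "convex ?S"
    by (simp add: Collect_conj_eq convex_Int convex_halfspace_Re_gt convex_halfspace_Re_lt)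
  have lim: "complex_of_real c0 islimpt (range (\<lambda>n. complex_of_real (c n)))"
    unfolding islimpt_sequential
    by (rule exI[of _ "\<lambda>n. complex_of_real (c n)"]) (use c in \<open>auto intro!: tendsto_intros\<close>)
  have "?g M w - ?g N w = 0" if "w \<in> ?S" for w
  proof (rule analytic_continuation[OF hol openS convex_connected[OF convS] _ _ lim _ that])
    fix z assume "z \<in> range (\<lambda>n. complex_of_real (c n))"
    then obtain n where "z = complex_of_real (c n)" by auto
    then show "?g M z - ?g N z = 0" unfolding \<open>z = _\<close> real_g eq by simp
  qed (use c c0 in auto)
  then have geq: "?g M w = ?g N w" if "w \<in> ?S" for w using that by auto
  define m where "m = (\<integral>y. exp (- c0 * y) \<partial>M)"
  have mN: "m = (\<integral>y. exp (- c0 * y) \<partial>N)"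
    using geq[of "complex_of_real c0"] c0 unfolding real_g m_def by simp
  have m: "0 < m" using pos by (simp add: m_def)
  \<comment> \<open>Exponential tilting by \<open>c0\<close>: the tilted measure has mass 1, and its
    characteristic function is the transform on the line Re w = c0 divided by m. The tilt is undone
    at the end by the reciprocal density.\<close>
  define D where "D K = density K (\<lambda>y. ennreal (exp (- c0 * y) / m))" for K :: "real measure"
  have intc: "integrable K (\<lambda>y. exp (- c0 * y))"
    if "sets K = sets borel" "integrable K (\<lambda>y. exp (- a * y))" "integrable K (\<lambda>y. exp (- b * y))" for K :: "real measure"
  proof -
    have "integrable K (\<lambda>y. Re (exp (- complex_of_real c0 * complex_of_real y)))"
      using c0 that by (intro integrable_Re integrable_laplace_between[where a=a and b=b]) auto
    then show ?thesis by (simp add: Re_exp)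
  qed
  have rd: "real_distribution (D K)" and char_D: "char (D K) t = ?g K (Complex c0 (-t)) / m"
    if K[measurable_cong]: "sets K = sets borel" "integrable K (\<lambda>y. exp (- c0 * y))" "m = (\<integral>y. exp (- c0 * y) \<partial>K)" for K t
  proof -
    have "emeasure (D K) (space (D K)) = (\<integral>\<^sup>+y. ennreal (exp (- c0 * y) / m) \<partial>K)"
      unfolding D_def by (subst emeasure_density) (auto simp: K sets_eq_imp_space_eq[OF K(1)] intro!: nn_integral_cong split: split_indicator)
    also have "\<dots> = ennreal (\<integral>y. exp (- c0 * y) / m \<partial>K)"
      using m K(2) by (intro nn_integral_eq_integral) auto
    also have "\<dots> = 1" using m K(3) by simp
    finally interpret prob_space "D K" by (rule prob_spaceI)
    show "real_distribution (D K)" by (standard) (simp_all add: D_def K)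
    have "char (D K) t = (\<integral>y. (exp (- c0 * y) / m) *\<^sub>R iexp (t * y) \<partial>K)"
      unfolding char_def D_def using m
      by (subst integral_density) (auto simp: K measurable_cong_sets[OF K(1) refl])
    also have "\<dots> = (\<integral>y. exp (- Complex c0 (-t) * complex_of_real y) / m \<partial>K)"
    proof (intro Bochner_Integration.integral_cong refl)
      fix y
      have e: "- Complex c0 (-t) * complex_of_real y = complex_of_real (- c0 * y) + \<i> * complex_of_real (t * y)"
        by (simp add: complex_eq_iff)
      show "(exp (- c0 * y) / m) *\<^sub>R iexp (t * y) = exp (- Complex c0 (-t) * complex_of_real y) / m"
        unfolding e exp_add exp_of_real by (simp add: scaleR_conv_of_real)
    qed
    also have "\<dots> = ?g K (Complex c0 (-t)) / m" by simp
    finally show "char (D K) t = ?g K (Complex c0 (-t)) / m" .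
  qed
  have iM: "integrable M (\<lambda>y. exp (- c0 * y))" and iN: "integrable N (\<lambda>y. exp (- c0 * y))"
    using intc S intM intN by auto
  have "D M = D N"
  proof (rule Levy_uniqueness)
    show "real_distribution (D M)" "real_distribution (D N)"
      using rd[OF S(1) iM m_def] rd[OF S(2) iN mN] by auto
    show "char (D M) = char (D N)"
      using char_D[OF S(1) iM m_def] char_D[OF S(2) iN mN] geq c0 by (intro ext) auto
  qed
  then have "density (D M) (\<lambda>y. ennreal (exp (c0 * y) * m)) = density (D N) (\<lambda>y. ennreal (exp (c0 * y) * m))"
    by simp
  moreover have "density (D K) (\<lambda>y. ennreal (exp (c0 * y) * m)) = K" if [measurable_cong]: "sets K = sets borel" for K
  proof -
    have "density (D K) (\<lambda>y. ennreal (exp (c0 * y) * m)) = density K (\<lambda>y. ennreal (exp (- c0 * y) / m) * ennreal (exp (c0 * y) * m))"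
      unfolding D_def by (subst density_density_eq) auto
    also have "(\<lambda>y. ennreal (exp (- c0 * y) / m) * ennreal (exp (c0 * y) * m)) = (\<lambda>y. 1)"
      using m by (auto simp flip: ennreal_mult exp_add simp: fun_eq_iff exp_minus field_simps)
    finally show ?thesis by (simp add: density_1)
  qed
  ultimately show "M = N" using S by metis
qed

lemma nn_laplace_convolution:
  fixes M N :: "real measure"
  assumes "finite_measure M" "finite_measure N" and [measurable_cong]: "sets M = sets borel" "sets N = sets borel"
  shows "(\<integral>\<^sup>+y. ennreal (exp (- z * y)) \<partial>(M \<star> N)) = (\<integral>\<^sup>+y. ennreal (exp (- z * y)) \<partial>M) * (\<integral>\<^sup>+y. ennreal (exp (- z * y)) \<partial>N)"
proof -
  have "(\<integral>\<^sup>+y. ennreal (exp (- z * y)) \<partial>(M \<star> N)) = (\<integral>\<^sup>+x. \<integral>\<^sup>+y. ennreal (exp (- z * (x + y))) \<partial>N \<partial>M)"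
    using assms by (intro nn_integral_convolution) auto
  also have "\<dots> = (\<integral>\<^sup>+x. \<integral>\<^sup>+y. ennreal (exp (- z * x)) * ennreal (exp (- z * y)) \<partial>N \<partial>M)"
    by (intro nn_integral_cong) (simp add: algebra_simps flip: ennreal_mult exp_add)
  also have "\<dots> = (\<integral>\<^sup>+x. ennreal (exp (- z * x)) * (\<integral>\<^sup>+y. ennreal (exp (- z * y)) \<partial>N) \<partial>M)"
    by (intro nn_integral_cong nn_integral_cmult) measurable
  also have "\<dots> = (\<integral>\<^sup>+x. ennreal (exp (- z * x)) \<partial>M) * (\<integral>\<^sup>+y. ennreal (exp (- z * y)) \<partial>N)"
    by (rule nn_integral_multc) measurable
  finally show ?thesis .
qed

section \<open>The Levy-Khintchine representation\<close>

lemma has_bochner_integral_AE_eq: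
  assumes "has_bochner_integral M f x" "g \<in> borel_measurable M" "AE u in M. f u = g u"
  shows "has_bochner_integral M g x"
  using assms has_bochner_integral_cong_AE[of f M g x]
  by (auto simp: has_bochner_integral_iff)

section \<open>The compensated power kernel\<close>

text \<open>The Levy-Khintchine kernel in the variable u = exp (- y), compensated by z (u - 1) and
  divided by the weight (u - 1)^2. The value at u = 1 is the second Taylor coefficient of u powr z
  there; it makes the quotient continuous and later yields the Gaussian term.\<close>

definition second_quotient :: "real \<Rightarrow> real \<Rightarrow> real" where
  "second_quotient z u = (if u = 1 then z * (z - 1) / 2 else (u powr z - 1 - z * (u - 1)) / (u - 1)\<^sup>2)"

lemma second_quotient_mult: "0 < u \<Longrightarrow> second_quotient z u * (u - 1)\<^sup>2 = u powr z - 1 - z * (u - 1)"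
  by (auto simp: second_quotient_def)

text \<open>For exponents z in (0,1] the power is concave and lies below its tangent at 1. This sign
  is what bounds the mass of the limit measure at u = 0.\<close>

lemma second_quotient_nonpos: 
  assumes "0 < z" "z \<le> 1" "0 \<le> u"
  shows "second_quotient z u \<le> 0"
proof (cases "u = 1")
  case True
  then show ?thesis using assms by (simp add: second_quotient_def mult_le_0_iff)
next
  case False
  have "u powr z \<le> 1 + z * (u - 1)"
  proof (cases "u = 0")
    case True
    then show ?thesis using assms by simp
  next
    case u: False
    have "exp ((1 - z) * 0 + z * ln u) \<le> (1 - z) * exp 0 + z * exp (ln u)"
      using convex_onD[OF exp_convex, of z 0 "ln u"] assms by simp
    then show ?thesis using u assms by (simp add: powr_def algebra_simps)
  qed
  then show ?thesis using False by (simp add: second_quotient_def divide_nonpos_pos)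
qed

lemma second_quotient_continuous:
  assumes "0 < z"
  shows "continuous_on {0..2} (second_quotient z)"
  unfolding continuous_on_def
proof
  fix u :: real assume u: "u \<in> {0..2}"
  let ?q = "\<lambda>u::real. (u powr z - 1 - z * (u - 1)) / (u - 1)\<^sup>2"
  have ev: "eventually (\<lambda>v. second_quotient z v = ?q v) (at u within {0..2})"
    using eventually_neq_at_within[of 1 u "{0..2}"] by eventually_elim (simp add: second_quotient_def)
  have "(?q \<longlongrightarrow> second_quotient z u) (at u within {0..2})"
  proof (cases "u = 1")
    case True
    have "(?q \<longlongrightarrow> z * (z - 1) / 2) (at 1)" by real_asymp
    then show ?thesis unfolding True by (auto simp: second_quotient_def intro: tendsto_within_subset)
  next
    case False
    have "eventually (\<lambda>v. v \<in> {0..2}) (at u within {0..2})" by (simp add: eventually_at_filter)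
    then have "eventually (\<lambda>v. 0 \<le> v) (at u within {0..2})" by eventually_elim auto
    then have "(?q \<longlongrightarrow> ?q u) (at u within {0..2})"
      using False assms by (intro tendsto_intros tendsto_powr') auto
    then show ?thesis using False by (simp add: second_quotient_def)
  qed
  then show "(second_quotient z \<longlongrightarrow> second_quotient z u) (at u within {0..2})"
    using tendsto_cong[OF ev] by simp
qed

text \<open>A bounded continuous extension to the line, fit to be a test function for weak
  convergence. The cut at 2 lies beyond (0,1], where the limit lives, and changes the integrals only
  on an upper tail that vanishes.\<close>

definition clamped_quotient :: "real \<Rightarrow> real \<Rightarrow> real" where
  "clamped_quotient z u = second_quotient z (max 0 (min 2 u))"

lemma clamped_quotient_continuous: "0 < z \<Longrightarrow> continuous_on UNIV (clamped_quotient z)"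
  unfolding clamped_quotient_def
  by (rule continuous_on_compose2[OF second_quotient_continuous]) (auto intro!: continuous_intros)

lemma clamped_quotient_bounded:
  assumes "0 < z"
  obtains B where "0 \<le> B" "\<And>u. \<bar>clamped_quotient z u\<bar> \<le> B"
proof -
  have "compact (second_quotient z ` {0..2})"
    using second_quotient_continuous[OF assms] by (intro compact_continuous_image) auto
  then obtain B where "\<And>u. u \<in> {0..2} \<Longrightarrow> \<bar>second_quotient z u\<bar> \<le> B"
    using compact_imp_bounded bounded_iff by (metis imageI real_norm_def)
  then have B: "\<bar>clamped_quotient z u\<bar> \<le> B" for u unfolding clamped_quotient_def by auto
  show ?thesis using that[OF _ B] B[of 0] by linarith
qed

text \<open>The variable is u = exp (- y), so that u powr z is the Laplace kernel and
  the half line y \<ge> 0 becomes the bounded interval (0,1].\<close>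

locale infinitely_divisible_moments =
  fixes N :: "nat \<Rightarrow> real measure" and \<psi> :: "real \<Rightarrow> real"
  assumes prob: "\<And>n. prob_space (N n)"
    and sets_N[measurable_cong]: "\<And>n. sets (N n) = sets borel"
    and pos: "\<And>n. AE u in N n. 0 < u"
    and moment: "\<And>n z. 0 \<le> z \<Longrightarrow> has_bochner_integral (N n) (\<lambda>u. u powr z) (exp (\<psi> z / Suc n))"
    and upper_tail: "\<And>a. 1 < a \<Longrightarrow> (\<lambda>n. real (Suc n) * measure (N n) {a..}) \<longlonglongrightarrow> 0"
begin

section \<open>Moments of the rescaled laws and their limits\<close>

lemma psi_0: "\<psi> 0 = 0"
proof -
  interpret prob_space "N 0" by (rule prob)
  have "has_bochner_integral (N 0) (\<lambda>u. 1) (exp (\<psi> 0))"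
    by (rule has_bochner_integral_AE_eq[OF moment[of 0 0, simplified]]) (measurable, use pos[of 0] in \<open>eventually_elim, simp\<close>)
  then have "exp (\<psi> 0) = 1" by (simp add: has_bochner_integral_iff prob_space)
  then show ?thesis by simp
qed

lemma second_moment:
  assumes a: "0 \<le> a"
  shows "has_bochner_integral (N n) (\<lambda>u. u powr a * (u - 1)\<^sup>2)
    (exp (\<psi> (a + 2) / Suc n) - 2 * exp (\<psi> (a + 1) / Suc n) + exp (\<psi> a / Suc n))"
proof (rule has_bochner_integral_AE_eq)
  show "has_bochner_integral (N n) (\<lambda>u. u powr (a + 2) - 2 * u powr (a + 1) + u powr a)
    (exp (\<psi> (a + 2) / Suc n) - 2 * exp (\<psi> (a + 1) / Suc n) + exp (\<psi> a / Suc n))"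
    using a by (intro has_bochner_integral_add has_bochner_integral_diff has_bochner_integral_mult_right moment) auto
  show "AE u in N n. u powr (a + 2) - 2 * u powr (a + 1) + u powr a = u powr a * (u - 1)\<^sup>2"
    using pos[of n] by eventually_elim (simp add: powr_add power2_eq_square algebra_simps)
qed measurable

text \<open>The coefficients 1, -2, 1 cancel at order zero, so multiplication by Suc n leaves the
  first-order terms, a second difference of psi.\<close>

lemma second_moment_limit:
  assumes a: "0 \<le> a"
  shows "(\<lambda>n. real (Suc n) * (\<integral>u. u powr a * (u - 1)\<^sup>2 \<partial>N n)) \<longlonglongrightarrow> \<psi> (a + 2) - 2 * \<psi> (a + 1) + \<psi> a"
  unfolding has_bochner_integral_integral_eq[OF second_moment[OF a]] by real_asymp

lemma second_moment_bounded:
  assumes a: "0 \<le> a"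
  obtains B where "\<And>n. real (Suc n) * (\<integral>u. u powr a * (u - 1)\<^sup>2 \<partial>N n) \<le> B"
proof -
  obtain K where "\<And>n. norm (real (Suc n) * (\<integral>u. u powr a * (u - 1)\<^sup>2 \<partial>N n)) \<le> K"
    using convergent_imp_Bseq[OF convergentI[OF second_moment_limit[OF a]]] unfolding Bseq_def by blast
  then show ?thesis using that[of K] abs_le_D1 unfolding real_norm_def by blast
qed

text \<open>Vanishing tail mass does not by itself control an unbounded weight v. The inequality v
  <= eta v^2 / 2 + 1 / (2 eta) splits the integral into a small multiple of rescaled moments
  dominating v^2, which stay bounded, and a multiple of the tail mass.\<close>

lemma second_moment_upper_tail:
  assumes z: "0 \<le> z" and a: "1 < a"
  shows "(\<lambda>n. real (Suc n) * (\<integral>u. indicator {a..} u * (u powr z * (u - 1)\<^sup>2) \<partial>N n)) \<longlonglongrightarrow> 0"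
proof (rule LIMSEQ_I)
  fix e :: real assume e: "0 < e"
  obtain B1 where B1: "\<And>n. real (Suc n) * (\<integral>u. u powr (2 * z + 2) * (u - 1)\<^sup>2 \<partial>N n) \<le> B1"
    using second_moment_bounded[of "2 * z + 2"] z by auto
  obtain B2 where B2: "\<And>n. real (Suc n) * (\<integral>u. u powr (2 * z) * (u - 1)\<^sup>2 \<partial>N n) \<le> B2"
    using second_moment_bounded[of "2 * z"] z by auto
  define B where "B = \<bar>B1\<bar> + \<bar>B2\<bar> + 1"
  \<comment> \<open>With this choice the moment part equals e / 2, and a rescaled tail mass below e
    * eta makes the other part less than e / 2.\<close>
  define \<eta> where "\<eta> = e / B"
  have B: "0 < B" by (simp add: B_def)
  then have \<eta>: "0 < \<eta>" using e by (simp add: \<eta>_def)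
  have bound: "real (Suc n) * (\<integral>u. indicator {a..} u * (u powr z * (u - 1)\<^sup>2) \<partial>N n)
      \<le> \<eta> / 2 * B + real (Suc n) * measure (N n) {a..} / (2 * \<eta>)" (is "?I \<le> _") for n
  proof -
    interpret prob_space "N n" by (rule prob)
    let ?r = "\<lambda>u. \<eta> / 2 * (u powr (2 * z + 2) * (u - 1)\<^sup>2 + u powr (2 * z) * (u - 1)\<^sup>2) + indicator {a..} u / (2 * \<eta>)"
    have i1: "integrable (N n) (\<lambda>u. u powr (2 * z + 2) * (u - 1)\<^sup>2)" "integrable (N n) (\<lambda>u. u powr (2 * z) * (u - 1)\<^sup>2)"
      "integrable (N n) (\<lambda>u. u powr z * (u - 1)\<^sup>2)"
      using second_moment[of "2 * z + 2" n] second_moment[of "2 * z" n] second_moment[of z n] z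
      by (auto simp: has_bochner_integral_iff)
    have i2: "integrable (N n) (indicator {a..} :: real \<Rightarrow> real)" by (auto simp: sets_N emeasure_eq_measure)
    have "(\<integral>u. indicator {a..} u * (u powr z * (u - 1)\<^sup>2) \<partial>N n) \<le> (\<integral>u. ?r u \<partial>N n)"
    proof (rule integral_mono_AE)
      show "integrable (N n) (\<lambda>u. indicator {a..} u * (u powr z * (u - 1)\<^sup>2))"
        by (rule Bochner_Integration.integrable_bound[OF i1(3)]) (auto split: split_indicator)
      show "integrable (N n) ?r"
        using i1 i2 by (intro Bochner_Integration.integrable_add integrable_mult_right integrable_divide)
      show "AE u in N n. indicator {a..} u * (u powr z * (u - 1)\<^sup>2) \<le> ?r u"
        using pos[of n]
      proof eventually_elim
        fix u :: real assume u: "0 < u"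
        define v where "v = u powr z * (u - 1)\<^sup>2"
        have "0 \<le> (\<eta> * v - 1)\<^sup>2 / (2 * \<eta>)" using \<eta> by simp
        then have v: "v \<le> \<eta> / 2 * v\<^sup>2 + 1 / (2 * \<eta>)" using \<eta> by (simp add: power2_eq_square field_simps)
        have "v\<^sup>2 = u powr (2 * z) * (u - 1)\<^sup>2 * (u - 1)\<^sup>2"
          unfolding v_def mult_2 powr_add by (simp add: power2_eq_square)
        also have "\<dots> \<le> u powr (2 * z) * (u - 1)\<^sup>2 * (u\<^sup>2 + 1)"
          using u by (intro mult_left_mono mult_nonneg_nonneg) (auto, simp add: power2_diff)
        also have "\<dots> = u powr (2 * z + 2) * (u - 1)\<^sup>2 + u powr (2 * z) * (u - 1)\<^sup>2"
          using u by (simp add: powr_add algebra_simps)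
        finally have \<eta>v: "\<eta> / 2 * v\<^sup>2 \<le> \<eta> / 2 * (u powr (2 * z + 2) * (u - 1)\<^sup>2 + u powr (2 * z) * (u - 1)\<^sup>2)"
          using \<eta> by (intro mult_left_mono) auto
        show "indicator {a..} u * (u powr z * (u - 1)\<^sup>2) \<le> ?r u"
        proof (cases "a \<le> u")
          case True
          then have "indicator {a..} u * (u powr z * (u - 1)\<^sup>2) = v" "indicator {a..} u / (2 * \<eta>) = 1 / (2 * \<eta>)"
            by (simp_all add: v_def)
          then show ?thesis using v \<eta>v by linarith
        qed (use \<eta> in auto)
      qed
    qed
    also have "\<dots> = \<eta> / 2 * ((\<integral>u. u powr (2 * z + 2) * (u - 1)\<^sup>2 \<partial>N n) + (\<integral>u. u powr (2 * z) * (u - 1)\<^sup>2 \<partial>N n))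
        + measure (N n) {a..} / (2 * \<eta>)"
      using i1 i2 by (simp add: sets_N sets_eq_imp_space_eq[OF sets_N])
    finally have "?I \<le> real (Suc n) * (\<eta> / 2 * ((\<integral>u. u powr (2 * z + 2) * (u - 1)\<^sup>2 \<partial>N n) + (\<integral>u. u powr (2 * z) * (u - 1)\<^sup>2 \<partial>N n))
        + measure (N n) {a..} / (2 * \<eta>))" by (rule mult_left_mono) simp
    also have "\<dots> = \<eta> / 2 * (real (Suc n) * (\<integral>u. u powr (2 * z + 2) * (u - 1)\<^sup>2 \<partial>N n) + real (Suc n) * (\<integral>u. u powr (2 * z) * (u - 1)\<^sup>2 \<partial>N n))
        + real (Suc n) * measure (N n) {a..} / (2 * \<eta>)" by (simp add: algebra_simps add_divide_distrib)
    also have "\<dots> \<le> \<eta> / 2 * B + real (Suc n) * measure (N n) {a..} / (2 * \<eta>)"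
      using \<eta> B1[of n] B2[of n] by (intro add_right_mono mult_left_mono) (auto simp: B_def)
    finally show ?thesis .
  qed
  obtain n0 where n0: "\<And>n. n \<ge> n0 \<Longrightarrow> \<bar>real (Suc n) * measure (N n) {a..}\<bar> < e * \<eta>"
    using LIMSEQ_D[OF upper_tail[OF a], of "e * \<eta>"] e \<eta> by auto
  show "\<exists>n0. \<forall>n\<ge>n0. norm (real (Suc n) * (\<integral>u. indicator {a..} u * (u powr z * (u - 1)\<^sup>2) \<partial>N n) - 0) < e"
  proof (intro exI allI impI)
    fix n assume "n0 \<le> n"
    have "real (Suc n) * measure (N n) {a..} / (2 * \<eta>) < e / 2"
      using n0[OF \<open>n0 \<le> n\<close>] \<eta> by (simp add: divide_less_eq abs_less_iff mult.commute)
    moreover have "\<eta> / 2 * B = e / 2" using B by (simp add: \<eta>_def)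
    ultimately have "real (Suc n) * (\<integral>u. indicator {a..} u * (u powr z * (u - 1)\<^sup>2) \<partial>N n) < e"
      using bound[of n] by linarith
    moreover have "0 \<le> real (Suc n) * (\<integral>u. indicator {a..} u * (u powr z * (u - 1)\<^sup>2) \<partial>N n)"
      by (intro mult_nonneg_nonneg integral_nonneg_AE) auto
    ultimately show "norm (real (Suc n) * (\<integral>u. indicator {a..} u * (u powr z * (u - 1)\<^sup>2) \<partial>N n) - 0) < e"
      by (simp only: diff_0_right real_norm_def abs_of_nonneg)
  qed
qed

text \<open>Without the clamp, the integrand is the compensated kernel and its rescaled integral is
  explicit in psi. Clamping alters the integrand only for u \<ge> 2, where the vanishing tail
  moments absorb the error.\<close>

lemma clamped_quotient_limit:
  assumes z: "0 < z"
  shows "(\<lambda>n. real (Suc n) * (\<integral>u. clamped_quotient z u * (u - 1)\<^sup>2 \<partial>N n)) \<longlonglongrightarrow> \<psi> z - z * \<psi> 1"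
proof -
  obtain B where B: "0 \<le> B" "\<And>u. \<bar>clamped_quotient z u\<bar> \<le> B" using clamped_quotient_bounded[OF z] by auto
  have [measurable]: "clamped_quotient z \<in> borel_measurable borel"
    using clamped_quotient_continuous[OF z] by (rule borel_measurable_continuous_onI)
  let ?k = "\<lambda>u::real. u powr z - 1 - z * (u - 1)"
  have k: "has_bochner_integral (N n) ?k (exp (\<psi> z / Suc n) - 1 - z * (exp (\<psi> 1 / Suc n) - 1))" for n
  proof -
    interpret prob_space "N n" by (rule prob)
    have one: "has_bochner_integral (N n) (\<lambda>u. 1) (1::real)" by (simp add: has_bochner_integral_iff prob_space)
    have "has_bochner_integral (N n) (\<lambda>u. u powr z - 1 - z * (u powr 1 - 1)) (exp (\<psi> z / Suc n) - 1 - z * (exp (\<psi> 1 / Suc n) - 1))"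
      using z by (intro has_bochner_integral_diff has_bochner_integral_mult_right moment one) auto
    then show ?thesis
      by (rule has_bochner_integral_AE_eq) (measurable, use pos[of n] in \<open>eventually_elim, simp\<close>)
  qed
  have lim1: "(\<lambda>n. real (Suc n) * (\<integral>u. ?k u \<partial>N n)) \<longlonglongrightarrow> \<psi> z - z * \<psi> 1"
    unfolding has_bochner_integral_integral_eq[OF k] by real_asymp
  \<comment> \<open>Collects the constants valid for u \<ge> 2: 1 + z bounds the constant and linear
    terms of the kernel by multiples of (u - 1)^2, and \<open>B\<close> bounds the clamped
    quotient.\<close>
  define C where "C = 1 + z + B"
  have sq: "integrable (N n) (\<lambda>u. (u - 1)\<^sup>2)" for n
  proof -
    have "has_bochner_integral (N n) (\<lambda>u. (u - 1)\<^sup>2) (exp (\<psi> (0 + 2) / Suc n) - 2 * exp (\<psi> (0 + 1) / Suc n) + exp (\<psi> 0 / Suc n))"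
      by (rule has_bochner_integral_AE_eq[OF second_moment[of 0 n, OF order_refl]]) (measurable, use pos[of n] in \<open>eventually_elim, simp\<close>)
    then show ?thesis by (simp add: has_bochner_integral_iff)
  qed
  have intf: "integrable (N n) (\<lambda>u. clamped_quotient z u * (u - 1)\<^sup>2)" for n
  proof (rule Bochner_Integration.integrable_bound)
    show "integrable (N n) (\<lambda>u. B * (u - 1)\<^sup>2)" using sq by (rule integrable_mult_right)
    show "AE u in N n. norm (clamped_quotient z u * (u - 1)\<^sup>2) \<le> norm (B * (u - 1)\<^sup>2)"
      using B by (auto simp: abs_mult intro!: mult_right_mono)
  qed measurable
  have inti: "integrable (N n) (\<lambda>u. indicator {2..} u * (u powr a * (u - 1)\<^sup>2))" if "0 \<le> a" for a n
    by (rule Bochner_Integration.integrable_bound[of _ "\<lambda>u. u powr a * (u - 1)\<^sup>2"])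
      (use second_moment[OF that, of n] in \<open>auto simp: has_bochner_integral_iff split: split_indicator\<close>)
  let ?d = "\<lambda>n. real (Suc n) * (\<integral>u. ?k u \<partial>N n) - real (Suc n) * (\<integral>u. clamped_quotient z u * (u - 1)\<^sup>2 \<partial>N n)"
  have "?d \<longlonglongrightarrow> 0"
  proof (rule Lim_null_comparison)
    show "(\<lambda>n. C * (real (Suc n) * (\<integral>u. indicator {2..} u * (u powr 0 * (u - 1)\<^sup>2) \<partial>N n)
       + real (Suc n) * (\<integral>u. indicator {2..} u * (u powr z * (u - 1)\<^sup>2) \<partial>N n))) \<longlonglongrightarrow> 0"
      using z by (intro tendsto_mult_right_zero tendsto_add_zero second_moment_upper_tail) auto
    show "\<forall>\<^sub>F n in sequentially. norm (?d n) \<le> C * (real (Suc n) * (\<integral>u. indicator {2..} u * (u powr 0 * (u - 1)\<^sup>2) \<partial>N n)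
       + real (Suc n) * (\<integral>u. indicator {2..} u * (u powr z * (u - 1)\<^sup>2) \<partial>N n))"
    proof (rule always_eventually, rule allI)
      fix n
      have "?d n = real (Suc n) * (\<integral>u. ?k u - clamped_quotient z u * (u - 1)\<^sup>2 \<partial>N n)"
        using k[of n] intf[of n] unfolding right_diff_distrib[symmetric]
        by (subst Bochner_Integration.integral_diff) (auto simp: has_bochner_integral_iff)
      then have "norm (?d n) = real (Suc n) * \<bar>\<integral>u. ?k u - clamped_quotient z u * (u - 1)\<^sup>2 \<partial>N n\<bar>"
        by (simp add: abs_mult)
      also have "\<dots> \<le> real (Suc n) * (\<integral>u. C * (indicator {2..} u * (u powr 0 * (u - 1)\<^sup>2) + indicator {2..} u * (u powr z * (u - 1)\<^sup>2)) \<partial>N n)"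
      proof (intro mult_left_mono order_trans[OF integral_abs_bound] integral_mono_AE)
        show "integrable (N n) (\<lambda>u. \<bar>?k u - clamped_quotient z u * (u - 1)\<^sup>2\<bar>)"
          using k[of n] intf by (auto simp: has_bochner_integral_iff)
        show "integrable (N n) (\<lambda>u. C * (indicator {2..} u * (u powr 0 * (u - 1)\<^sup>2) + indicator {2..} u * (u powr z * (u - 1)\<^sup>2)))"
          using z by (intro integrable_mult_right Bochner_Integration.integrable_add inti) auto
        show "AE u in N n. \<bar>?k u - clamped_quotient z u * (u - 1)\<^sup>2\<bar>
          \<le> C * (indicator {2..} u * (u powr 0 * (u - 1)\<^sup>2) + indicator {2..} u * (u powr z * (u - 1)\<^sup>2))"
          using pos[of n]
        proof eventually_elim
          fix u :: real assume u: "0 < u"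
          show "\<bar>?k u - clamped_quotient z u * (u - 1)\<^sup>2\<bar>
            \<le> C * (indicator {2..} u * (u powr 0 * (u - 1)\<^sup>2) + indicator {2..} u * (u powr z * (u - 1)\<^sup>2))"
          proof (cases "u < 2")
            case True
            then have "clamped_quotient z u = second_quotient z u" using u by (simp add: clamped_quotient_def)
            then show ?thesis using second_quotient_mult[OF u, of z] True by simp
          next
            case False
            have sq1: "1 \<le> (u - 1)\<^sup>2" "u - 1 \<le> (u - 1)\<^sup>2"
              using False mult_mono[of 1 "u - 1" 1 "u - 1"] mult_right_mono[of 1 "u - 1" "u - 1"] by (auto simp: power2_eq_square)
            have "\<bar>?k u\<bar> \<le> u powr z + 1 + z * (u - 1)"
              using False z mult_nonneg_nonneg[of z "u - 1"] powr_ge_zero[of u z] by linarith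
            also have "\<dots> \<le> u powr z * (u - 1)\<^sup>2 + (u - 1)\<^sup>2 + z * (u - 1)\<^sup>2"
              using sq1 z mult_left_mono[OF sq1(1), of "u powr z"] by (intro add_mono mult_left_mono) auto
            finally have "\<bar>?k u\<bar> \<le> u powr z * (u - 1)\<^sup>2 + (1 + z) * (u - 1)\<^sup>2" by (simp add: algebra_simps)
            moreover have "\<bar>clamped_quotient z u * (u - 1)\<^sup>2\<bar> \<le> B * (u - 1)\<^sup>2"
              using B(2)[of u] by (simp add: abs_mult mult_right_mono)
            moreover have "u powr z * (u - 1)\<^sup>2 \<le> C * (u powr z * (u - 1)\<^sup>2)"
              using B z mult_right_mono[of 1 C "u powr z * (u - 1)\<^sup>2"] by (simp add: C_def)
            ultimately have "\<bar>?k u - clamped_quotient z u * (u - 1)\<^sup>2\<bar> \<le> C * (u - 1)\<^sup>2 + C * (u powr z * (u - 1)\<^sup>2)"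
              by (simp add: C_def distrib_right)
            then show ?thesis using False u by (simp add: distrib_left)
          qed
        qed
      qed auto
      also have "\<dots> = C * (real (Suc n) * (\<integral>u. indicator {2..} u * (u powr 0 * (u - 1)\<^sup>2) \<partial>N n)
       + real (Suc n) * (\<integral>u. indicator {2..} u * (u powr z * (u - 1)\<^sup>2) \<partial>N n))"
        using inti[of 0 n] inti[of z n] z by (simp add: algebra_simps del: powr_zero_eq_one)
      finally show "norm (?d n) \<le> \<dots>" .
    qed
  qed
  from tendsto_diff[OF lim1 this] show ?thesis by simp
qed

lemma square_integral:
  "has_bochner_integral (N n) (\<lambda>u. (u - 1)\<^sup>2) (exp (\<psi> 2 / Suc n) - 2 * exp (\<psi> 1 / Suc n) + 1)"
proof -
  have "has_bochner_integral (N n) (\<lambda>u. (u - 1)\<^sup>2) (exp (\<psi> (0 + 2) / Suc n) - 2 * exp (\<psi> (0 + 1) / Suc n) + exp (\<psi> 0 / Suc n))"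
    by (rule has_bochner_integral_AE_eq[OF second_moment[of 0 n, OF order_refl]])
      (measurable, use pos[of n] in \<open>eventually_elim, simp\<close>)
  then show ?thesis by (simp add: psi_0)
qed

lemma variance_integral:
  "has_bochner_integral (N 0) (\<lambda>u. (u - exp (\<psi> 1))\<^sup>2) (exp (\<psi> 2) - exp (2 * \<psi> 1))"
proof -
  interpret prob_space "N 0" by (rule prob)
  let ?m = "exp (\<psi> 1)"
  have one: "has_bochner_integral (N 0) (\<lambda>u. ?m\<^sup>2) (?m\<^sup>2)" by (simp add: has_bochner_integral_iff prob_space)
  have "has_bochner_integral (N 0) (\<lambda>u. u powr 2 - (2 * ?m) * u powr 1 + ?m\<^sup>2) (exp (\<psi> 2 / Suc 0) - (2 * ?m) * exp (\<psi> 1 / Suc 0) + ?m\<^sup>2)"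
    by (intro has_bochner_integral_add has_bochner_integral_diff has_bochner_integral_mult_right moment one) auto
  moreover have "exp (\<psi> 2 / Suc 0) - (2 * ?m) * exp (\<psi> 1 / Suc 0) + ?m\<^sup>2 = exp (\<psi> 2) - exp (2 * \<psi> 1)"
    by (simp add: power2_eq_square exp_double)
  ultimately have "has_bochner_integral (N 0) (\<lambda>u. u powr 2 - (2 * ?m) * u powr 1 + ?m\<^sup>2) (exp (\<psi> 2) - exp (2 * \<psi> 1))"
    by metis
  then show ?thesis
    by (rule has_bochner_integral_AE_eq)
      (measurable, use pos[of 0] in \<open>eventually_elim, simp add: power2_eq_square algebra_simps\<close>)
qed

lemma psi_superadditive: "2 * \<psi> 1 \<le> \<psi> 2"
proof -
  have "0 \<le> (\<integral>u. (u - exp (\<psi> 1))\<^sup>2 \<partial>N 0)" by (intro integral_nonneg_AE) auto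
  then show ?thesis using has_bochner_integral_integral_eq[OF variance_integral] by simp
qed

text \<open>The equality says that u has variance 0 under \<open>N 0\<close>. Then u is almost
  surely the constant exp (psi 1), and the process is a pure drift.\<close>

lemma psi_degenerate:
  assumes eq: "\<psi> 2 = 2 * \<psi> 1" and z: "0 \<le> z"
  shows "\<psi> z = z * \<psi> 1"
proof -
  interpret prob_space "N 0" by (rule prob)
  have "AE u in N 0. (u - exp (\<psi> 1))\<^sup>2 = 0"
    using variance_integral eq
    by (subst integral_nonneg_eq_0_iff_AE[symmetric]) (auto simp: has_bochner_integral_iff)
  then have ae: "AE u in N 0. u powr z = exp (z * \<psi> 1)"
    by eventually_elim (auto simp: powr_def)
  have "exp (\<psi> z) = (\<integral>u. u powr z \<partial>N 0)" using moment[OF z, of 0] by (simp add: has_bochner_integral_iff)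
  also have "\<dots> = (\<integral>u. exp (z * \<psi> 1) \<partial>N 0)" using ae by (intro integral_cong_AE) auto
  also have "\<dots> = exp (z * \<psi> 1)" by (simp add: prob_space)
  finally show ?thesis by simp
qed

text \<open>Since u > 0 almost surely, u powr (1/k) tends to 1, dominated by 1 + u. This continuity
  at 0 later excludes mass of the limit measure at u = 0.\<close>

lemma psi_tendsto_0: "(\<lambda>k. \<psi> (1 / real (Suc k))) \<longlonglongrightarrow> 0"
proof -
  interpret prob_space "N 0" by (rule prob)
  have int_e: "(\<integral>u. u powr (1 / real (Suc k)) \<partial>N 0) = exp (\<psi> (1 / real (Suc k)))" for k
    using moment[of "1 / real (Suc k)" 0] by (simp add: has_bochner_integral_iff)
  have "(\<lambda>k. \<integral>u. u powr (1 / real (Suc k)) \<partial>N 0) \<longlonglongrightarrow> (\<integral>u. 1 \<partial>N 0)"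
  proof (rule integral_dominated_convergence)
    show "integrable (N 0) (\<lambda>u. 1 + u powr 1)"
      using moment[of 1 0] by (auto simp: has_bochner_integral_iff)
    show "AE u in N 0. (\<lambda>k. u powr (1 / real (Suc k))) \<longlonglongrightarrow> 1"
      using pos[of 0]
    proof eventually_elim
      fix u :: real assume u: "0 < u"
      have "(\<lambda>k. 1 / real (Suc k)) \<longlonglongrightarrow> 0" by real_asymp
      from tendsto_powr[OF tendsto_const this, of u] show "(\<lambda>k. u powr (1 / real (Suc k))) \<longlonglongrightarrow> 1" using u by simp
    qed
    show "AE u in N 0. norm (u powr (1 / real (Suc k))) \<le> 1 + u powr 1" for k
      using pos[of 0]
    proof eventually_elim
      fix u :: real assume u: "0 < u"
      show "norm (u powr (1 / real (Suc k))) \<le> 1 + u powr 1"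
      proof (cases "u \<le> 1")
        case True
        then have "u powr (1 / real (Suc k)) \<le> 1" using u by (intro powr_le1) auto
        then show ?thesis using u by simp
      next
        case False
        then have "u powr (1 / real (Suc k)) \<le> u powr 1" by (intro powr_mono) auto
        then show ?thesis by simp
      qed
    qed
  qed measurable
  then have "(\<lambda>k. exp (\<psi> (1 / real (Suc k)))) \<longlonglongrightarrow> 1" unfolding int_e by (simp add: prob_space)
  from tendsto_ln[OF this] show ?thesis by simp
qed

text \<open>The measures \<open>N n\<close> weighted by (u - 1)^2 and normalised are tight, and
  along a convergent subsequence the clamped quotients pass to the limit. The support is then cut
  down on both sides: nothing outside [0,1] by the vanishing upper tails, nothing at 0 by the
  behaviour of psi near 0.\<close>

lemma limit_measure_exists:
  assumes nondeg: "2 * \<psi> 1 < \<psi> 2"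
  obtains R where "real_distribution R" "AE u in R. u \<in> {0<..1}"
    "\<And>z. 0 < z \<Longrightarrow> \<psi> z - z * \<psi> 1 = (\<psi> 2 - 2 * \<psi> 1) * (\<integral>u. clamped_quotient z u \<partial>R)"
proof -
  define g where "g n = real (Suc n) * (\<integral>u. (u - 1)\<^sup>2 \<partial>N n)" for n
  define G where "G = \<psi> 2 - 2 * \<psi> 1"
  have G: "0 < G" using nondeg by (simp add: G_def)
  have g_eq: "g n = real (Suc n) * (exp (\<psi> 2 / Suc n) - 2 * exp (\<psi> 1 / Suc n) + 1)" for n
    unfolding g_def has_bochner_integral_integral_eq[OF square_integral] ..
  have g_lim: "g \<longlonglongrightarrow> G" unfolding g_eq G_def by real_asymp
  \<comment> \<open>Strict inequality of the exponents makes the expression larger than the square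
    of exp (psi 1 / Suc n) - 1, so the normalisation never divides by 0.\<close>
  have g_pos: "0 < g n" for n
  proof -
    have "2 * (\<psi> 1 / Suc n) < \<psi> 2 / Suc n" using nondeg by (simp add: divide_strict_right_mono)
    then have "exp (\<psi> 1 / Suc n) * exp (\<psi> 1 / Suc n) < exp (\<psi> 2 / Suc n)"
      by (metis exp_add exp_less_mono mult_2)
    moreover have "0 \<le> (exp (\<psi> 1 / Suc n) - 1)\<^sup>2" by simp
    ultimately have "0 < exp (\<psi> 2 / Suc n) - 2 * exp (\<psi> 1 / Suc n) + 1"
      unfolding power2_eq_square by (simp add: algebra_simps)
    then show ?thesis unfolding g_eq by simp
  qed
  define R where "R n = density (N n) (\<lambda>u. ennreal (real (Suc n) * (u - 1)\<^sup>2 / g n))" for n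
  have sets_R[measurable_cong]: "sets (R n) = sets borel" for n by (simp add: R_def sets_N)
  have space_R: "space (R n) = UNIV" for n using sets_eq_imp_space_eq[OF sets_R] by simp
  have int_R: "integral\<^sup>L (R n) f = real (Suc n) / g n * (\<integral>u. f u * (u - 1)\<^sup>2 \<partial>N n)"
    if [measurable]: "f \<in> borel_measurable borel" for n and f :: "real \<Rightarrow> real"
  proof -
    have "integral\<^sup>L (R n) f = (\<integral>u. real (Suc n) * (u - 1)\<^sup>2 / g n * f u \<partial>N n)"
      unfolding R_def using g_pos[of n] by (subst integral_real_density) (auto simp: less_imp_le)
    also have "\<dots> = (\<integral>u. real (Suc n) / g n * (f u * (u - 1)\<^sup>2) \<partial>N n)"
      by (intro Bochner_Integration.integral_cong) auto
    finally show ?thesis by simp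
  qed
  have sq: "integrable (N n) (\<lambda>u. (u - 1)\<^sup>2)" for n using square_integral[of n] by (simp add: has_bochner_integral_iff)
  have R_prob: "prob_space (R n)" for n
  proof
    have "emeasure (R n) (space (R n)) = (\<integral>\<^sup>+u. ennreal (real (Suc n) * (u - 1)\<^sup>2 / g n) \<partial>N n)"
      unfolding R_def by (subst emeasure_density) (auto intro!: nn_integral_cong split: split_indicator)
    also have "\<dots> = ennreal (\<integral>u. real (Suc n) * (u - 1)\<^sup>2 / g n \<partial>N n)"
      using g_pos[of n] sq[of n] by (intro nn_integral_eq_integral) (auto simp: less_imp_le)
    also have "(\<integral>u. real (Suc n) * (u - 1)\<^sup>2 / g n \<partial>N n) = 1"
    proof -
      have "(\<integral>u. real (Suc n) * (u - 1)\<^sup>2 / g n \<partial>N n) = g n / g n" unfolding g_def[of n] by simp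
      also have "\<dots> = 1" using g_pos[of n] by simp
      finally show ?thesis .
    qed
    finally show "emeasure (R n) (space (R n)) = 1" by simp
  qed
  have R_rd: "real_distribution (R n)" for n
    unfolding real_distribution_def real_distribution_axioms_def using R_prob sets_R by auto
  have R_nonneg: "AE u in R n. 0 < u" for n
    unfolding R_def using pos[of n] by (subst AE_density) (auto elim: eventually_mono)
  have tight: "tight R"
    unfolding tight_def
  proof (intro conjI allI impI R_rd)
    fix e :: real assume e: "0 < e"
    have "(\<lambda>n. real (Suc n) * (\<integral>u. u powr 2 * (u - 1)\<^sup>2 \<partial>N n) / g n) \<longlonglongrightarrow> (\<psi> (2 + 2) - 2 * \<psi> (2 + 1) + \<psi> 2) / G"
      using G by (intro tendsto_divide second_moment_limit g_lim) auto
    from convergent_imp_Bseq[OF convergentI[OF this]]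
    obtain K where K: "0 < K" "\<And>n. norm (real (Suc n) * (\<integral>u. u powr 2 * (u - 1)\<^sup>2 \<partial>N n) / g n) \<le> K"
      unfolding Bseq_def by blast
    \<comment> \<open>Any b > 1 with K / b < e works in this Markov inequality: for u > b > 1 the
      factor u^2 / b is at least 1.\<close>
    define b where "b = 1 + 2 * K / e"
    have b: "1 < b" "K / b < e" using K(1) e by (auto simp: b_def field_simps intro!: add_pos_pos mult_pos_pos)
    show "\<exists>a b. a < b \<and> (\<forall>n. 1 - e < measure (R n) {a<..b})"
    proof (rule exI[of _ 0], rule exI[of _ b], intro conjI allI)
      fix n
      interpret R: prob_space "R n" by (rule R_prob)
      have i2: "integrable (N n) (\<lambda>u. u powr 2 * (u - 1)\<^sup>2)" using second_moment[of 2 n] by (simp add: has_bochner_integral_iff)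
      have "measure (R n) {0<..b} = 1 - measure (R n) (space (R n) - {0<..b})"
        using R.prob_compl[of "{0<..b}"] by (simp add: sets_R)
      moreover have "measure (R n) (space (R n) - {0<..b}) < e"
      proof -
        have "measure (R n) (space (R n) - {0<..b}) = measure (R n) {b<..}"
        proof (rule R.finite_measure_eq_AE)
          show "AE u in R n. (u \<in> space (R n) - {0<..b}) = (u \<in> {b<..})"
            using R_nonneg[of n] by eventually_elim (auto simp: space_R)
        qed (auto simp: sets_R space_R)
        also have "\<dots> = (\<integral>u. indicator {b<..} u \<partial>R n)" by (simp add: sets_R space_R)
        also have "\<dots> = real (Suc n) / g n * (\<integral>u. indicator {b<..} u * (u - 1)\<^sup>2 \<partial>N n)"
          by (subst int_R) auto
        also have "\<dots> \<le> real (Suc n) / g n * (\<integral>u. u powr 2 * (u - 1)\<^sup>2 / b \<partial>N n)"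
        proof (intro mult_left_mono integral_mono)
          show "integrable (N n) (\<lambda>u. indicator {b<..} u * (u - 1)\<^sup>2)"
            by (rule Bochner_Integration.integrable_bound[OF sq[of n]]) (auto split: split_indicator)
          show "integrable (N n) (\<lambda>u. u powr 2 * (u - 1)\<^sup>2 / b)" using i2 by simp
          fix u
          show "indicator {b<..} u * (u - 1)\<^sup>2 \<le> u powr 2 * (u - 1)\<^sup>2 / b"
          proof (cases "b < u")
            case True
            have "b \<le> u * u" using True b(1) mult_mono[of 1 u b u] by simp
            then have "1 \<le> u powr 2 / b" using b True by (simp add: power2_eq_square)
            then show ?thesis using True mult_right_mono[of 1 "u powr 2 / b" "(u - 1)\<^sup>2"] by simp
          qed (use b in auto)
        qed (use g_pos[of n] in auto)
        also have "\<dots> = (real (Suc n) * (\<integral>u. u powr 2 * (u - 1)\<^sup>2 \<partial>N n) / g n) / b" by simp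
        also have "\<dots> \<le> K / b" using K(2)[of n] b unfolding real_norm_def by (intro divide_right_mono) linarith+
        finally show ?thesis using b by simp
      qed
      ultimately show "1 - e < measure (R n) {0<..b}" by simp
    qed (use b in auto)
  qed
  obtain r M where r: "strict_mono (r :: nat \<Rightarrow> nat)" and M: "real_distribution M" "weak_conv_m (R \<circ> id \<circ> r) M"
    using tight_imp_convergent_subsubsequence[OF tight strict_mono_id] by auto
  interpret M: real_distribution M by fact
  have wc: "(\<lambda>n. integral\<^sup>L (R (r n)) f) \<longlonglongrightarrow> integral\<^sup>L M f"
    if "continuous_on UNIV f" "\<And>u. \<bar>f u\<bar> \<le> B" for f :: "real \<Rightarrow> real" and B
  proof -
    have "(\<lambda>n. integral\<^sup>L ((R \<circ> id \<circ> r) n) f) \<longlonglongrightarrow> integral\<^sup>L M f"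
      using R_rd M that
      by (intro weak_conv_imp_integral_bdd_continuous_conv[of "R \<circ> id \<circ> r" M f B])
        (auto simp: continuous_on_eq_continuous_at)
    then show ?thesis by simp
  qed
  have rep: "\<psi> z - z * \<psi> 1 = G * (\<integral>u. clamped_quotient z u \<partial>M)" if z: "0 < z" for z
  proof -
    obtain B where B: "0 \<le> B" "\<And>u. \<bar>clamped_quotient z u\<bar> \<le> B" using clamped_quotient_bounded[OF z] by auto
    have [measurable]: "clamped_quotient z \<in> borel_measurable borel"
      using clamped_quotient_continuous[OF z] by (rule borel_measurable_continuous_onI)
    have "(\<lambda>n. g (r n) * integral\<^sup>L (R (r n)) (clamped_quotient z)) \<longlonglongrightarrow> G * integral\<^sup>L M (clamped_quotient z)"
      using LIMSEQ_subseq_LIMSEQ[OF g_lim r] wc[OF clamped_quotient_continuous[OF z] B(2)]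
      by (intro tendsto_mult) (auto simp: o_def)
    moreover have "g (r n) * integral\<^sup>L (R (r n)) (clamped_quotient z)
        = real (Suc (r n)) * (\<integral>u. clamped_quotient z u * (u - 1)\<^sup>2 \<partial>N (r n))" for n
      using g_pos[of "r n"] by (subst int_R) auto
    moreover have "(\<lambda>n. real (Suc (r n)) * (\<integral>u. clamped_quotient z u * (u - 1)\<^sup>2 \<partial>N (r n))) \<longlonglongrightarrow> \<psi> z - z * \<psi> 1"
      using LIMSEQ_subseq_LIMSEQ[OF clamped_quotient_limit[OF z] r] by (simp add: o_def)
    ultimately show ?thesis using LIMSEQ_unique by auto
  qed
  have supp: "AE u in M. u \<in> {0..1}"
  proof -
    \<comment> \<open>A bounded continuous function, zero on [0,1] and positive elsewhere, so a
      vanishing integral gives the support. On u > 0 it is at most e below 1 + e, and beyond that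
      the tail moment takes over.\<close>
    define h :: "real \<Rightarrow> real" where "h u = min 1 (max 0 (max (-u) (u - 1)))" for u
    have h: "continuous_on UNIV h" "\<And>u. \<bar>h u\<bar> \<le> 1" unfolding h_def by (auto intro!: continuous_intros)
    have [measurable]: "h \<in> borel_measurable borel" using h(1) by (rule borel_measurable_continuous_onI)
    have alg: "c / y * (e * I + J) = e * (c * I) / y + c * J / y" for c y e I J :: real
      by (simp add: add_divide_distrib algebra_simps)
    have le: "integral\<^sup>L M h \<le> e" if e: "0 < e" for e
    proof (rule LIMSEQ_le)
      show "(\<lambda>n. integral\<^sup>L (R (r n)) h) \<longlonglongrightarrow> integral\<^sup>L M h" using h by (rule wc)
      let ?t = "\<lambda>n. e + real (Suc n) * (\<integral>u. indicator {1+e..} u * (u powr 0 * (u - 1)\<^sup>2) \<partial>N n) / g n"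
      have "?t \<longlonglongrightarrow> e + 0 / G"
        using e G by (intro tendsto_add tendsto_const tendsto_divide second_moment_upper_tail g_lim) auto
      from LIMSEQ_subseq_LIMSEQ[OF this r] show "(\<lambda>n. ?t (r n)) \<longlonglongrightarrow> e" by (simp add: o_def)
      show "\<exists>K. \<forall>n\<ge>K. integral\<^sup>L (R (r n)) h \<le> ?t (r n)"
      proof (intro exI allI impI)
        fix n
        let ?n = "r n"
        have it: "integrable (N ?n) (\<lambda>u. indicator {1+e..} u * (u powr 0 * (u - 1)\<^sup>2))"
          by (rule Bochner_Integration.integrable_bound[OF sq]) (auto split: split_indicator)
        have "integral\<^sup>L (R ?n) h = real (Suc ?n) / g ?n * (\<integral>u. h u * (u - 1)\<^sup>2 \<partial>N ?n)" by (rule int_R) measurable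
        also have "\<dots> \<le> real (Suc ?n) / g ?n * (\<integral>u. e * (u - 1)\<^sup>2 + indicator {1+e..} u * (u powr 0 * (u - 1)\<^sup>2) \<partial>N ?n)"
        proof (intro mult_left_mono integral_mono_AE)
          show "integrable (N ?n) (\<lambda>u. h u * (u - 1)\<^sup>2)"
            by (rule Bochner_Integration.integrable_bound[OF sq]) (use h(2) in \<open>auto simp: abs_mult intro!: mult_left_le_one_le\<close>)
          show "integrable (N ?n) (\<lambda>u. e * (u - 1)\<^sup>2 + indicator {1+e..} u * (u powr 0 * (u - 1)\<^sup>2))"
            using it sq by (intro Bochner_Integration.integrable_add integrable_mult_right)
          show "AE u in N ?n. h u * (u - 1)\<^sup>2 \<le> e * (u - 1)\<^sup>2 + indicator {1+e..} u * (u powr 0 * (u - 1)\<^sup>2)"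
            using pos[of ?n]
          proof eventually_elim
            fix u :: real assume u: "0 < u"
            have "h u \<le> e + indicator {1+e..} u" using u e by (auto simp: h_def split: split_indicator)
            from mult_right_mono[OF this, of "(u - 1)\<^sup>2"] show "h u * (u - 1)\<^sup>2 \<le> e * (u - 1)\<^sup>2 + indicator {1+e..} u * (u powr 0 * (u - 1)\<^sup>2)"
              using u by (simp add: distrib_right)
          qed
        qed (use g_pos[of ?n] in auto)
        also have "\<dots> = real (Suc ?n) / g ?n * (e * (\<integral>u. (u - 1)\<^sup>2 \<partial>N ?n) + (\<integral>u. indicator {1+e..} u * (u powr 0 * (u - 1)\<^sup>2) \<partial>N ?n))"
          using sq it by (subst Bochner_Integration.integral_add) auto
        also have "\<dots> = e * g ?n / g ?n + real (Suc ?n) * (\<integral>u. indicator {1+e..} u * (u powr 0 * (u - 1)\<^sup>2) \<partial>N ?n) / g ?n"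
          unfolding alg g_def[of ?n, symmetric] ..
        also have "\<dots> = ?t ?n" using g_pos[of ?n] by simp
        finally show "integral\<^sup>L (R ?n) h \<le> ?t ?n" .
      qed
    qed
    have h_nonneg: "0 \<le> h u" for u by (simp add: h_def)
    have inth: "integrable M h" by (rule M.integrable_const_bound[of _ 1]) (use h in auto)
    have "integral\<^sup>L M h = 0"
      using le field_le_epsilon[of "integral\<^sup>L M h" 0] h_nonneg by (intro antisym integral_nonneg_AE) auto
    then have "AE u in M. h u = 0"
      using integral_nonneg_eq_0_iff_AE[OF inth] h_nonneg by auto
    then show ?thesis by eventually_elim (auto simp: h_def min_def max_def split: if_splits)
  qed
  \<comment> \<open>For z \<le> 1 the quotient is nonpositive, and at u = 0 it equals z - 1. The
    representation therefore bounds (1 - z) times the mass at 0 by (z psi 1 - psi z) / G, which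
    tends to 0 with z.\<close>
  have "measure M {0} \<le> 0"
  proof (rule LIMSEQ_le)
    let ?z = "\<lambda>k. 1 / real (Suc k)"
    have z0: "?z \<longlonglongrightarrow> 0" by real_asymp
    have "(\<lambda>k. measure M {0} * (1 - ?z k)) \<longlonglongrightarrow> measure M {0} * (1 - 0)"
      by (intro tendsto_intros z0)
    then show "(\<lambda>k. measure M {0} * (1 - ?z k)) \<longlonglongrightarrow> measure M {0}" by simp
    have "(\<lambda>k. (?z k * \<psi> 1 - \<psi> (?z k)) / G) \<longlonglongrightarrow> (0 * \<psi> 1 - 0) / G"
      using G by (intro tendsto_intros z0 psi_tendsto_0) auto
    then show "(\<lambda>k. (?z k * \<psi> 1 - \<psi> (?z k)) / G) \<longlonglongrightarrow> 0" by simp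
    show "\<exists>K. \<forall>k\<ge>K. measure M {0} * (1 - ?z k) \<le> (?z k * \<psi> 1 - \<psi> (?z k)) / G"
    proof (intro exI allI impI)
      fix k :: nat
      define z where "z = ?z k"
      have z: "0 < z" "z \<le> 1" by (auto simp: z_def)
      obtain B where B: "0 \<le> B" "\<And>u. \<bar>clamped_quotient z u\<bar> \<le> B" using clamped_quotient_bounded[OF z(1)] by auto
      have [measurable]: "clamped_quotient z \<in> borel_measurable borel"
        using clamped_quotient_continuous[OF z(1)] by (rule borel_measurable_continuous_onI)
      have "(\<integral>u. clamped_quotient z u \<partial>M) \<le> (\<integral>u. (z - 1) * indicator {0} u \<partial>M)"
      proof (rule integral_mono)
        show "integrable M (clamped_quotient z)" by (rule M.integrable_const_bound[of _ B]) (use B in auto)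
        show "integrable M (\<lambda>u. (z - 1) * indicator {0} u)" by (auto simp: M.emeasure_eq_measure)
        show "clamped_quotient z u \<le> (z - 1) * indicator {0} u" for u
        proof (cases "u = 0")
          case True
          then show ?thesis by (simp add: clamped_quotient_def second_quotient_def)
        next
          case False
          then show ?thesis
            using second_quotient_nonpos[OF z, of "max 0 (min 2 u)"] by (simp add: clamped_quotient_def)
        qed
      qed
      also have "\<dots> = - (measure M {0} * (1 - z))" by (subst integral_mult_right_zero) (simp add: algebra_simps)
      finally have "measure M {0} * (1 - z) \<le> - (\<integral>u. clamped_quotient z u \<partial>M)" by simp
      also have "\<dots> = (z * \<psi> 1 - \<psi> z) / G" using rep[OF z(1)] G by (simp add: field_simps)
      finally show "measure M {0} * (1 - ?z k) \<le> (?z k * \<psi> 1 - \<psi> (?z k)) / G" unfolding z_def .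
    qed
  qed
  then have "measure M {0} = 0" using measure_nonneg[of M "{0}"] by simp
  then have "AE u in M. u \<notin> {0}" by (intro AE_not_in) (simp add: null_sets_def M.emeasure_eq_measure)
  with supp have "AE u in M. u \<in> {0<..1}" by eventually_elim auto
  then show ?thesis using that[of M] M(1) rep unfolding G_def by blast
qed

text \<open>The part of the limit measure on (0,1), divided by the weight and carried over by h = -
  ln u, is the Levy measure; the atom at 1 gives the Gaussian coefficient. Replacing the compensator
  z (u - 1) by the truncated linear one changes only the drift.\<close>

theorem levy_khintchine: "sp_laplace_exponent \<psi>"
proof (cases "2 * \<psi> 1 = \<psi> 2")
  case True
  show ?thesis
    unfolding sp_laplace_exponent_def
  proof (intro exI conjI allI impI)
    fix z :: real assume "0 \<le> z"
    from psi_degenerate[OF True[symmetric] this]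
    show "\<psi> z = - (- \<psi> 1) * z + 0\<^sup>2 / 2 * z\<^sup>2
        + (\<integral>h. exp (- z * h) + z * h * indicator {0<..1} h - 1 \<partial>null_measure borel)"
      by (simp add: integral_null_measure mult.commute)
  qed (simp_all add: nn_integral_null_measure)
next
  case False
  then have nondeg: "2 * \<psi> 1 < \<psi> 2" using psi_superadditive by simp
  obtain R where R: "real_distribution R" and supp: "AE u in R. u \<in> {0<..1}"
    and rep: "\<And>z. 0 < z \<Longrightarrow> \<psi> z - z * \<psi> 1 = (\<psi> 2 - 2 * \<psi> 1) * (\<integral>u. clamped_quotient z u \<partial>R)"
    using limit_measure_exists[OF nondeg] by blast
  interpret R: real_distribution R by fact
  define G where "G = \<psi> 2 - 2 * \<psi> 1"
  have G: "0 < G" using nondeg by (simp add: G_def)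
  \<comment> \<open>The atom at u = 1, that is at h = 0, contributes s * z * (z - 1) / 2. Its
    quadratic part is the Gaussian term, its linear part goes into the drift.\<close>
  define s where "s = G * measure R {1}"
  have s: "0 \<le> s" using G by (simp add: s_def)
  define w :: "real \<Rightarrow> real" where "w u = indicator {0<..<1} u * G / (u - 1)\<^sup>2" for u
  have [measurable]: "w \<in> borel_measurable borel" unfolding w_def by measurable
  have w_nonneg: "0 \<le> w u" for u using G by (simp add: w_def)
  define m where "m = distr (density R (\<lambda>u. ennreal (w u))) borel (\<lambda>u. - ln u)"
  \<comment> \<open>The singularity of 1 / (u - 1)^2 at u = 1 is compensated by (ln u)^2, and away
    from 1 the weight is bounded. After transport this is the integrability condition on the Levy
    measure.\<close>
  have w_bound: "w u * min ((- ln u)\<^sup>2) 1 \<le> 4 * G" for u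
  proof (cases "0 < u \<and> u < 1")
    case True
    have "min ((- ln u)\<^sup>2) 1 \<le> 4 * (u - 1)\<^sup>2"
    proof (cases "u \<le> 1/2")
      case u: True
      have "1/4 \<le> (1 - u)\<^sup>2" using u power_mono[of "1/2" "1 - u" 2] by (simp add: power2_eq_square)
      then show ?thesis by (simp add: power2_commute min.coboundedI2)
    next
      case u: False
      have "- ln u = ln (1 / u)" using True by (simp add: ln_div)
      also have "\<dots> \<le> 1 / u - 1" using True by (intro ln_le_minus_one) auto
      also have "\<dots> \<le> 2 * (1 - u)" using True u mult_right_mono[of 1 "2 * u" "1 - u"] by (simp add: field_simps)
      finally have "(- ln u)\<^sup>2 \<le> (2 * (1 - u))\<^sup>2" using True by (intro power_mono) (auto simp: ln_le_zero_iff)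
      moreover have "(2 * (1 - u))\<^sup>2 = 4 * (u - 1)\<^sup>2" by (simp add: power2_eq_square algebra_simps)
      ultimately show ?thesis by linarith
    qed
    then have "min ((- ln u)\<^sup>2) 1 * G \<le> 4 * (u - 1)\<^sup>2 * G" using G by (intro mult_right_mono) auto
    then show ?thesis using True by (simp add: w_def divide_le_eq algebra_simps)
  qed (use G in \<open>auto simp: w_def\<close>)
  have int_m: "integral\<^sup>L m f = (\<integral>u. w u * f (- ln u) \<partial>R)"
    if [measurable]: "f \<in> borel_measurable borel" for f :: "real \<Rightarrow> real"
    unfolding m_def using w_nonneg by (subst integral_distr) (auto simp: integral_real_density)
  \<comment> \<open>The difference of the two compensators per unit of z: the truncated h against 1
    - exp (- h) = 1 - u. It is of order h^2 near 0 and bounded, hence integrable against the Levy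
    measure.\<close>
  define \<kappa> :: "real \<Rightarrow> real" where "\<kappa> h = h * indicator {0<..1} h + exp (- h) - 1" for h
  define k :: "real \<Rightarrow> real \<Rightarrow> real" where "k z h = exp (- z * h) + z * h * indicator {0<..1} h - 1" for z h
  have [measurable]: "\<kappa> \<in> borel_measurable borel" "k z \<in> borel_measurable borel" for z
    unfolding \<kappa>_def k_def by measurable
  have \<kappa>_bound: "\<bar>\<kappa> h\<bar> \<le> min (h\<^sup>2) 1" if h: "0 < h" for h
  proof (cases "h \<le> 1")
    case True
    have "1 - h \<le> exp (- h)" using exp_ge_add_one_self[of "- h"] by simp
    moreover have "exp (- h) \<le> 1 - h + h\<^sup>2"
    proof -
      have "exp (- h) = 1 / exp h" by (simp add: exp_minus inverse_eq_divide)
      also have "\<dots> \<le> 1 / (1 + h)" using h exp_ge_add_one_self[of h] by (intro divide_left_mono) auto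
      also have "\<dots> \<le> 1 - h + h\<^sup>2"
      proof -
        have "(1 - h + h\<^sup>2) * (1 + h) = 1 + h * h * h" by (simp add: power2_eq_square algebra_simps)
        then have "1 \<le> (1 - h + h\<^sup>2) * (1 + h)" using h by simp
        then show ?thesis using h by (subst pos_divide_le_eq) auto
      qed
      finally show ?thesis .
    qed
    moreover have "h\<^sup>2 \<le> 1" using h True by (simp add: power_le_one)
    ultimately show ?thesis using h True by (simp add: \<kappa>_def min_def)
  next
    case False
    then have "min (h\<^sup>2) 1 = 1" by simp
    moreover have "exp (- h) \<le> 1" using h by simp
    ultimately show ?thesis using False by (simp add: \<kappa>_def)
  qed
  have int_\<kappa>: "integrable R (\<lambda>u. w u * \<kappa> (- ln u))"
  proof (rule R.integrable_const_bound[of _ "4 * G"])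
    show "AE u in R. norm (w u * \<kappa> (- ln u)) \<le> 4 * G"
    proof (rule AE_I2)
      fix u
      show "norm (w u * \<kappa> (- ln u)) \<le> 4 * G"
      proof (cases "0 < u \<and> u < 1")
        case True
        have "norm (w u * \<kappa> (- ln u)) \<le> w u * min ((- ln u)\<^sup>2) 1"
          using w_nonneg[of u] \<kappa>_bound[of "- ln u"] True by (simp add: abs_mult mult_left_mono)
        then show ?thesis using w_bound[of u] by linarith
      qed (use G in \<open>auto simp: w_def\<close>)
    qed
  qed measurable
  define K where "K = (\<integral>u. w u * \<kappa> (- ln u) \<partial>R)"
  have int_k: "integral\<^sup>L m (k z) = \<psi> z - z * \<psi> 1 - s * (z * (z - 1) / 2) + z * K" if z: "0 < z" for z
  proof -
    obtain B where B: "0 \<le> B" "\<And>u. \<bar>clamped_quotient z u\<bar> \<le> B" using clamped_quotient_bounded[OF z] by auto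
    have [measurable]: "clamped_quotient z \<in> borel_measurable borel"
      using clamped_quotient_continuous[OF z] by (rule borel_measurable_continuous_onI)
    have iq: "integrable R (clamped_quotient z)" by (rule R.integrable_const_bound[of _ B]) (use B in auto)
    have i1: "integrable R (\<lambda>u. indicator {1::real} u * (G * (z * (z - 1) / 2)))"
      by (auto simp: R.emeasure_eq_measure)
    have "integral\<^sup>L m (k z) = (\<integral>u. w u * k z (- ln u) \<partial>R)" by (rule int_m) measurable
    also have "\<dots> = (\<integral>u. G * clamped_quotient z u - indicator {1} u * (G * (z * (z - 1) / 2)) + z * (w u * \<kappa> (- ln u)) \<partial>R)"
    proof (rule integral_cong_AE)
      show "AE u in R. w u * k z (- ln u) = G * clamped_quotient z u - indicator {1} u * (G * (z * (z - 1) / 2)) + z * (w u * \<kappa> (- ln u))"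
        using supp
      proof eventually_elim
        fix u :: real assume u: "u \<in> {0<..1}"
        have q: "clamped_quotient z u = second_quotient z u" using u by (simp add: clamped_quotient_def)
        show "w u * k z (- ln u) = G * clamped_quotient z u - indicator {1} u * (G * (z * (z - 1) / 2)) + z * (w u * \<kappa> (- ln u))"
        proof (cases "u = 1")
          case True
          then show ?thesis unfolding q by (simp add: w_def second_quotient_def)
        next
          case False
          have e: "exp (z * ln u) = u powr z" "exp (ln u) = u" using u by (auto simp: powr_def)
          have "k z (- ln u) - z * \<kappa> (- ln u) = u powr z - 1 - z * (u - 1)"
            unfolding k_def \<kappa>_def using e by (simp add: algebra_simps)
          moreover have "G * second_quotient z u = w u * (u powr z - 1 - z * (u - 1))"
            using u False by (simp add: w_def second_quotient_def)
          ultimately have "G * second_quotient z u = w u * (k z (- ln u) - z * \<kappa> (- ln u))" by simp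
          then show ?thesis unfolding q using False by (simp add: algebra_simps)
        qed
      qed
    qed measurable
    also have "\<dots> = G * (\<integral>u. clamped_quotient z u \<partial>R) - measure R {1} * (G * (z * (z - 1) / 2)) + z * K"
      unfolding K_def using iq i1 int_\<kappa>
      by (subst Bochner_Integration.integral_add Bochner_Integration.integral_diff; simp)+
    finally show ?thesis using rep[OF z] by (simp add: s_def G_def)
  qed
  show ?thesis
    unfolding sp_laplace_exponent_def
  proof (intro exI conjI allI impI)
    show "0 \<le> sqrt s" using s by simp
    show "sets m = sets borel" by (simp add: m_def)
    have "emeasure m {..0} = (\<integral>\<^sup>+u. ennreal (w u) * indicator ((\<lambda>u. - ln u) -` {..0}) u \<partial>R)"
    proof -
      have "(\<lambda>u::real. - ln u) -` {..0} \<inter> space borel \<in> sets borel" by measurable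
      then show ?thesis unfolding m_def by (subst emeasure_distr) (auto simp: emeasure_density)
    qed
    also have "\<dots> = (\<integral>\<^sup>+u. 0 \<partial>R)"
      by (intro nn_integral_cong) (auto simp: w_def ln_ge_zero_iff split: split_indicator)
    finally show "emeasure m {..0} = 0" by simp
    have "(\<integral>\<^sup>+h. ennreal (min (h\<^sup>2) 1) \<partial>m) = (\<integral>\<^sup>+u. ennreal (w u) * ennreal (min ((- ln u)\<^sup>2) 1) \<partial>R)"
      unfolding m_def by (subst nn_integral_distr) (auto simp: nn_integral_density)
    also have "\<dots> \<le> (\<integral>\<^sup>+u. ennreal (4 * G) \<partial>R)"
      using w_bound w_nonneg by (intro nn_integral_mono) (simp flip: ennreal_mult add: ennreal_leI)
    also have "\<dots> < \<infinity>" by (simp add: R.emeasure_eq_measure ennreal_mult_less_top)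
    finally show "(\<integral>\<^sup>+h. ennreal (min (h\<^sup>2) 1) \<partial>m) < \<infinity>" .
    fix z :: real assume "0 \<le> z"
    \<comment> \<open>The drift gathers psi 1, the linear half of s * z * (z - 1) / 2, and the
      integral \<open>K\<close> of the change of compensator.\<close>
    show "\<psi> z = - (- (\<psi> 1 - s / 2 - K)) * z + (sqrt s)\<^sup>2 / 2 * z\<^sup>2 + (\<integral>h. exp (- z * h) + z * h * indicator {0<..1} h - 1 \<partial>m)"
    proof (cases "z = 0")
      case True
      then show ?thesis by (simp add: psi_0)
    next
      case False
      then have "0 < z" using \<open>0 \<le> z\<close> by simp
      from int_k[OF this] show ?thesis using s unfolding k_def by (simp add: algebra_simps power2_eq_square diff_divide_distrib)
    qed
  qed
qed

end

section \<open>First passage of cadlag paths\<close>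

text \<open>The pathwise clauses of the standing setting for a single path \<open>w\<close> with
  lifetime \<open>z\<close>. They make the passage-time arguments below deterministic.\<close>

definition cadlag_until :: "(real \<Rightarrow> ereal) \<Rightarrow> ennreal \<Rightarrow> bool" where
  "cadlag_until w z \<longleftrightarrow>
    (\<forall>t\<ge>0. (ennreal t < z \<longrightarrow> \<bar>w t\<bar> \<noteq> \<infinity>) \<and> (z \<le> ennreal t \<longrightarrow> w t = \<infinity>)) \<and>
    (\<forall>t\<ge>0. ennreal t < z \<longrightarrow> continuous (at_right t) (\<lambda>s. real_of_ereal (w s)) \<and>
        (0 < t \<longrightarrow> (\<exists>l. ((\<lambda>s. real_of_ereal (w s)) \<longlongrightarrow> l) (at_left t))))"

lemma cadlag_until_finite: "cadlag_until w z \<Longrightarrow> 0 \<le> t \<Longrightarrow> ennreal t < z \<Longrightarrow> \<bar>w t\<bar> \<noteq> \<infinity>"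
  and cadlag_until_dead: "cadlag_until w z \<Longrightarrow> 0 \<le> t \<Longrightarrow> z \<le> ennreal t \<Longrightarrow> w t = \<infinity>"
  and cadlag_until_right: "cadlag_until w z \<Longrightarrow> 0 \<le> t \<Longrightarrow> ennreal t < z \<Longrightarrow>
    ((\<lambda>s. real_of_ereal (w s)) \<longlongrightarrow> real_of_ereal (w t)) (at_right t)"
  and cadlag_until_left: "cadlag_until w z \<Longrightarrow> 0 < t \<Longrightarrow> ennreal t < z \<Longrightarrow>
    \<exists>l. ((\<lambda>s. real_of_ereal (w s)) \<longlongrightarrow> l) (at_left t)"
  unfolding cadlag_until_def continuous_within by auto

lemma cadlag_until_alive: "cadlag_until w z \<Longrightarrow> 0 \<le> t \<Longrightarrow> w t < \<infinity> \<Longrightarrow> ennreal t < z"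
  using cadlag_until_dead not_le by fastforce

lemma eventually_at_right_less_ennreal:
  assumes "0 \<le> t" "ennreal t < z"
  shows "eventually (\<lambda>s. ennreal s < z) (at_right t)"
proof (cases z)
  case (real y)
  then have "t < y" using assms by (simp add: ennreal_less_iff)
  then have "eventually (\<lambda>s. s < y) (at_right t)"
    using eventually_at_right_field by blast
  moreover have "eventually (\<lambda>s. t < s) (at_right t)" by (simp add: eventually_at_right_less)
  ultimately show ?thesis by eventually_elim (use real assms in \<open>auto simp: ennreal_less_iff\<close>)
qed auto

lemma cadlag_until_less_at_right:
  assumes w: "cadlag_until w z" and t: "0 \<le> t" and c: "w t < ereal c"
  shows "eventually (\<lambda>s. w s < ereal c) (at_right t)"
proof -
  have tz: "ennreal t < z" using cadlag_until_alive[OF w t] c by (cases "w t") auto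
  have "real_of_ereal (w t) < c" using cadlag_until_finite[OF w t tz] c by (cases "w t") auto
  then have "eventually (\<lambda>s. real_of_ereal (w s) < c) (at_right t)"
    by (rule order_tendstoD[OF cadlag_until_right[OF w t tz]])
  moreover have "eventually (\<lambda>s. t < s) (at_right t)" by (simp add: eventually_at_right_less)
  ultimately show ?thesis using eventually_at_right_less_ennreal[OF t tz]
  proof eventually_elim
    case (elim s)
    then have "\<bar>w s\<bar> \<noteq> \<infinity>" using cadlag_until_finite[OF w, of s] t by auto
    then show ?case using elim(1) by (cases "w s") auto
  qed
qed

lemma cadlag_until_rational_right:
  assumes w: "cadlag_until w z" and t: "0 \<le> t" and c: "w t < ereal c" and e: "t < e"
  shows "\<exists>r\<in>\<rat>. t < r \<and> r < e \<and> w r < ereal c"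
proof -
  obtain b where b: "t < b" "\<And>s. t < s \<Longrightarrow> s < b \<Longrightarrow> w s < ereal c"
    using cadlag_until_less_at_right[OF w t c] unfolding eventually_at_right_field by auto
  obtain r where "r \<in> \<rat>" "t < r" "r < min b e" using Rats_dense_in_real[of t "min b e"] b e by auto
  then show ?thesis using b by auto
qed

text \<open>A version of the first entrance time into the half line below l that only inspects
  rational times, hence is measurable for the product sigma-algebra.\<close>

definition passage_time :: "real \<Rightarrow> (real \<Rightarrow> ereal) \<Rightarrow> ennreal" where
  "passage_time l w = (SUP n. INF r\<in>\<rat> \<inter> {0..}. if w r < ereal (l + 1 / real (Suc n)) then ennreal r else \<infinity>)"

lemma passage_time_restrict: "passage_time l (restrict w {0..}) = passage_time l w"
  unfolding passage_time_def by (intro SUP_cong INF_cong refl) auto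

lemma measurable_passage_time[measurable]: "passage_time l \<in> borel_measurable path_space"
proof -
  have [measurable]: "(\<lambda>w. w r) \<in> borel_measurable path_space" if "r \<in> \<rat> \<inter> {0..}" for r
    using that unfolding path_space_def by (intro measurable_component_singleton) auto
  have "countable (\<rat> \<inter> {0::real..})" using countable_rat by blast
  then show ?thesis unfolding passage_time_def[abs_def] by measurable
qed

text \<open>Right continuity lets rational times stand in for all times. The right-hand side asks
  for the infimum of the path over [0,t] to be at most l, so approaching l through a left limit
  counts as a passage as well.\<close>

lemma passage_time_le_iff:
  assumes w: "cadlag_until w z" and t: "0 \<le> t"
  shows "passage_time l w \<le> ennreal t \<longleftrightarrow> (\<forall>n. \<exists>r. 0 \<le> r \<and> r \<le> t \<and> w r < ereal (l + 1 / real (Suc n)))"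
proof
  assume R: "\<forall>n. \<exists>r. 0 \<le> r \<and> r \<le> t \<and> w r < ereal (l + 1 / real (Suc n))"
  show "passage_time l w \<le> ennreal t"
    unfolding passage_time_def
  proof (rule SUP_least)
    fix n
    obtain r where r: "0 \<le> r" "r \<le> t" "w r < ereal (l + 1 / real (Suc n))" using R by auto
    show "(INF r\<in>\<rat> \<inter> {0..}. if w r < ereal (l + 1 / real (Suc n)) then ennreal r else \<infinity>) \<le> ennreal t"
    proof (rule ennreal_le_epsilon)
      fix e :: real assume e: "0 < e"
      obtain r' where r': "r' \<in> \<rat>" "r < r'" "r' < r + e" "w r' < ereal (l + 1 / real (Suc n))"
        using cadlag_until_rational_right[OF w r(1,3), of "r + e"] e by auto
      then have "(INF r\<in>\<rat> \<inter> {0..}. if w r < ereal (l + 1 / real (Suc n)) then ennreal r else \<infinity>) \<le> ennreal r'"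
        using r(1) by (intro INF_lower2[of r']) auto
      also have "\<dots> \<le> ennreal t + ennreal e" using r r' t e by (simp flip: ennreal_plus add: ennreal_leI)
      finally show "(INF r\<in>\<rat> \<inter> {0..}. if w r < ereal (l + 1 / real (Suc n)) then ennreal r else \<infinity>) \<le> ennreal t + ennreal e" .
    qed
  qed
next
  assume le: "passage_time l w \<le> ennreal t"
  show "\<forall>n. \<exists>r. 0 \<le> r \<and> r \<le> t \<and> w r < ereal (l + 1 / real (Suc n))"
  proof (rule allI, rule ccontr)
    fix n assume no: "\<nexists>r. 0 \<le> r \<and> r \<le> t \<and> w r < ereal (l + 1 / real (Suc n))"
    \<comment> \<open>A strictly smaller level gives room: without a visit up to t the path at t is
      at least the old level, so by right continuity it stays above \<open>?c\<close> just after t,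
      whereas the passage time forces visits below \<open>?c\<close> arbitrarily soon after
      t.\<close>
    let ?c = "l + 1 / real (Suc (Suc n))"
    have c_less: "?c < l + 1 / real (Suc n)" by (simp add: frac_less2)
    have ex: "\<exists>r. t < r \<and> r < t + e \<and> w r < ereal ?c" if e: "0 < e" for e
    proof -
      have "(INF r\<in>\<rat> \<inter> {0..}. if w r < ereal ?c then ennreal r else \<infinity>) \<le> passage_time l w"
        unfolding passage_time_def by (intro SUP_upper) auto
      also have "\<dots> < ennreal (t + e)" using le e t by (intro le_less_trans[OF le]) (auto simp: ennreal_less_iff)
      finally obtain r where r: "r \<in> \<rat> \<inter> {0..}" "(if w r < ereal ?c then ennreal r else \<infinity>) < ennreal (t + e)"
        unfolding INF_less_iff by auto
      then have r': "w r < ereal ?c" "r < t + e" "0 \<le> r" by (auto simp: ennreal_less_iff split: if_splits)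
      moreover have "t < r"
      proof (rule ccontr)
        assume "\<not> t < r"
        moreover have "w r < ereal (l + 1 / real (Suc n))" using r'(1) c_less by (meson ereal_less_eq(3) less_imp_le less_le_trans)
        ultimately show False using no r' by auto
      qed
      ultimately show ?thesis by auto
    qed
    obtain r where r: "t < r" "w r < ereal ?c" using ex[of 1] by auto
    have "ennreal r < z" using cadlag_until_alive[OF w, of r] r t by (cases "w r") auto
    then have tz: "ennreal t < z" using r t by (meson ennreal_leI le_less_trans less_imp_le)
    have "?c < real_of_ereal (w t)"
    proof -
      have "\<not> w t < ereal (l + 1 / real (Suc n))" using no t by auto
      then show ?thesis using cadlag_until_finite[OF w t tz] c_less by (cases "w t") auto
    qed
    then have "eventually (\<lambda>s. ?c < real_of_ereal (w s)) (at_right t)"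
      by (rule order_tendstoD[OF cadlag_until_right[OF w t tz]])
    then obtain b where b: "t < b" "\<And>s. t < s \<Longrightarrow> s < b \<Longrightarrow> ?c < real_of_ereal (w s)"
      unfolding eventually_at_right_field by auto
    obtain r where r: "t < r" "r < b" "w r < ereal ?c" using ex[of "b - t"] b(1) by auto
    have "ennreal r < z" using cadlag_until_alive[OF w, of r] r t by (cases "w r") auto
    then have "\<bar>w r\<bar> \<noteq> \<infinity>" using cadlag_until_finite[OF w, of r] r t by auto
    then show False using b(2)[OF r(1,2)] r(3) by (cases "w r") auto
  qed
qed

text \<open>A countable condition for measurability at time t. The time t itself must be added,
  since a visit at t is approximated by rationals only from the right, beyond t.\<close>

lemma passage_time_le_iff_countable:
  assumes w: "cadlag_until w z" and t: "0 \<le> t"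
  shows "passage_time l w \<le> ennreal t \<longleftrightarrow>
    (\<forall>n. \<exists>r\<in>insert t (\<rat> \<inter> {0..t}). w r < ereal (l + 1 / real (Suc n)))"
  unfolding passage_time_le_iff[OF assms]
proof (intro iff_allI iffI)
  fix n assume "\<exists>r. 0 \<le> r \<and> r \<le> t \<and> w r < ereal (l + 1 / real (Suc n))"
  then obtain r where r: "0 \<le> r" "r \<le> t" "w r < ereal (l + 1 / real (Suc n))" by auto
  show "\<exists>r\<in>insert t (\<rat> \<inter> {0..t}). w r < ereal (l + 1 / real (Suc n))"
  proof (cases "r = t")
    case False
    then show ?thesis using cadlag_until_rational_right[OF w r(1,3), of t] r by force
  qed (use r in auto)
qed (use t in auto)

lemma passage_time_leI:
  assumes w: "cadlag_until w z" and t: "0 \<le> t" "w t \<le> ereal l"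
  shows "passage_time l w \<le> ennreal t"
  unfolding passage_time_le_iff[OF w t(1)]
proof
  fix n
  have "w t < ereal (l + 1 / real (Suc n))" using t(2) by (rule le_less_trans) simp
  then show "\<exists>r\<ge>0. r \<le> t \<and> w r < ereal (l + 1 / real (Suc n))" using t(1) by auto
qed

lemma passage_time_shift_le:
  assumes w: "cadlag_until w z" and n: "\<not> passage_time l w \<le> ennreal t" and t: "0 \<le> t" and s: "0 \<le> s"
    and w': "cadlag_until (\<lambda>r. w (t + r)) z'"
  shows "passage_time l w \<le> ennreal (t + s) \<longleftrightarrow> passage_time l (\<lambda>r. w (t + r)) \<le> ennreal s"
proof -
  \<comment> \<open>Some level above l is also missed up to t. A visit below the lower of this level
    and the given one must then happen after t.\<close>
  obtain m where m: "\<And>r. 0 \<le> r \<Longrightarrow> r \<le> t \<Longrightarrow> \<not> w r < ereal (l + 1 / real (Suc m))"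
    using n unfolding passage_time_le_iff[OF w t] by auto
  have "(\<exists>r. 0 \<le> r \<and> r \<le> s \<and> w (t + r) < ereal (l + 1 / real (Suc n)))"
    if R: "\<forall>n. \<exists>r. 0 \<le> r \<and> r \<le> t + s \<and> w r < ereal (l + 1 / real (Suc n))" for n
  proof -
    obtain r where r: "0 \<le> r" "r \<le> t + s" "w r < ereal (l + 1 / real (Suc (max m n)))" using R by blast
    have le: "1 / real (Suc (max m n)) \<le> 1 / real (Suc n)" "1 / real (Suc (max m n)) \<le> 1 / real (Suc m)"
      by (auto intro!: divide_left_mono)
    have "w r < ereal (l + 1 / real (Suc m))" "w r < ereal (l + 1 / real (Suc n))"
      using r(3) le by (auto elim!: less_le_trans)
    moreover have "t < r" using m[of r] r(1) calculation(1) by (meson not_le)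
    ultimately show ?thesis using r by (intro exI[of _ "r - t"]) auto
  qed
  moreover have "\<exists>r. 0 \<le> r \<and> r \<le> t + s \<and> w r < ereal (l + 1 / real (Suc n))"
    if "\<exists>r. 0 \<le> r \<and> r \<le> s \<and> w (t + r) < ereal (l + 1 / real (Suc n))" for n
    using that t by (metis add_left_mono add_nonneg_nonneg)
  ultimately show ?thesis
    unfolding passage_time_le_iff[OF w add_nonneg_nonneg[OF t s]] passage_time_le_iff[OF w' s] by blast
qed

lemma ennreal_eqI_le_iff:
  assumes "\<And>s. 0 \<le> s \<Longrightarrow> a \<le> ennreal s \<longleftrightarrow> b \<le> ennreal s"
  shows "a = b"
proof -
  have le: "a \<le> b" if "\<And>s. 0 \<le> s \<Longrightarrow> b \<le> ennreal s \<Longrightarrow> a \<le> ennreal s" for a b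
    by (cases b) (use that in auto)
  show ?thesis using le assms by (metis antisym)
qed

lemma cadlag_until_shift:
  assumes w: "cadlag_until w z" and t: "0 \<le> t"
  shows "cadlag_until (\<lambda>r. w (t + r)) (z - ennreal t)"
proof -
  have less: "ennreal s < z - ennreal t \<longleftrightarrow> ennreal (t + s) < z" if "0 \<le> s" for s
    using that t by (cases z) (auto simp: ennreal_less_iff ennreal_minus ennreal_top_minus simp del: ennreal_plus)
  have le: "z - ennreal t \<le> ennreal s \<longleftrightarrow> z \<le> ennreal (t + s)" if "0 \<le> s" for s
    using less[OF that] by (simp add: not_less[symmetric])
  have right: "filterlim (\<lambda>r. t + r) (at_right (t + s)) (at_right s)" for s
    unfolding filterlim_at by (auto intro!: tendsto_intros simp: eventually_at_right_less eventually_at_filter)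
  have left: "filterlim (\<lambda>r. t + r) (at_left (t + s)) (at_left s)" for s
    unfolding filterlim_at by (auto intro!: tendsto_intros simp: eventually_at_filter)
  show ?thesis
    unfolding cadlag_until_def continuous_within
  proof (intro conjI allI impI)
    fix s :: real assume s: "0 \<le> s"
    show "\<bar>w (t + s)\<bar> \<noteq> \<infinity>" if "ennreal s < z - ennreal t"
      using cadlag_until_finite[OF w, of "t + s"] that less[OF s] s t by auto
    show "w (t + s) = \<infinity>" if "z - ennreal t \<le> ennreal s"
      using cadlag_until_dead[OF w, of "t + s"] that le[OF s] s t by auto
    assume a: "ennreal s < z - ennreal t"
    show "((\<lambda>s. real_of_ereal (w (t + s))) \<longlongrightarrow> real_of_ereal (w (t + s))) (at_right s)"
      using filterlim_compose[OF cadlag_until_right[OF w, of "t + s"] right] a less[OF s] s t by auto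
    assume "0 < s"
    then obtain l where "((\<lambda>s. real_of_ereal (w s)) \<longlongrightarrow> l) (at_left (t + s))"
      using cadlag_until_left[OF w, of "t + s"] a less[OF s] t by auto
    from filterlim_compose[OF this left]
    show "\<exists>l. ((\<lambda>s. real_of_ereal (w (t + s))) \<longlongrightarrow> l) (at_left s)" by auto
  qed
qed

lemma passage_time_shift:
  assumes w: "cadlag_until w z" and t: "0 \<le> t" and n: "\<not> passage_time l w \<le> ennreal t"
  shows "passage_time l w = ennreal t + passage_time l (\<lambda>r. w (t + r))"
proof (rule ennreal_eqI_le_iff)
  fix s :: real assume s: "0 \<le> s"
  show "passage_time l w \<le> ennreal s \<longleftrightarrow> ennreal t + passage_time l (\<lambda>r. w (t + r)) \<le> ennreal s"
  proof (cases "s < t")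
    case True
    then have "\<not> passage_time l w \<le> ennreal s" using n by (meson ennreal_leI less_imp_le order_trans)
    moreover have "\<not> ennreal t + passage_time l (\<lambda>r. w (t + r)) \<le> ennreal s"
      using True s by (smt (verit) ennreal_le_iff le_iff_add order_trans)
    ultimately show ?thesis by simp
  next
    case False
    define s' where "s' = s - t"
    have s': "s = t + s'" "0 \<le> s'" using False by (auto simp: s'_def)
    have "passage_time l w \<le> ennreal s \<longleftrightarrow> passage_time l (\<lambda>r. w (t + r)) \<le> ennreal s'"
      unfolding s'(1) by (rule passage_time_shift_le[OF w n t s'(2) cadlag_until_shift[OF w t]])
    also have "\<dots> \<longleftrightarrow> ennreal t + passage_time l (\<lambda>r. w (t + r)) \<le> ennreal t + ennreal s'"
      by (simp add: ennreal_add_left_cancel_le)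
    finally show ?thesis using s' t by simp
  qed
qed

lemma passage_time_antimono:
  assumes "l \<le> l'"
  shows "passage_time l' w \<le> passage_time l w"
  unfolding passage_time_def
proof (intro SUP_mono' INF_mono', goal_cases)
  case (1 n r)
  have "l + 1 / real (Suc n) \<le> l' + 1 / real (Suc n)" using assms by simp
  then have "w r < ereal (l + 1 / real (Suc n)) \<Longrightarrow> w r < ereal (l' + 1 / real (Suc n))"
    by (meson ereal_less_eq(3) less_le_trans)
  then show ?case by auto
qed

lemma passage_time_tendsto:
  assumes w: "cadlag_until w z"
  shows "incseq (\<lambda>k. passage_time (l + 1 / real (Suc k)) w)"
    "(\<lambda>k. passage_time (l + 1 / real (Suc k)) w) \<longlonglongrightarrow> passage_time l w"
proof -
  show inc: "incseq (\<lambda>k. passage_time (l + 1 / real (Suc k)) w)"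
    by (intro incseq_SucI passage_time_antimono) (simp add: frac_le)
  have "(SUP k. passage_time (l + 1 / real (Suc k)) w) = passage_time l w"
  proof (rule ennreal_eqI_le_iff)
    fix s :: real assume s: "0 \<le> s"
    show "(SUP k. passage_time (l + 1 / real (Suc k)) w) \<le> ennreal s \<longleftrightarrow> passage_time l w \<le> ennreal s"
    proof
      assume le: "(SUP k. passage_time (l + 1 / real (Suc k)) w) \<le> ennreal s"
      show "passage_time l w \<le> ennreal s"
        unfolding passage_time_le_iff[OF w s]
      proof
        fix n :: nat
        \<comment> \<open>The level and the slack in the characterisation of the passage time each
          take half of 1 / Suc n.\<close>
        define k where "k = 2 * n + 1"
        have "passage_time (l + 1 / real (Suc k)) w \<le> ennreal s" using le by (meson SUP_le_iff UNIV_I)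
        then obtain r where r: "0 \<le> r" "r \<le> s" "w r < ereal (l + 1 / real (Suc k) + 1 / real (Suc k))"
          unfolding passage_time_le_iff[OF w s] by blast
        moreover have "1 / real (Suc k) + 1 / real (Suc k) = 1 / real (Suc n)" by (simp add: k_def field_simps)
        ultimately show "\<exists>r\<ge>0. r \<le> s \<and> w r < ereal (l + 1 / real (Suc n))" by (auto simp: add.assoc)
      qed
    next
      assume le: "passage_time l w \<le> ennreal s"
      show "(SUP k. passage_time (l + 1 / real (Suc k)) w) \<le> ennreal s"
        by (intro SUP_least order_trans[OF passage_time_antimono le]) simp
    qed
  qed
  with LIMSEQ_SUP[OF inc] show "(\<lambda>k. passage_time (l + 1 / real (Suc k)) w) \<longlonglongrightarrow> passage_time l w" by simp
qed

text \<open>Isolates the exceptional behaviour at a passage time t where the path is not at or below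
  l: t is reached strictly from below by the passage times of higher levels, and the path comes
  close to l just before t. The probabilistic axioms exclude this later.\<close>

lemma passage_time_not_attained:
  assumes w: "cadlag_until w z" and t: "0 \<le> t" and eq: "passage_time l w = ennreal t"
    and no: "\<not> (ennreal t < z \<and> w t \<le> ereal l)"
  shows "0 < t" "ennreal t \<le> z" "\<And>k. passage_time (l + 1 / real (Suc k)) w < ennreal t"
    "\<And>n. \<exists>\<^sub>F s in at_left t. w s < ereal (l + 1 / real (Suc n))"
proof -
  have R: "\<exists>r. 0 \<le> r \<and> r \<le> t \<and> w r < ereal (l + 1 / real (Suc n))" for n
    using passage_time_le_iff[OF w t, of l] eq by auto
  have mono: "l + 1 / real (Suc n) \<le> l + 1 / real (Suc m)" if "m \<le> n" for m n
    using that by (simp add: frac_le)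
  \<comment> \<open>At t the path is either dead or above l by a fixed margin, so visits below
    sufficiently fine levels happen strictly before t.\<close>
  have "\<exists>m. \<forall>n\<ge>m. \<not> w t < ereal (l + 1 / real (Suc n))"
  proof (cases "ennreal t < z")
    case True
    then have "ereal l < w t" using no by auto
    then obtain c where c: "l < c" "ereal c < w t" by (metis ereal_dense2 ereal_less_eq(3) less_ereal.simps(1))
    obtain m where "1 / real (Suc m) < c - l" using c(1) nat_approx_posE[of "c - l"] by auto
    then have "ereal (l + 1 / real (Suc n)) \<le> w t" if "m \<le> n" for n
      using mono[OF that] c(2) by (smt (verit) ereal_less_eq(3) less_imp_le order_trans)
    then show ?thesis by (intro exI[of _ m]) (auto simp: not_less)
  next
    case False
    then show ?thesis using cadlag_until_dead[OF w t] by auto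
  qed
  then obtain m where m: "\<And>n. m \<le> n \<Longrightarrow> \<not> w t < ereal (l + 1 / real (Suc n))" by auto
  have R': "\<exists>r. 0 \<le> r \<and> r < t \<and> w r < ereal (l + 1 / real (Suc n))" for n
  proof -
    obtain r where r: "0 \<le> r" "r \<le> t" "w r < ereal (l + 1 / real (Suc (max m n)))" using R by blast
    have "r \<noteq> t" using m[of "max m n"] r by auto
    moreover have "w r < ereal (l + 1 / real (Suc n))"
      using r(3) mono[of n "max m n"] by (elim less_le_trans) simp
    ultimately show ?thesis using r by (intro exI[of _ r]) auto
  qed
  show "0 < t" using R'[of 0] by auto
  show "ennreal t \<le> z"
  proof (cases z)
    case (real y)
    have "passage_time l w \<le> ennreal y"
      unfolding passage_time_le_iff[OF w real(1)]
    proof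
      fix n
      obtain r where r: "0 \<le> r" "w r < ereal (l + 1 / real (Suc n))" using R' by blast
      have "ennreal r < z" using cadlag_until_alive[OF w r(1)] r by (cases "w r") auto
      then have "r \<le> y" using real r by (simp add: ennreal_less_iff)
      then show "\<exists>r\<ge>0. r \<le> y \<and> w r < ereal (l + 1 / real (Suc n))" using r by auto
    qed
    then show ?thesis using eq real by simp
  qed auto
  show "passage_time (l + 1 / real (Suc k)) w < ennreal t" for k
  proof -
    obtain r where r: "0 \<le> r" "r < t" "w r < ereal (l + 1 / real (Suc k))" using R' by blast
    have "passage_time (l + 1 / real (Suc k)) w \<le> ennreal r"
      using r by (intro passage_time_leI[OF w]) auto
    also have "\<dots> < ennreal t" using r by (simp add: ennreal_less_iff)
    finally show ?thesis .
  qed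
  show "\<exists>\<^sub>F s in at_left t. w s < ereal (l + 1 / real (Suc n))" for n
    unfolding frequently_def
  proof
    assume "\<forall>\<^sub>F s in at_left t. \<not> w s < ereal (l + 1 / real (Suc n))"
    then obtain b where b: "b < t" "\<And>s. b < s \<Longrightarrow> s < t \<Longrightarrow> \<not> w s < ereal (l + 1 / real (Suc n))"
      unfolding eventually_at_left_field by auto
    \<comment> \<open>The passage has not happened by max 0 b, so some level is missed up to there;
      a visit below that level before t has to fall into (b,t).\<close>
    have "max 0 b < t" using b \<open>0 < t\<close> by simp
    then have "\<not> passage_time l w \<le> ennreal (max 0 b)" using eq \<open>0 < t\<close> by (simp add: ennreal_le_iff2)
    then obtain N where N: "\<And>r. 0 \<le> r \<Longrightarrow> r \<le> max 0 b \<Longrightarrow> \<not> w r < ereal (l + 1 / real (Suc N))"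
      unfolding passage_time_le_iff[OF w max.cobounded1] by blast
    obtain r where r: "0 \<le> r" "r < t" "w r < ereal (l + 1 / real (Suc (max n N)))" using R' by blast
    have "w r < ereal (l + 1 / real (Suc n))" "w r < ereal (l + 1 / real (Suc N))"
      using r(3) mono[of n "max n N"] mono[of N "max n N"] by (auto elim!: less_le_trans)
    moreover have "\<not> r \<le> max 0 b" using N[of r] r calculation(2) by blast
    then have "b < r" by linarith
    ultimately show False using b(2)[of r] r by blast
  qed
qed

lemma frequently_less_imp_limit_le:
  fixes L :: ereal
  assumes lim: "(w \<longlongrightarrow> L) F" and fr: "\<And>n. \<exists>\<^sub>F s in F. w s < ereal (l + 1 / real (Suc n))"
  shows "L \<le> ereal l"
proof (rule ccontr)
  assume "\<not> L \<le> ereal l"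
  then obtain c where c: "l < c" "ereal c < L" by (metis ereal_dense2 ereal_less_eq(3) less_ereal.simps(1) not_le)
  obtain m where m: "1 / real (Suc m) < c - l" using c(1) nat_approx_posE[of "c - l"] by auto
  have "eventually (\<lambda>s. ereal c < w s) F" using order_tendstoD(1)[OF lim c(2)] .
  with fr[of m] have "\<exists>\<^sub>F s in F. ereal c < w s \<and> w s < ereal (l + 1 / real (Suc m))"
    by (rule frequently_eventually_conj)
  then obtain s where s: "w s < ereal (l + 1 / real (Suc m))" "ereal c < w s" using frequently_ex by blast
  then have "ereal c < ereal (l + 1 / real (Suc m))" by (rule less_trans[rotated])
  then show False using m by simp
qed

text \<open>One-sided limits bound the path below near each time, and bisection patches the local
  bounds together. Consequently a path alive at t has not passed very low levels by time t.\<close>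

lemma cadlag_until_bounded_below:
  assumes w: "cadlag_until w z" and t: "0 \<le> t" "ennreal t < z"
  obtains k :: nat where "\<And>r. 0 \<le> r \<Longrightarrow> r \<le> t \<Longrightarrow> ereal (- real k) \<le> w r"
proof -
  have alive: "ennreal r < z" if "r \<le> t" for r using that t by (meson ennreal_leI le_less_trans)
  \<comment> \<open>The window [0,t] is part of the predicate because bisection tests every small
    interval around a point, including those that leave the window.\<close>
  define Q where "Q a b \<longleftrightarrow> (\<exists>K. \<forall>r. a \<le> r \<and> r \<le> b \<and> 0 \<le> r \<and> r \<le> t \<longrightarrow> K \<le> real_of_ereal (w r))" for a b
  have "Q 0 t"
    using t(1)
  proof (rule Bolzano)
    fix a b c assume "Q a b" "Q b c"
    then obtain K K' where "\<And>r. a \<le> r \<and> r \<le> b \<and> 0 \<le> r \<and> r \<le> t \<Longrightarrow> K \<le> real_of_ereal (w r)"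
      "\<And>r. b \<le> r \<and> r \<le> c \<and> 0 \<le> r \<and> r \<le> t \<Longrightarrow> K' \<le> real_of_ereal (w r)" unfolding Q_def by blast
    then show "Q a c" unfolding Q_def by (intro exI[of _ "min K K'"]) (metis linear min.coboundedI1 min.coboundedI2)
  next
    fix x assume x: "0 \<le> x" "x \<le> t"
    have "eventually (\<lambda>s. real_of_ereal (w x) - 1 < real_of_ereal (w s)) (at_right x)"
      by (rule order_tendstoD[OF cadlag_until_right[OF w x(1) alive[OF x(2)]]]) simp
    then obtain b where b: "x < b" "\<And>s. x < s \<Longrightarrow> s < b \<Longrightarrow> real_of_ereal (w x) - 1 < real_of_ereal (w s)"
      unfolding eventually_at_right_field by auto
    obtain a K where a: "a < x" "\<And>s. 0 \<le> s \<Longrightarrow> a < s \<Longrightarrow> s < x \<Longrightarrow> K < real_of_ereal (w s)"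
    proof (cases "x = 0")
      case True
      then show ?thesis using that[of "-1" 0] by auto
    next
      case False
      then obtain l where "((\<lambda>s. real_of_ereal (w s)) \<longlongrightarrow> l) (at_left x)"
        using cadlag_until_left[OF w _ alive[OF x(2)]] x by auto
      then have "eventually (\<lambda>s. l - 1 < real_of_ereal (w s)) (at_left x)" by (rule order_tendstoD) simp
      then show ?thesis using that unfolding eventually_at_left_field by auto
    qed
    show "\<exists>d>0. \<forall>a b. a \<le> x \<and> x \<le> b \<and> b - a < d \<longrightarrow> Q a b"
    proof (intro exI[of _ "min (b - x) (x - a)"] conjI allI impI)
      fix a' b' assume ab: "a' \<le> x \<and> x \<le> b' \<and> b' - a' < min (b - x) (x - a)"
      show "Q a' b'" unfolding Q_def
      proof (intro exI[of _ "min K (real_of_ereal (w x) - 1)"] allI impI)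
        fix r assume r: "a' \<le> r \<and> r \<le> b' \<and> 0 \<le> r \<and> r \<le> t"
        consider "r < x" | "r = x" | "x < r" by linarith
        then show "min K (real_of_ereal (w x) - 1) \<le> real_of_ereal (w r)"
          by cases (use a(2)[of r] b(2)[of r] ab r in auto)
      qed
    qed (use a(1) b(1) in auto)
  qed
  then obtain K where K: "\<And>r. 0 \<le> r \<Longrightarrow> r \<le> t \<Longrightarrow> K \<le> real_of_ereal (w r)" unfolding Q_def by auto
  obtain k :: nat where k: "- K \<le> real k" using real_arch_simple by blast
  show ?thesis
  proof (rule that[of k])
    fix r assume r: "0 \<le> r" "r \<le> t"
    have "\<bar>w r\<bar> \<noteq> \<infinity>" using cadlag_until_finite[OF w r(1) alive[OF r(2)]] .
    then show "ereal (- real k) \<le> w r" using K[OF r] k by (cases "w r") auto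
  qed
qed

text \<open>A uniform lower bound survives upward jumps although uniform continuity does not. Near x
  the path is close to its left limit before x and close to its value from x on, and passing from
  the first to the second is a step upward.\<close>

lemma no_negative_jump_increments:
  assumes w: "cadlag_until w z" and T: "ennreal 1 < z" and e: "0 < e"
    and up: "\<And>t. 0 < t \<Longrightarrow> t \<le> 1 \<Longrightarrow> Lim (at_left t) (\<lambda>s. real_of_ereal (w s)) \<le> real_of_ereal (w t)"
  obtains d where "0 < d"
    "\<And>s u. 0 \<le> s \<Longrightarrow> s \<le> u \<Longrightarrow> u \<le> 1 \<Longrightarrow> u - s < d \<Longrightarrow> - e < real_of_ereal (w u) - real_of_ereal (w s)"
proof -
  define f where "f s = real_of_ereal (w s)" for s
  have alive: "ennreal r < z" if "r \<le> 1" for r using that T by (meson ennreal_leI le_less_trans)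
  have "\<exists>d>0. \<forall>s u. 0 \<le> s \<and> s \<le> u \<and> \<bar>s - x\<bar> < d \<and> \<bar>u - x\<bar> < d \<longrightarrow> - e < f u - f s" if x: "0 \<le> x" "x \<le> 1" for x
  proof -
    have lim: "(f \<longlongrightarrow> f x) (at_right x)" unfolding f_def using cadlag_until_right[OF w x(1) alive[OF x(2)]] .
    then have "eventually (\<lambda>s. dist (f s) (f x) < e / 2) (at_right x)" using e by (intro tendstoD) auto
    then obtain b where b: "x < b" "\<And>s. x < s \<Longrightarrow> s < b \<Longrightarrow> \<bar>f s - f x\<bar> < e / 2"
      unfolding eventually_at_right_field dist_real_def by auto
    obtain a L where a: "a < x" "L \<le> f x" "\<And>s. 0 \<le> s \<Longrightarrow> a < s \<Longrightarrow> s < x \<Longrightarrow> \<bar>f s - L\<bar> < e / 2"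
    proof (cases "x = 0")
      case True
      then show ?thesis using that[of "-1" "f x"] by auto
    next
      case False
      then obtain l where l: "(f \<longlongrightarrow> l) (at_left x)"
        using cadlag_until_left[OF w _ alive[OF x(2)]] x unfolding f_def by auto
      then have "eventually (\<lambda>s. dist (f s) l < e / 2) (at_left x)" using e by (intro tendstoD) auto
      then obtain a where "a < x" "\<And>s. a < s \<Longrightarrow> s < x \<Longrightarrow> \<bar>f s - l\<bar> < e / 2"
        unfolding eventually_at_left_field dist_real_def by auto
      moreover have "l \<le> f x" using up[of x] tendsto_Lim[OF _ l] False x unfolding f_def by simp
      ultimately show ?thesis using that by auto
    qed
    show ?thesis
    proof (intro exI[of _ "min (b - x) (x - a)"] conjI allI impI)
      fix s u assume su: "0 \<le> s \<and> s \<le> u \<and> \<bar>s - x\<bar> < min (b - x) (x - a) \<and> \<bar>u - x\<bar> < min (b - x) (x - a)"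
      have left: "\<bar>f r - L\<bar> < e / 2" if "r < x" "r = s \<or> r = u" for r
        using a(3)[of r] su that by auto
      have right: "\<bar>f r - f x\<bar> < e / 2" if "x \<le> r" "r = s \<or> r = u" for r
      proof (cases "r = x")
        case False
        then show ?thesis using b(2)[of r] su that by auto
      qed (use e in simp)
      \<comment> \<open>Only a pair straddling x sees the jump at x, and there L \<le> f x has the
        favourable sign.\<close>
      consider "u < x" | "s < x" "x \<le> u" | "x \<le> s" by linarith
      then show "- e < f u - f s"
      proof cases
        case 1
        then have "\<bar>f s - L\<bar> < e / 2" "\<bar>f u - L\<bar> < e / 2" using left su by auto
        then show ?thesis by linarith
      next
        case 2
        then have "\<bar>f s - L\<bar> < e / 2" "\<bar>f u - f x\<bar> < e / 2" using left right by auto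
        then show ?thesis using a(2) by linarith
      next
        case 3
        then have "\<bar>f s - f x\<bar> < e / 2" "\<bar>f u - f x\<bar> < e / 2" using right su by auto
        then show ?thesis by linarith
      qed
    qed (use a(1) b(1) in auto)
  qed
  then obtain d where d: "\<And>x. 0 \<le> x \<Longrightarrow> x \<le> 1 \<Longrightarrow> 0 < d x"
    "\<And>x s u. 0 \<le> x \<Longrightarrow> x \<le> 1 \<Longrightarrow> 0 \<le> s \<Longrightarrow> s \<le> u \<Longrightarrow> \<bar>s - x\<bar> < d x \<Longrightarrow> \<bar>u - x\<bar> < d x \<Longrightarrow> - e < f u - f s"
    by metis
  \<comment> \<open>The radii depend on the point; a Lebesgue number of the cover gives a single
    radius for all pairs.\<close>
  let ?G = "(\<lambda>x. ball x (d x)) ` {0..1}"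
  have "{0..1} \<subseteq> \<Union>?G" using d(1) by force
  then obtain \<delta> where \<delta>: "0 < \<delta>" "\<And>x. x \<in> {0..1} \<Longrightarrow> \<exists>B\<in>?G. ball x \<delta> \<subseteq> B"
    using Heine_Borel_lemma[of "{0..1::real}" ?G] by (metis (no_types, lifting) compact_Icc imageE open_ball)
  show ?thesis
  proof (rule that[OF \<delta>(1)])
    fix s u :: real assume su: "0 \<le> s" "s \<le> u" "u \<le> 1" "u - s < \<delta>"
    obtain x where x: "x \<in> {0..1}" "ball s \<delta> \<subseteq> ball x (d x)" using \<delta>(2)[of s] su by auto
    have "s \<in> ball x (d x)" "u \<in> ball x (d x)" using x(2) su \<delta>(1) by (auto simp: subset_eq dist_real_def)
    then show "- e < real_of_ereal (w u) - real_of_ereal (w s)"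
      using d(2)[of x s u] x(1) su unfolding f_def by (auto simp: dist_real_def abs_minus_commute)
  qed
qed

section \<open>Passage times and the Markov property\<close>

locale standing =
  fixes \<Omega> :: "'a set" and F P :: "real \<Rightarrow> 'a measure" and \<zeta> :: "'a \<Rightarrow> ennreal"
    and X :: "real \<Rightarrow> 'a \<Rightarrow> ereal"
  assumes std: "standing_setting \<Omega> F P \<zeta> X"
begin

text \<open>The fact with suffix k lacks the first k conjuncts of the definition.\<close>

lemmas std_unfolded = std[unfolded standing_setting_def]
lemmas std_1 = std_unfolded[THEN conjunct2]
lemmas std_2 = std_1[THEN conjunct2]
lemmas std_3 = std_2[THEN conjunct2]
lemmas std_4 = std_3[THEN conjunct2]
lemmas std_5 = std_4[THEN conjunct2]
lemmas std_6 = std_5[THEN conjunct2]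
lemmas std_7 = std_6[THEN conjunct2]
lemmas std_8 = std_7[THEN conjunct2]
lemmas std_9 = std_8[THEN conjunct2]
lemmas std_10 = std_9[THEN conjunct2]
lemmas std_11 = std_10[THEN conjunct2]
lemmas std_12 = std_11[THEN conjunct2]
lemmas std_13 = std_12[THEN conjunct2]

lemma space_F: "0 \<le> t \<Longrightarrow> space (F t) = \<Omega>"
  using std_unfolded[THEN conjunct1] by blast

lemma F_mono: "0 \<le> s \<Longrightarrow> s \<le> t \<Longrightarrow> A \<in> sets (F s) \<Longrightarrow> A \<in> sets (F t)"
  using std_1[THEN conjunct1] by blast

lemma prob_P: "prob_space (P x)" and space_P: "space (P x) = \<Omega>"
  and F_infty_sub: "sets (F_infty \<Omega> F) \<subseteq> sets (P x)"
  using std_2[THEN conjunct1] by blast+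

sublocale P: prob_space "P x" for x by (rule prob_P)

lemma stopping_zeta: "stopping_timeF F \<zeta>" by (rule std_5[THEN conjunct1])

lemma cadlag_path: "\<omega> \<in> \<Omega> \<Longrightarrow> cadlag_until (\<lambda>t. X t \<omega>) (\<zeta> \<omega>)"
  unfolding cadlag_until_def
  by (rule conjI[OF bspec[OF std_7[THEN conjunct1]] bspec[OF std_8[THEN conjunct1]]])

lemma AE_zeta_minus: "AE \<omega> in P x. 0 < \<zeta> \<omega> \<and> \<zeta> \<omega> < \<infinity> \<longrightarrow>
        (\<exists>l. l \<noteq> -\<infinity> \<and> ((\<lambda>s. X s \<omega>) \<longlongrightarrow> l) (at_left (enn2real (\<zeta> \<omega>))))"
  by (rule std_9[THEN conjunct1, rule_format])

lemma AE_X_0: "AE \<omega> in P x. X 0 \<omega> = ereal x"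
  by (rule std_11[THEN conjunct1, rule_format])

lemma strong_markov:
  assumes "stopping_timeF F S" "H \<in> borel_measurable path_space"
  obtains C where "C \<in> borel_measurable (F_at \<Omega> F S)"
    "\<And>A. A \<in> sets (F_at \<Omega> F S) \<Longrightarrow> (\<integral>\<^sup>+\<omega>. C \<omega> * indicator A \<omega> \<partial>P x) =
               (\<integral>\<^sup>+\<omega>. H (shifted_path X S \<omega>) * indicator {\<omega>. S \<omega> < \<zeta> \<omega>} \<omega>
                         * indicator A \<omega> \<partial>P x)"
    "AE \<omega> in P x. S \<omega> < \<zeta> \<omega> \<longrightarrow>
               C \<omega> = (\<integral>\<^sup>+\<omega>'. H (path_of X \<omega>') \<partial>P (real_of_ereal (X_at X \<zeta> S \<omega>)))"
  using std_12[THEN conjunct1, rule_format, OF assms, of x] by blast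

lemma quasi_left_continuous:
  fixes T :: "'a \<Rightarrow> ennreal"
  assumes "\<And>n. stopping_timeF F (Ts n)"
    and "\<And>x. AE \<omega> in P x. incseq (\<lambda>n. Ts n \<omega>) \<and> (\<lambda>n. Ts n \<omega>) \<longlonglongrightarrow> T \<omega>"
  shows "AE \<omega> in P x. T \<omega> < \<zeta> \<omega> \<longrightarrow> (\<lambda>n. X_at X \<zeta> (Ts n) \<omega>) \<longlonglongrightarrow> X_at X \<zeta> T \<omega>"
  using std_13[THEN conjunct1] assms by blast

lemma not_announceable:
  assumes "\<And>n. stopping_timeF F (Ts n)" and "\<And>x. AE \<omega> in P x. incseq (\<lambda>n. Ts n \<omega>)"
  shows "AE \<omega> in P x. \<not> ((\<forall>n. Ts n \<omega> < \<zeta> \<omega>) \<and> (\<lambda>n. Ts n \<omega>) \<longlonglongrightarrow> \<zeta> \<omega> \<and>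
                              \<zeta> \<omega> < \<infinity> \<and> zeta_minus X \<zeta> \<omega> < \<infinity>)"
proof -
  have "negligible P {\<omega>\<in>\<Omega>. (\<forall>n. Ts n \<omega> < \<zeta> \<omega>) \<and> (\<lambda>n. Ts n \<omega>) \<longlonglongrightarrow> \<zeta> \<omega> \<and>
                              \<zeta> \<omega> < \<infinity> \<and> zeta_minus X \<zeta> \<omega> < \<infinity>}"
    using std_13[THEN conjunct2] assms by blast
  then have "{\<omega>\<in>\<Omega>. (\<forall>n. Ts n \<omega> < \<zeta> \<omega>) \<and> (\<lambda>n. Ts n \<omega>) \<longlonglongrightarrow> \<zeta> \<omega> \<and>
                              \<zeta> \<omega> < \<infinity> \<and> zeta_minus X \<zeta> \<omega> < \<infinity>} \<in> null_sets (P x)"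
    unfolding negligible_def by blast
  then show ?thesis by (rule AE_I') (auto simp: space_P)
qed

lemma sets_F_subset: "0 \<le> t \<Longrightarrow> A \<in> sets (F t) \<Longrightarrow> A \<subseteq> \<Omega>"
  using sets.sets_into_space[of A "F t"] by (simp add: space_F)

lemma F_in_F_infty: "0 \<le> t \<Longrightarrow> A \<in> sets (F t) \<Longrightarrow> A \<in> sets (F_infty \<Omega> F)"
  unfolding F_infty_def using sets_F_subset
  by (subst sets_measure_of) (auto intro!: sigma_sets.Basic)

lemma F_in_P: "0 \<le> t \<Longrightarrow> A \<in> sets (F t) \<Longrightarrow> A \<in> sets (P x)"
  using F_in_F_infty F_infty_sub by blast

lemma adapted: "0 \<le> t \<Longrightarrow> X t \<in> borel_measurable (F t)"
  using std_4[THEN conjunct1] by blast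

lemma X_measurable_F: "0 \<le> s \<Longrightarrow> s \<le> t \<Longrightarrow> X s \<in> borel_measurable (F t)"
proof (rule measurableI)
  fix B :: "ereal set" assume "0 \<le> s" "s \<le> t" "B \<in> sets borel"
  then show "X s -` B \<inter> space (F t) \<in> sets (F t)"
    using F_mono[OF _ _ measurable_sets[OF adapted]] space_F by (metis order_trans)
qed simp

lemma X_measurable: "0 \<le> t \<Longrightarrow> X t \<in> borel_measurable (P x)"
proof (rule measurableI)
  fix B :: "ereal set" assume "0 \<le> t" "B \<in> sets borel"
  then show "X t -` B \<inter> space (P x) \<in> sets (P x)"
    using F_in_P[OF _ measurable_sets[OF adapted]] space_F space_P by metis
qed simp

lemma alive_in_F: "0 \<le> t \<Longrightarrow> {\<omega>\<in>\<Omega>. ennreal t < \<zeta> \<omega>} \<in> sets (F t)"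
proof -
  assume t: "0 \<le> t"
  have "space (F t) - {\<omega>\<in>space (F t). \<zeta> \<omega> \<le> ennreal t} \<in> sets (F t)"
    using stopping_zeta t unfolding stopping_timeF_def by auto
  moreover have "space (F t) - {\<omega>\<in>space (F t). \<zeta> \<omega> \<le> ennreal t} = {\<omega>\<in>\<Omega>. ennreal t < \<zeta> \<omega>}"
    using t by (auto simp: space_F)
  ultimately show ?thesis by simp
qed

lemma alive_in_P: "0 \<le> t \<Longrightarrow> {\<omega>\<in>\<Omega>. ennreal t < \<zeta> \<omega>} \<in> sets (P x)"
  using alive_in_F F_in_P by blast

lemma path_measurable: "path_of X \<in> measurable (P x) path_space"
  unfolding path_of_def path_space_def by (intro measurable_restrict X_measurable) auto

text \<open>The strong Markov property at a constant time, in integrated form. The caller supplies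
  the inner expectation as \<open>K\<close> on the surviving part of \<open>A\<close>, so no
  measurability of the kernel in the starting point enters.\<close>

lemma markov_property:
  assumes s: "0 \<le> s" and A: "A \<in> sets (F s)" and H: "H \<in> borel_measurable path_space"
    and K: "\<And>\<omega>. \<omega> \<in> A \<Longrightarrow> ennreal s < \<zeta> \<omega> \<Longrightarrow> (\<integral>\<^sup>+\<omega>'. H (path_of X \<omega>') \<partial>P (real_of_ereal (X s \<omega>))) = K \<omega>"
  shows "(\<integral>\<^sup>+\<omega>. H (restrict (\<lambda>r. X (s + r) \<omega>) {0..}) * indicator (A \<inter> {\<omega>. ennreal s < \<zeta> \<omega>}) \<omega> \<partial>P x)
    = (\<integral>\<^sup>+\<omega>. K \<omega> * indicator (A \<inter> {\<omega>. ennreal s < \<zeta> \<omega>}) \<omega> \<partial>P x)"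
proof -
  let ?S = "\<lambda>\<omega>::'a. ennreal s"
  let ?A = "A \<inter> {\<omega>. ennreal s < \<zeta> \<omega>}"
  have st: "stopping_timeF F ?S" unfolding stopping_timeF_def
  proof (intro allI impI)
    fix t :: real assume "0 \<le> t"
    have "{\<omega> \<in> space (F t). ennreal s \<le> ennreal t} = (if ennreal s \<le> ennreal t then space (F t) else {})" by auto
    then show "{\<omega> \<in> space (F t). ennreal s \<le> ennreal t} \<in> sets (F t)" by simp
  qed
  have "?A = A \<inter> {\<omega>\<in>\<Omega>. ennreal s < \<zeta> \<omega>}" using sets_F_subset[OF s A] by auto
  then have A': "?A \<in> sets (F s)" using A alive_in_F[OF s] by auto
  have "?A \<in> sets (F_at \<Omega> F ?S)"
  proof -
    let ?G = "{A \<in> sets (F_infty \<Omega> F). \<forall>t\<ge>0. {\<omega>\<in>A. ennreal s \<le> ennreal t} \<in> sets (F t)}"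
    have "?A \<in> ?G"
    proof (intro CollectI conjI allI impI F_in_F_infty[OF s A'])
      fix t :: real assume t: "0 \<le> t"
      show "{\<omega> \<in> ?A. ennreal s \<le> ennreal t} \<in> sets (F t)"
      proof (cases "s \<le> t")
        case True
        then have "{\<omega> \<in> ?A. ennreal s \<le> ennreal t} = ?A" by (auto simp: ennreal_leI)
        then show ?thesis using F_mono[OF s True A'] by (simp only:)
      next
        case False
        then have "{\<omega> \<in> ?A. ennreal s \<le> ennreal t} = {}" using t s by (auto simp: ennreal_le_iff)
        then show ?thesis by (simp only: sets.empty_sets)
      qed
    qed
    moreover have sub: "?G \<subseteq> Pow \<Omega>"
      using F_infty_sub[of x] sets.sets_into_space[of _ "P x"] space_P[of x] by blast
    ultimately show ?thesis unfolding F_at_def sets_measure_of[OF sub] by (blast intro: sigma_sets.Basic)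
  qed
  moreover obtain C where
    C: "\<And>A. A \<in> sets (F_at \<Omega> F ?S) \<Longrightarrow> (\<integral>\<^sup>+\<omega>. C \<omega> * indicator A \<omega> \<partial>P x) =
               (\<integral>\<^sup>+\<omega>. H (shifted_path X ?S \<omega>) * indicator {\<omega>. ?S \<omega> < \<zeta> \<omega>} \<omega> * indicator A \<omega> \<partial>P x)"
    "AE \<omega> in P x. ?S \<omega> < \<zeta> \<omega> \<longrightarrow>
               C \<omega> = (\<integral>\<^sup>+\<omega>'. H (path_of X \<omega>') \<partial>P (real_of_ereal (X_at X \<zeta> ?S \<omega>)))"
    using strong_markov[OF st H, of x] by blast
  ultimately have "(\<integral>\<^sup>+\<omega>. H (shifted_path X ?S \<omega>) * indicator {\<omega>. ?S \<omega> < \<zeta> \<omega>} \<omega> * indicator ?A \<omega> \<partial>P x)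
      = (\<integral>\<^sup>+\<omega>. C \<omega> * indicator ?A \<omega> \<partial>P x)" by simp
  also have "\<dots> = (\<integral>\<^sup>+\<omega>. K \<omega> * indicator ?A \<omega> \<partial>P x)"
  proof (rule nn_integral_cong_AE)
    show "AE \<omega> in P x. C \<omega> * indicator ?A \<omega> = K \<omega> * indicator ?A \<omega>"
      using C(2)
    proof eventually_elim
      fix \<omega> assume "?S \<omega> < \<zeta> \<omega> \<longrightarrow> C \<omega> = (\<integral>\<^sup>+\<omega>'. H (path_of X \<omega>') \<partial>P (real_of_ereal (X_at X \<zeta> ?S \<omega>)))"
      then show "C \<omega> * indicator ?A \<omega> = K \<omega> * indicator ?A \<omega>"
        using K[of \<omega>] s by (cases "\<omega> \<in> ?A") (auto simp: X_at_def)
    qed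
  qed
  also have "(\<integral>\<^sup>+\<omega>. H (shifted_path X ?S \<omega>) * indicator {\<omega>. ?S \<omega> < \<zeta> \<omega>} \<omega> * indicator ?A \<omega> \<partial>P x)
    = (\<integral>\<^sup>+\<omega>. H (restrict (\<lambda>r. X (s + r) \<omega>) {0..}) * indicator ?A \<omega> \<partial>P x)"
    using s by (intro nn_integral_cong) (auto simp: shifted_path_def split: split_indicator)
  finally show ?thesis .
qed

definition tau :: "real \<Rightarrow> 'a \<Rightarrow> ennreal" where
  "tau l \<omega> = passage_time l (\<lambda>t. X t \<omega>)"

lemma tau_le_in_F:
  assumes t: "0 \<le> t"
  shows "{\<omega>\<in>\<Omega>. tau l \<omega> \<le> ennreal t} \<in> sets (F t)"
proof -
  let ?I = "insert t (\<rat> \<inter> {0..t})"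
  have "{\<omega>\<in>\<Omega>. tau l \<omega> \<le> ennreal t} = {\<omega>\<in>space (F t). \<forall>n. \<exists>r\<in>?I. X r \<omega> < ereal (l + 1 / real (Suc n))}"
    unfolding tau_def using passage_time_le_iff_countable[OF cadlag_path t] t by (auto simp: space_F)
  also have "\<dots> \<in> sets (F t)"
  proof (intro sets.sets_Collect_countable_All sets.sets_Collect_countable_Ex')
    show "countable ?I" using countable_rat by blast
    fix n r assume "r \<in> ?I"
    then have [measurable]: "X r \<in> borel_measurable (F t)" using t by (intro X_measurable_F) auto
    show "{\<omega>\<in>space (F t). X r \<omega> < ereal (l + 1 / real (Suc n))} \<in> sets (F t)" by measurable
  qed
  finally show ?thesis .
qed

lemma tau_stopping: "stopping_timeF F (tau l)"
  unfolding stopping_timeF_def using tau_le_in_F by (auto simp: space_F)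

lemma tau_measurable[measurable]: "tau l \<in> borel_measurable (P x)"
proof -
  have "(\<lambda>\<omega>. passage_time l (path_of X \<omega>)) \<in> borel_measurable (P x)"
    by (rule measurable_compose[OF path_measurable measurable_passage_time])
  then show ?thesis unfolding tau_def[abs_def] path_of_def passage_time_restrict .
qed

text \<open>The passage time is approximated by the passage times of higher levels. If the level l
  were only reached as a left limit, these would announce a jump of X or the lifetime,
  contradicting quasi left-continuity or non-announceability.\<close>

lemma AE_tau_attained:
  "AE \<omega> in P x. tau l \<omega> < \<infinity> \<longrightarrow> tau l \<omega> < \<zeta> \<omega> \<and> X (enn2real (tau l \<omega>)) \<omega> \<le> ereal l"
proof -
  let ?T = "\<lambda>k. tau (l + 1 / real (Suc k))"
  have inc: "AE \<omega> in P x. incseq (\<lambda>k. ?T k \<omega>) \<and> (\<lambda>k. ?T k \<omega>) \<longlonglongrightarrow> tau l \<omega>" for x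
    unfolding tau_def using passage_time_tendsto[OF cadlag_path] by (intro AE_I2) (auto simp: space_P)
  have inc': "AE \<omega> in P x. incseq (\<lambda>k. ?T k \<omega>)" for x using inc[of x] by eventually_elim auto
  have sp: "AE \<omega> in P x. \<omega> \<in> \<Omega>" by (intro AE_I2) (simp add: space_P)
  show ?thesis
    using inc[of x] quasi_left_continuous[OF tau_stopping inc, of x] not_announceable[OF tau_stopping inc', of x]
      AE_zeta_minus[of x] sp
  proof eventually_elim
    fix \<omega>
    assume conv: "incseq (\<lambda>k. ?T k \<omega>) \<and> (\<lambda>k. ?T k \<omega>) \<longlonglongrightarrow> tau l \<omega>"
      and qlc: "tau l \<omega> < \<zeta> \<omega> \<longrightarrow> (\<lambda>k. X_at X \<zeta> (?T k) \<omega>) \<longlonglongrightarrow> X_at X \<zeta> (tau l) \<omega>"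
      and na: "\<not> ((\<forall>k. ?T k \<omega> < \<zeta> \<omega>) \<and> (\<lambda>k. ?T k \<omega>) \<longlonglongrightarrow> \<zeta> \<omega> \<and> \<zeta> \<omega> < \<infinity> \<and> zeta_minus X \<zeta> \<omega> < \<infinity>)"
      and zm: "0 < \<zeta> \<omega> \<and> \<zeta> \<omega> < \<infinity> \<longrightarrow> (\<exists>l. l \<noteq> -\<infinity> \<and> ((\<lambda>s. X s \<omega>) \<longlongrightarrow> l) (at_left (enn2real (\<zeta> \<omega>))))"
      and \<omega>: "\<omega> \<in> \<Omega>"
    note w = cadlag_path[OF \<omega>]
    show "tau l \<omega> < \<infinity> \<longrightarrow> tau l \<omega> < \<zeta> \<omega> \<and> X (enn2real (tau l \<omega>)) \<omega> \<le> ereal l"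
    proof (rule impI, rule ccontr)
      assume fin: "tau l \<omega> < \<infinity>" and no: "\<not> (tau l \<omega> < \<zeta> \<omega> \<and> X (enn2real (tau l \<omega>)) \<omega> \<le> ereal l)"
      obtain t where t: "0 \<le> t" "tau l \<omega> = ennreal t" using fin by (cases "tau l \<omega>") auto
      have no': "\<not> (ennreal t < \<zeta> \<omega> \<and> X t \<omega> \<le> ereal l)" using no t by simp
      note na' = passage_time_not_attained[OF w t(1) t(2)[unfolded tau_def] no', folded tau_def]
      have lt: "?T k \<omega> < ennreal t" for k using na'(3) by (simp add: tau_def)
      show False
      proof (cases "ennreal t < \<zeta> \<omega>")
        case True
        \<comment> \<open>Before the lifetime: along the passage times of the higher levels, which
          increase strictly to t, X converges to its left limit at t and, by quasi left-continuity,
          to X t. Hence X does not jump at t, and the limit is at most l.\<close>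
        obtain L where L: "((\<lambda>s. real_of_ereal (X s \<omega>)) \<longlongrightarrow> L) (at_left t)"
          using cadlag_until_left[OF w na'(1) True] by auto
        define tk where "tk k = enn2real (?T k \<omega>)" for k
        have tk: "?T k \<omega> = ennreal (tk k)" "0 \<le> tk k" "tk k < t" for k
        proof -
          show 1: "?T k \<omega> = ennreal (tk k)" using lt[of k] unfolding tk_def by (cases "?T k \<omega>") auto
          show 2: "0 \<le> tk k" by (simp add: tk_def)
          show "tk k < t" using lt[of k] unfolding 1 using 2 by (simp add: ennreal_less_iff)
        qed
        have "(\<lambda>k. ennreal (tk k)) \<longlonglongrightarrow> ennreal t" using conv unfolding tk(1) t(2) by auto
        then have "tk \<longlonglongrightarrow> t" using tk(2) t(1) by (simp add: tendsto_ennreal_iff)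
        then have "filterlim tk (at_left t) sequentially"
          unfolding filterlim_at using tk(3) by (auto simp: less_imp_neq)
        from filterlim_compose[OF L this] have "(\<lambda>k. real_of_ereal (X (tk k) \<omega>)) \<longlonglongrightarrow> L" .
        then have "(\<lambda>k. ereal (real_of_ereal (X (tk k) \<omega>))) \<longlonglongrightarrow> ereal L" by simp
        moreover have "ereal (real_of_ereal (X (tk k) \<omega>)) = X_at X \<zeta> (?T k) \<omega>" for k
        proof -
          have a: "ennreal (tk k) < \<zeta> \<omega>" using lt[of k] True unfolding tk(1) by (rule less_trans)
          have "\<bar>X (tk k) \<omega>\<bar> \<noteq> \<infinity>" using cadlag_until_finite[OF w tk(2) a] .
          then show ?thesis unfolding X_at_def tk(1) using a tk(2) by (simp add: ereal_real)
        qed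
        ultimately have "(\<lambda>k. X_at X \<zeta> (?T k) \<omega>) \<longlonglongrightarrow> ereal L" by simp
        moreover have "(\<lambda>k. X_at X \<zeta> (?T k) \<omega>) \<longlonglongrightarrow> X t \<omega>"
          using qlc t True by (simp add: X_at_def)
        ultimately have XL: "X t \<omega> = ereal L" using LIMSEQ_unique by blast
        have "((\<lambda>s. ereal (real_of_ereal (X s \<omega>))) \<longlongrightarrow> ereal L) (at_left t)" using L by simp
        moreover have "eventually (\<lambda>s. ereal (real_of_ereal (X s \<omega>)) = X s \<omega>) (at_left t)"
        proof -
          have "eventually (\<lambda>s. 0 < s \<and> s < t) (at_left t)"
            using na'(1) eventually_at_left_field by blast
          then show ?thesis
          proof eventually_elim
            case (elim s)
            have "ennreal s < \<zeta> \<omega>" using elim True by (meson ennreal_leI le_less_trans less_imp_le)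
            then have "\<bar>X s \<omega>\<bar> \<noteq> \<infinity>" using cadlag_until_finite[OF w, of s] elim by auto
            then show ?case by (simp add: ereal_real)
          qed
        qed
        ultimately have "((\<lambda>s. X s \<omega>) \<longlongrightarrow> ereal L) (at_left t)" by (rule Lim_transform_eventually)
        then have "ereal L \<le> ereal l" using na'(4) by (rule frequently_less_imp_limit_le)
        then show False using no' XL True by simp
      next
        case False
        then have zt: "\<zeta> \<omega> = ennreal t" using na'(2) by auto
        obtain L where L: "L \<noteq> -\<infinity>" "((\<lambda>s. X s \<omega>) \<longlongrightarrow> L) (at_left t)"
          using zm zt na'(1) t(1) by auto
        have "L \<le> ereal l" using L(2) na'(4) by (rule frequently_less_imp_limit_le)
        moreover have "zeta_minus X \<zeta> \<omega> = L"
          unfolding zeta_minus_def using L zt t(1) tendsto_Lim[OF _ L(2)] by auto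
        ultimately have "zeta_minus X \<zeta> \<omega> < \<infinity>" by auto
        then show False using na lt conv zt t by auto
      qed
    qed
  qed
qed

text \<open>Once the passage is attained, its time belongs to the set whose infimum is
  \<open>T_minus\<close>. This transfers the hypothesis to the stopping time
  \<open>tau\<close>.\<close>

lemma AE_T_minus_eq_tau: "AE \<omega> in P x. T_minus X \<zeta> l \<omega> = tau l \<omega>"
proof -
  have sp: "AE \<omega> in P x. \<omega> \<in> \<Omega>" by (intro AE_I2) (simp add: space_P)
  show ?thesis using AE_tau_attained[of l x] sp
  proof eventually_elim
    fix \<omega> assume att: "tau l \<omega> < \<infinity> \<longrightarrow> tau l \<omega> < \<zeta> \<omega> \<and> X (enn2real (tau l \<omega>)) \<omega> \<le> ereal l" and \<omega>: "\<omega> \<in> \<Omega>"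
    show "T_minus X \<zeta> l \<omega> = tau l \<omega>"
    proof (rule antisym)
      show "tau l \<omega> \<le> T_minus X \<zeta> l \<omega>"
        unfolding T_minus_def tau_def by (rule Inf_greatest) (auto intro: passage_time_leI[OF cadlag_path[OF \<omega>]])
      show "T_minus X \<zeta> l \<omega> \<le> tau l \<omega>"
      proof (cases "tau l \<omega> < \<infinity>")
        case True
        then show ?thesis unfolding T_minus_def using att
          by (intro Inf_lower CollectI exI[of _ "enn2real (tau l \<omega>)"]) auto
      qed (simp add: less_top[symmetric])
    qed
  qed
qed

end

section \<open>The increments of the process\<close>

text \<open>\<open>enn2real\<close> sends infinity to 0, hence the separate case: a passage that
  never takes place contributes 0, not 1.\<close>

definition discount :: "real \<Rightarrow> ennreal \<Rightarrow> real" where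
  "discount q T = (if T = \<infinity> then 0 else exp (- q * enn2real T))"

lemma measurable_discount[measurable]: "discount q \<in> borel_measurable borel"
  unfolding discount_def[abs_def] by measurable

lemma discount_nonneg: "0 \<le> discount q T" by (simp add: discount_def)

lemma discount_le_1: "0 \<le> q \<Longrightarrow> discount q T \<le> 1" by (simp add: discount_def)

lemma discount_add: "0 \<le> t \<Longrightarrow> discount q (ennreal t + T) = exp (- q * t) * discount q T"
  by (cases T) (auto simp: discount_def algebra_simps simp flip: exp_add ennreal_plus)

lemma discount_antimono: "q \<le> q' \<Longrightarrow> discount q' T \<le> discount q T"
  by (auto simp: discount_def mult_right_mono)

text \<open>Transition kernel of a process killed to the cemetery whose surviving increments have the
  sub-probability law N.\<close>

definition killed_kernel :: "real measure \<Rightarrow> ereal \<Rightarrow> ereal set \<Rightarrow> ennreal" where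
  "killed_kernel N y B = (if y = \<infinity> then indicator B \<infinity>
     else (\<integral>\<^sup>+r. indicator B (ereal (real_of_ereal y + r)) \<partial>N) + (1 - emeasure N UNIV) * indicator B \<infinity>)"

lemma measurable_killed_kernel:
  assumes N: "finite_measure N" and [measurable_cong]: "sets N = sets borel" and [measurable]: "B \<in> sets borel"
  shows "(\<lambda>y. killed_kernel N y B) \<in> borel_measurable borel"
proof -
  interpret finite_measure N by fact
  show ?thesis unfolding killed_kernel_def by measurable
qed

locale passage_setting = standing \<Omega> F P \<zeta> X
  for \<Omega> :: "'a set" and F P :: "real \<Rightarrow> 'a measure" and \<zeta> :: "'a \<Rightarrow> ennreal"
    and X :: "real \<Rightarrow> 'a \<Rightarrow> ereal" +
  fixes Q :: real and \<phi> :: "real \<Rightarrow> real"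
  assumes nnj: "no_negative_jumps P \<zeta> X" and ph: "passage_hyp P \<zeta> X Q \<phi>"
begin

section \<open>Regularity of the passage exponent and the passage identity\<close>

lemma Q_nonneg: "0 \<le> Q" and phi_pos: "Q < q \<Longrightarrow> 0 < \<phi> q"
  using ph unfolding passage_hyp_def by auto

lemma nn_passage_laplace:
  assumes "l \<le> x" "Q < q"
  shows "(\<integral>\<^sup>+\<omega>. ennreal (discount q (tau l \<omega>)) \<partial>P x) = ennreal (exp (- \<phi> q * (x - l)))"
proof -
  have "(\<integral>\<^sup>+\<omega>. ennreal (discount q (tau l \<omega>)) \<partial>P x)
    = (\<integral>\<^sup>+\<omega>. ennreal (exp (- q * enn2real (T_minus X \<zeta> l \<omega>))) * indicator {\<omega>. T_minus X \<zeta> l \<omega> < \<zeta> \<omega>} \<omega> \<partial>P x)"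
  proof (rule nn_integral_cong_AE)
    show "AE \<omega> in P x. ennreal (discount q (tau l \<omega>))
      = ennreal (exp (- q * enn2real (T_minus X \<zeta> l \<omega>))) * indicator {\<omega>. T_minus X \<zeta> l \<omega> < \<zeta> \<omega>} \<omega>"
      using AE_T_minus_eq_tau[of l x] AE_tau_attained[of l x]
      by eventually_elim (auto simp: discount_def less_top split: split_indicator)
  qed
  also have "\<dots> = ennreal (exp (- \<phi> q * (x - l)))"
    using ph assms unfolding passage_hyp_def by blast
  finally show ?thesis .
qed

lemma passage_laplace:
  assumes "l \<le> x" "Q < q"
  shows "(\<integral>\<omega>. discount q (tau l \<omega>) \<partial>P x) = exp (- \<phi> q * (x - l))"
  by (subst integral_eq_nn_integral) (auto simp: nn_passage_laplace[OF assms] discount_nonneg)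

lemma AE_tau_pos:
  assumes "l < x"
  shows "AE \<omega> in P x. 0 < tau l \<omega>"
proof -
  have sp: "AE \<omega> in P x. \<omega> \<in> \<Omega>" by (intro AE_I2) (simp add: space_P)
  show ?thesis using AE_X_0[of x] sp
  proof eventually_elim
    fix \<omega> assume X0: "X 0 \<omega> = ereal x" and \<omega>: "\<omega> \<in> \<Omega>"
    obtain n where "1 / real (Suc n) < x - l" using nat_approx_posE[of "x - l"] assms by auto
    then have "\<not> X 0 \<omega> < ereal (l + 1 / real (Suc n))" using X0 by simp
    then have "\<not> tau l \<omega> \<le> ennreal 0"
      unfolding tau_def passage_time_le_iff[OF cadlag_path[OF \<omega>] order_refl] by (metis order_antisym)
    then show "0 < tau l \<omega>" by (simp add: zero_less_iff_neq_zero)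
  qed
qed

text \<open>exp (- phi q) is the Laplace transform of the passage time from 0 to -1, so continuity
  is dominated convergence.\<close>

lemma phi_tendsto:
  assumes "\<And>n. Q < c n" "c \<longlonglongrightarrow> q" "Q < q"
  shows "(\<lambda>n. \<phi> (c n)) \<longlonglongrightarrow> \<phi> q"
proof -
  have "(\<lambda>n. \<integral>\<omega>. discount (c n) (tau (-1) \<omega>) \<partial>P 0) \<longlonglongrightarrow> (\<integral>\<omega>. discount q (tau (-1) \<omega>) \<partial>P 0)"
  proof (rule integral_dominated_convergence[where w="\<lambda>_. 1"])
    show "AE \<omega> in P 0. (\<lambda>n. discount (c n) (tau (-1) \<omega>)) \<longlonglongrightarrow> discount q (tau (-1) \<omega>)"
      unfolding discount_def using assms(2) by (intro AE_I2) (auto intro!: tendsto_intros)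
    show "AE \<omega> in P 0. norm (discount (c n) (tau (-1) \<omega>)) \<le> 1" for n
      using assms(1)[of n] Q_nonneg by (intro AE_I2) (auto simp: discount_nonneg intro!: discount_le_1)
  qed auto
  then have "(\<lambda>n. exp (- \<phi> (c n))) \<longlonglongrightarrow> exp (- \<phi> q)"
    using assms by (simp add: passage_laplace)
  from tendsto_ln[OF this] show ?thesis by (simp add: tendsto_minus_cancel_left[symmetric])
qed

text \<open>The passage from 0 to -1 takes positive time, so its transform vanishes as q grows. It
  follows that every z \<ge> 0 lies below a point where the transform of the increments is
  known.\<close>

lemma phi_unbounded:
  obtains q where "Q < q" "z \<le> \<phi> q"
proof -
  define c where "c n = Q + 1 + real n" for n
  have c: "Q < c n" for n by (simp add: c_def)
  have "(\<lambda>n. \<integral>\<omega>. discount (c n) (tau (-1) \<omega>) \<partial>P 0) \<longlonglongrightarrow> (\<integral>\<omega>. 0 \<partial>P 0)"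
  proof (rule integral_dominated_convergence[where w="\<lambda>_. 1"])
    show "AE \<omega> in P 0. (\<lambda>n. discount (c n) (tau (-1) \<omega>)) \<longlonglongrightarrow> 0"
      using AE_tau_pos[of "-1" 0, simplified]
    proof eventually_elim
      fix \<omega> assume "0 < tau (-1) \<omega>"
      show "(\<lambda>n. discount (c n) (tau (-1) \<omega>)) \<longlonglongrightarrow> 0"
      proof (cases "tau (-1) \<omega>")
        case (real T)
        then have T: "0 < T" using \<open>0 < tau (-1) \<omega>\<close> by auto
        have "filterlim (\<lambda>n. - c n * T) at_bot sequentially"
          unfolding c_def using T by real_asymp
        from filterlim_compose[OF exp_at_bot this] show ?thesis using real by (simp add: discount_def)
      qed (simp add: discount_def)
    qed
    show "AE \<omega> in P 0. norm (discount (c n) (tau (-1) \<omega>)) \<le> 1" for n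
      using c[of n] Q_nonneg by (intro AE_I2) (auto simp: discount_nonneg intro!: discount_le_1)
  qed auto
  then have "(\<lambda>n. exp (- \<phi> (c n))) \<longlonglongrightarrow> 0" using c by (simp add: passage_laplace)
  then have "eventually (\<lambda>n. exp (- \<phi> (c n)) < exp (- z)) sequentially"
    by (rule order_tendstoD) simp
  then obtain n where "exp (- \<phi> (c n)) < exp (- z)" by (meson eventually_sequentially order_refl)
  then show ?thesis using that[of "c n"] c by simp
qed

text \<open>Equality at two rates would force the passage time to be 0 or infinite almost surely. It
  is positive, and if it were always infinite its transform would be 0 and not an
  exponential.\<close>

lemma phi_strict_mono:
  assumes "Q < q" "q < q'"
  shows "\<phi> q < \<phi> q'"
proof -
  have int: "integrable (P 0) (\<lambda>\<omega>. discount q (tau (-1) \<omega>))" if "Q < q" for q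
    using that Q_nonneg by (intro P.integrable_const_bound[of _ 1]) (auto simp: discount_nonneg intro!: discount_le_1)
  have le: "exp (- \<phi> q') \<le> exp (- \<phi> q)"
    using assms integral_mono[OF int[of q'] int[of q]] by (simp add: passage_laplace discount_antimono)
  moreover have "exp (- \<phi> q') \<noteq> exp (- \<phi> q)"
  proof
    assume eq: "exp (- \<phi> q') = exp (- \<phi> q)"
    have "(\<integral>\<omega>. discount q (tau (-1) \<omega>) - discount q' (tau (-1) \<omega>) \<partial>P 0) = 0"
      using assms eq int by (subst Bochner_Integration.integral_diff) (auto simp: passage_laplace)
    then have "AE \<omega> in P 0. discount q (tau (-1) \<omega>) - discount q' (tau (-1) \<omega>) = 0"
      using assms int discount_antimono[of q q'] by (subst integral_nonneg_eq_0_iff_AE[symmetric]) auto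
    then have "AE \<omega> in P 0. discount q (tau (-1) \<omega>) = 0"
      using AE_tau_pos[of "-1" 0, simplified]
    proof eventually_elim
      fix \<omega> assume a: "discount q (tau (-1) \<omega>) - discount q' (tau (-1) \<omega>) = 0" "0 < tau (-1) \<omega>"
      show "discount q (tau (-1) \<omega>) = 0"
        using a assms by (cases "tau (-1) \<omega>") (auto simp: discount_def)
    qed
    then have "(\<integral>\<omega>. discount q (tau (-1) \<omega>) \<partial>P 0) = (\<integral>\<omega>. 0 \<partial>P 0)" by (intro integral_cong_AE) auto
    then show False using assms by (simp add: passage_laplace)
  qed
  ultimately have "exp (- \<phi> q') < exp (- \<phi> q)" by simp
  then show ?thesis by simp
qed

text \<open>Paths are split according to whether level l was passed by time t. Those that were not,
  and are alive, restart at X t above l, where the remaining passage has the known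
  transform.\<close>

lemma passage_decomposition:
  assumes lx: "l \<le> x" and q: "Q < q" and t: "0 \<le> t"
  shows "ennreal (exp (- \<phi> q * (x - l))) =
    (\<integral>\<^sup>+\<omega>. ennreal (discount q (tau l \<omega>)) * indicator {\<omega>\<in>\<Omega>. tau l \<omega> \<le> ennreal t} \<omega> \<partial>P x)
    + (\<integral>\<^sup>+\<omega>. ennreal (exp (- q * t) * exp (- \<phi> q * (real_of_ereal (X t \<omega>) - l)))
        * indicator ((\<Omega> - {\<omega>\<in>\<Omega>. tau l \<omega> \<le> ennreal t}) \<inter> {\<omega>. ennreal t < \<zeta> \<omega>}) \<omega> \<partial>P x)"
proof -
  let ?B = "{\<omega>\<in>\<Omega>. tau l \<omega> \<le> ennreal t}"
  let ?A = "\<Omega> - ?B"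
  let ?H = "\<lambda>w. ennreal (exp (- q * t)) * ennreal (discount q (passage_time l w))"
  have AF: "?A \<in> sets (F t)" using tau_le_in_F[OF t, of l] sets.compl_sets[of ?B "F t"] t by (simp add: space_F)
  have [measurable]: "?B \<in> sets (P x)" by (rule F_in_P[OF t tau_le_in_F[OF t]])
  have [measurable]: "?A \<in> sets (P x)" by (rule F_in_P[OF t AF])
  have "ennreal (exp (- \<phi> q * (x - l))) = (\<integral>\<^sup>+\<omega>. ennreal (discount q (tau l \<omega>)) \<partial>P x)"
    using nn_passage_laplace[OF lx q] by simp
  also have "\<dots> = (\<integral>\<^sup>+\<omega>. ennreal (discount q (tau l \<omega>)) * indicator ?B \<omega> + ennreal (discount q (tau l \<omega>)) * indicator ?A \<omega> \<partial>P x)"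
    by (intro nn_integral_cong) (auto simp: space_P split: split_indicator)
  also have "\<dots> = (\<integral>\<^sup>+\<omega>. ennreal (discount q (tau l \<omega>)) * indicator ?B \<omega> \<partial>P x) + (\<integral>\<^sup>+\<omega>. ennreal (discount q (tau l \<omega>)) * indicator ?A \<omega> \<partial>P x)"
    by (intro nn_integral_add) measurable
  also have "(\<integral>\<^sup>+\<omega>. ennreal (discount q (tau l \<omega>)) * indicator ?A \<omega> \<partial>P x)
      = (\<integral>\<^sup>+\<omega>. ?H (restrict (\<lambda>r. X (t + r) \<omega>) {0..}) * indicator (?A \<inter> {\<omega>. ennreal t < \<zeta> \<omega>}) \<omega> \<partial>P x)"
  proof (rule nn_integral_cong_AE)
    show "AE \<omega> in P x. ennreal (discount q (tau l \<omega>)) * indicator ?A \<omega>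
      = ?H (restrict (\<lambda>r. X (t + r) \<omega>) {0..}) * indicator (?A \<inter> {\<omega>. ennreal t < \<zeta> \<omega>}) \<omega>"
      using AE_tau_attained[of l x]
    proof eventually_elim
      fix \<omega> assume att: "tau l \<omega> < \<infinity> \<longrightarrow> tau l \<omega> < \<zeta> \<omega> \<and> X (enn2real (tau l \<omega>)) \<omega> \<le> ereal l"
      show "ennreal (discount q (tau l \<omega>)) * indicator ?A \<omega>
        = ?H (restrict (\<lambda>r. X (t + r) \<omega>) {0..}) * indicator (?A \<inter> {\<omega>. ennreal t < \<zeta> \<omega>}) \<omega>"
      proof (cases "\<omega> \<in> ?A")
        case A: True
        show ?thesis
        proof (cases "ennreal t < \<zeta> \<omega>")
          case True
          have "tau l \<omega> = ennreal t + passage_time l (\<lambda>r. X (t + r) \<omega>)"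
            unfolding tau_def using A t by (intro passage_time_shift[OF cadlag_path]) (auto simp: tau_def)
          then show ?thesis using A True t
            by (simp add: passage_time_restrict discount_add ennreal_mult discount_nonneg)
        next
          case False
          \<comment> \<open>A finite passage time precedes the lifetime, so a path dead at t that
            has not passed l by then never does.\<close>
          have "\<not> tau l \<omega> < \<infinity>"
          proof
            assume "tau l \<omega> < \<infinity>"
            then have "tau l \<omega> < \<zeta> \<omega>" using att by simp
            then have "tau l \<omega> \<le> ennreal t" using False by auto
            then show False using A by auto
          qed
          then have "tau l \<omega> = \<infinity>" by (simp add: less_top[symmetric])
          then show ?thesis using False by (simp add: discount_def)
        qed
      qed simp
    qed
  qed
  also have "\<dots> = (\<integral>\<^sup>+\<omega>. ennreal (exp (- q * t) * exp (- \<phi> q * (real_of_ereal (X t \<omega>) - l)))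
        * indicator (?A \<inter> {\<omega>. ennreal t < \<zeta> \<omega>}) \<omega> \<partial>P x)"
  proof (rule markov_property[OF t AF])
    show "?H \<in> borel_measurable path_space" by measurable
    fix \<omega> assume A: "\<omega> \<in> ?A" and alive: "ennreal t < \<zeta> \<omega>"
    have w: "cadlag_until (\<lambda>t. X t \<omega>) (\<zeta> \<omega>)" using A by (intro cadlag_path) auto
    have "\<not> X t \<omega> \<le> ereal l" using passage_time_leI[OF w t, of l] A by (auto simp: tau_def)
    then have "l \<le> real_of_ereal (X t \<omega>)" using cadlag_until_finite[OF w t alive] by (cases "X t \<omega>") auto
    then have "(\<integral>\<^sup>+\<omega>'. ennreal (discount q (tau l \<omega>')) \<partial>P (real_of_ereal (X t \<omega>))) = ennreal (exp (- \<phi> q * (real_of_ereal (X t \<omega>) - l)))"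
      using q by (rule nn_passage_laplace)
    then show "(\<integral>\<^sup>+\<omega>'. ?H (path_of X \<omega>') \<partial>P (real_of_ereal (X t \<omega>))) = ennreal (exp (- q * t) * exp (- \<phi> q * (real_of_ereal (X t \<omega>) - l)))"
      by (simp add: path_of_def passage_time_restrict tau_def[symmetric] nn_integral_cmult ennreal_mult)
  qed
  finally show ?thesis .
qed

text \<open>Letting the level tend to minus infinity removes the stopped part: by the hypothesis at the rate
  q + 1 it is of order exp (- (phi (q + 1) - phi q) n).\<close>

lemma laplace_X:
  assumes q: "Q < q" and t: "0 \<le> t"
  shows "(\<integral>\<^sup>+\<omega>. ennreal (exp (- \<phi> q * real_of_ereal (X t \<omega>))) * indicator {\<omega>\<in>\<Omega>. ennreal t < \<zeta> \<omega>} \<omega> \<partial>P x)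
    = ennreal (exp (q * t - \<phi> q * x))"
proof -
  let ?B = "\<lambda>n. {\<omega>\<in>\<Omega>. tau (- real n) \<omega> \<le> ennreal t}"
  let ?A = "\<lambda>n. (\<Omega> - ?B n) \<inter> {\<omega>. ennreal t < \<zeta> \<omega>}"
  let ?Z = "{\<omega>\<in>\<Omega>. ennreal t < \<zeta> \<omega>}"
  have [measurable]: "X t \<in> borel_measurable (P x)" by (rule X_measurable[OF t])
  have [measurable]: "?Z \<in> sets (P x)" by (rule alive_in_P[OF t])
  have [measurable]: "?B n \<in> sets (P x)" for n by (rule F_in_P[OF t tau_le_in_F[OF t]])
  have A_eq: "?A n = ?Z - ?B n" for n by auto
  have [measurable]: "?A n \<in> sets (P x)" for n unfolding A_eq by measurable
  define f where "f \<omega> = ennreal (exp (- \<phi> q * real_of_ereal (X t \<omega>)))" for \<omega>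
  have [measurable]: "f \<in> borel_measurable (P x)" unfolding f_def by measurable
  \<comment> \<open>The factor exp (phi q * n) shifts the reference level from -n to 0, so the main
    term depends on n only through the event \<open>?A n\<close>.\<close>
  define a where "a n = ennreal (exp (\<phi> q * real n)) * (\<integral>\<^sup>+\<omega>. ennreal (discount q (tau (- real n) \<omega>)) * indicator (?B n) \<omega> \<partial>P x)" for n
  define b where "b n = (\<integral>\<^sup>+\<omega>. f \<omega> * indicator (?A n) \<omega> \<partial>P x)" for n
  have dec: "ennreal (exp (- \<phi> q * x)) = a n + ennreal (exp (- q * t)) * b n" if "- real n \<le> x" for n
  proof -
    have "ennreal (exp (- \<phi> q * x)) = ennreal (exp (\<phi> q * real n)) * ennreal (exp (- \<phi> q * (x - (- real n))))"
      by (simp flip: ennreal_mult exp_add add: algebra_simps)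
    also have "\<dots> = a n + ennreal (exp (\<phi> q * real n)) * (\<integral>\<^sup>+\<omega>. ennreal (exp (- q * t) * exp (- \<phi> q * (real_of_ereal (X t \<omega>) - (- real n)))) * indicator (?A n) \<omega> \<partial>P x)"
      unfolding passage_decomposition[OF that q t] a_def by (simp add: distrib_left)
    also have "ennreal (exp (\<phi> q * real n)) * (\<integral>\<^sup>+\<omega>. ennreal (exp (- q * t) * exp (- \<phi> q * (real_of_ereal (X t \<omega>) - (- real n)))) * indicator (?A n) \<omega> \<partial>P x)
       = (\<integral>\<^sup>+\<omega>. ennreal (exp (\<phi> q * real n)) * (ennreal (exp (- q * t) * exp (- \<phi> q * (real_of_ereal (X t \<omega>) - (- real n)))) * indicator (?A n) \<omega>) \<partial>P x)"
      by (rule nn_integral_cmult[symmetric]) measurable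
    also have "\<dots> = (\<integral>\<^sup>+\<omega>. ennreal (exp (- q * t)) * (f \<omega> * indicator (?A n) \<omega>) \<partial>P x)"
      unfolding f_def
      by (intro nn_integral_cong) (auto simp flip: ennreal_mult exp_add simp: algebra_simps split: split_indicator)
    also have "\<dots> = ennreal (exp (- q * t)) * b n" unfolding b_def by (rule nn_integral_cmult) measurable
    finally show ?thesis .
  qed
  have "a \<longlonglongrightarrow> 0"
  proof (rule tendsto_sandwich[OF _ _ tendsto_const])
    \<comment> \<open>On passages before t the discount at rate q is at most exp t times the one at
      rate q + 1. The hypothesis at q + 1 then leaves a decay with rate phi (q + 1) - phi q >
      0.\<close>
    define u where "u n = exp (t - \<phi> (q + 1) * x) * exp (- (\<phi> (q + 1) - \<phi> q) * real n)" for n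
    have d: "0 < \<phi> (q + 1) - \<phi> q" using phi_strict_mono[OF q, of "q + 1"] by simp
    have "u \<longlonglongrightarrow> exp (t - \<phi> (q + 1) * x) * 0"
      unfolding u_def
    proof (intro tendsto_mult tendsto_const)
      have "filterlim (\<lambda>n. - (\<phi> (q + 1) - \<phi> q) * real n) at_bot sequentially" using d by real_asymp
      from filterlim_compose[OF exp_at_bot this] show "(\<lambda>n. exp (- (\<phi> (q + 1) - \<phi> q) * real n)) \<longlonglongrightarrow> 0" .
    qed
    then show "(\<lambda>n. ennreal (u n)) \<longlonglongrightarrow> 0" using tendsto_ennrealI[of u 0] by simp
    have "eventually (\<lambda>n. - x \<le> real n) sequentially" using eventually_ge_at_top[of "nat \<lceil>- x\<rceil>"]
      by eventually_elim linarith
    then show "eventually (\<lambda>n. a n \<le> ennreal (u n)) sequentially"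
    proof eventually_elim
      fix n assume n: "- x \<le> real n"
      have "(\<integral>\<^sup>+\<omega>. ennreal (discount q (tau (- real n) \<omega>)) * indicator (?B n) \<omega> \<partial>P x)
        \<le> (\<integral>\<^sup>+\<omega>. ennreal (exp t) * ennreal (discount (q + 1) (tau (- real n) \<omega>)) \<partial>P x)"
      proof (rule nn_integral_mono)
        fix \<omega>
        show "ennreal (discount q (tau (- real n) \<omega>)) * indicator (?B n) \<omega> \<le> ennreal (exp t) * ennreal (discount (q + 1) (tau (- real n) \<omega>))"
        proof (cases "\<omega> \<in> ?B n")
          case True
          then have le: "tau (- real n) \<omega> \<le> ennreal t" by auto
          then obtain T where T: "tau (- real n) \<omega> = ennreal T" "0 \<le> T" by (cases "tau (- real n) \<omega>") (auto simp: top_unique)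
          then have "T \<le> t" using le t by simp
          then have "discount q (tau (- real n) \<omega>) \<le> exp t * discount (q + 1) (tau (- real n) \<omega>)"
            using T by (simp add: discount_def algebra_simps flip: exp_add)
          then show ?thesis using True by (simp flip: ennreal_mult add: ennreal_leI discount_nonneg)
        qed simp
      qed
      also have "\<dots> = ennreal (exp t) * ennreal (exp (- \<phi> (q + 1) * (x - (- real n))))"
        using nn_passage_laplace[of "- real n" x "q + 1"] n q by (simp add: nn_integral_cmult)
      finally have "a n \<le> ennreal (exp (\<phi> q * real n)) * (ennreal (exp t) * ennreal (exp (- \<phi> (q + 1) * (x - (- real n)))))"
        unfolding a_def by (rule mult_left_mono) simp
      also have "\<dots> = ennreal (u n)" unfolding u_def
        by (simp flip: ennreal_mult exp_add add: algebra_simps)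
      finally show "a n \<le> ennreal (u n)" .
    qed
  qed simp
  moreover have "b \<longlonglongrightarrow> (\<integral>\<^sup>+\<omega>. f \<omega> * indicator ?Z \<omega> \<partial>P x)"
    unfolding b_def
  proof (rule nn_integral_LIMSEQ)
    have dec_B: "?B n \<subseteq> ?B m" if "m \<le> n" for m n
    proof
      fix \<omega> assume \<omega>: "\<omega> \<in> ?B n"
      then have "tau (- real m) \<omega> \<le> tau (- real n) \<omega>"
        unfolding tau_def using that by (intro passage_time_antimono) auto
      then show "\<omega> \<in> ?B m" using \<omega> by auto
    qed
    show "incseq (\<lambda>n \<omega>. f \<omega> * indicator (?A n) \<omega>)"
    proof (intro incseq_SucI le_funI mult_left_mono)
      fix n \<omega>
      have "?A n \<subseteq> ?A (Suc n)" using dec_B[OF le_SucI[OF order_refl], of n] by blast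
      then show "indicator (?A n) \<omega> \<le> (indicator (?A (Suc n)) \<omega> :: ennreal)"
        by (intro indicator_leI) blast
    qed simp
    fix \<omega>
    show "(\<lambda>n. f \<omega> * indicator (?A n) \<omega>) \<longlonglongrightarrow> f \<omega> * indicator ?Z \<omega>"
    proof (cases "\<omega> \<in> ?Z")
      case True
      then have w: "cadlag_until (\<lambda>t. X t \<omega>) (\<zeta> \<omega>)" and alive: "ennreal t < \<zeta> \<omega>" using cadlag_path by auto
      obtain k :: nat where k: "\<And>r. 0 \<le> r \<Longrightarrow> r \<le> t \<Longrightarrow> ereal (- real k) \<le> X r \<omega>"
        using cadlag_until_bounded_below[OF w t alive] by blast
      \<comment> \<open>Passing -n by time t entails a value below -n + 1 (the coarsest test level),
        which contradicts the bound -k once n \<ge> k + 1.\<close>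
      have "\<omega> \<in> ?A n" if n: "k + 1 \<le> n" for n
      proof -
        have "\<not> tau (- real n) \<omega> \<le> ennreal t"
          unfolding tau_def passage_time_le_iff[OF w t]
        proof
          assume "\<forall>m. \<exists>r\<ge>0. r \<le> t \<and> X r \<omega> < ereal (- real n + 1 / real (Suc m))"
          then obtain r where r: "0 \<le> r" "r \<le> t" "X r \<omega> < ereal (- real n + 1 / real (Suc 0))" by blast
          have "ereal (- real k) < ereal (- real n + 1 / real (Suc 0))" using k[OF r(1,2)] r(3) by (rule le_less_trans)
          then show False using n by simp
        qed
        then show ?thesis using True by auto
      qed
      then have "f \<omega> * indicator (?A n) \<omega> = f \<omega> * indicator ?Z \<omega>" if "k + 1 \<le> n" for n
        using True that by (simp only: indicator_simps)
      then have "eventually (\<lambda>n. f \<omega> * indicator (?A n) \<omega> = f \<omega> * indicator ?Z \<omega>) sequentially"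
        unfolding eventually_sequentially by blast
      then show ?thesis by (rule tendsto_eventually)
    next
      case False
      then have "f \<omega> * indicator (?A n) \<omega> = 0" for n by auto
      then show ?thesis using False by simp
    qed
  qed measurable
  then have "(\<lambda>n. ennreal (exp (- q * t)) * b n) \<longlonglongrightarrow> ennreal (exp (- q * t)) * (\<integral>\<^sup>+\<omega>. f \<omega> * indicator ?Z \<omega> \<partial>P x)"
    by (intro ennreal_tendsto_cmult) auto
  ultimately have "(\<lambda>n. a n + ennreal (exp (- q * t)) * b n) \<longlonglongrightarrow> 0 + ennreal (exp (- q * t)) * (\<integral>\<^sup>+\<omega>. f \<omega> * indicator ?Z \<omega> \<partial>P x)"
    by (intro tendsto_add)
  moreover have "eventually (\<lambda>n. a n + ennreal (exp (- q * t)) * b n = ennreal (exp (- \<phi> q * x))) sequentially"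
  proof -
    have "eventually (\<lambda>n. - real n \<le> x) sequentially" using eventually_ge_at_top[of "nat \<lceil>- x\<rceil>"]
      by eventually_elim linarith
    then show ?thesis by eventually_elim (rule dec[symmetric])
  qed
  then have "(\<lambda>n. a n + ennreal (exp (- q * t)) * b n) \<longlonglongrightarrow> ennreal (exp (- \<phi> q * x))" by (rule tendsto_eventually)
  ultimately have eq: "ennreal (exp (- q * t)) * (\<integral>\<^sup>+\<omega>. f \<omega> * indicator ?Z \<omega> \<partial>P x) = ennreal (exp (- \<phi> q * x))"
    using LIMSEQ_unique by fastforce
  have "(\<integral>\<^sup>+\<omega>. f \<omega> * indicator ?Z \<omega> \<partial>P x) = ennreal (exp (q * t)) * (ennreal (exp (- q * t)) * (\<integral>\<^sup>+\<omega>. f \<omega> * indicator ?Z \<omega> \<partial>P x))"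
    by (simp flip: mult.assoc ennreal_mult exp_add)
  also have "\<dots> = ennreal (exp (q * t - \<phi> q * x))" unfolding eq by (simp flip: ennreal_mult exp_add)
  finally show ?thesis unfolding f_def .
qed

section \<open>Stationary independent increments\<close>

text \<open>A sub-probability whose total mass is the survival probability. The increment is taken
  from X 0 and not from x, so it is a functional of the path alone and can be inserted into the
  Markov property.\<close>

definition incr_law :: "real \<Rightarrow> real \<Rightarrow> real measure" where
  "incr_law x t = distr (density (P x) (indicator {\<omega>\<in>\<Omega>. ennreal t < \<zeta> \<omega>})) borel
     (\<lambda>\<omega>. real_of_ereal (X t \<omega>) - real_of_ereal (X 0 \<omega>))"

lemma sets_incr_law[simp, measurable_cong]: "sets (incr_law x t) = sets borel"
  by (simp add: incr_law_def)

lemma nn_integral_incr_law: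
  assumes t: "0 \<le> t" and [measurable]: "f \<in> borel_measurable borel"
  shows "(\<integral>\<^sup>+y. f y \<partial>incr_law x t)
    = (\<integral>\<^sup>+\<omega>. f (real_of_ereal (X t \<omega>) - real_of_ereal (X 0 \<omega>)) * indicator {\<omega>\<in>\<Omega>. ennreal t < \<zeta> \<omega>} \<omega> \<partial>P x)"
proof -
  have [measurable]: "X t \<in> borel_measurable (P x)" "X 0 \<in> borel_measurable (P x)" using t by (auto intro: X_measurable)
  have [measurable]: "{\<omega>\<in>\<Omega>. ennreal t < \<zeta> \<omega>} \<in> sets (P x)" by (rule alive_in_P[OF t])
  have "(\<integral>\<^sup>+y. f y \<partial>incr_law x t) = (\<integral>\<^sup>+\<omega>. f (real_of_ereal (X t \<omega>) - real_of_ereal (X 0 \<omega>)) \<partial>density (P x) (indicator {\<omega>\<in>\<Omega>. ennreal t < \<zeta> \<omega>}))"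
    unfolding incr_law_def by (rule nn_integral_distr) measurable
  also have "\<dots> = (\<integral>\<^sup>+\<omega>. indicator {\<omega>\<in>\<Omega>. ennreal t < \<zeta> \<omega>} \<omega> * f (real_of_ereal (X t \<omega>) - real_of_ereal (X 0 \<omega>)) \<partial>P x)"
    by (rule nn_integral_density) measurable
  finally show ?thesis by (simp add: mult.commute)
qed

lemma incr_set_measurable:
  assumes t: "0 \<le> s" "s \<le> t" and B: "B \<in> sets borel"
  shows "{\<omega>\<in>\<Omega>. ennreal t < \<zeta> \<omega> \<and> real_of_ereal (X t \<omega>) - real_of_ereal (X s \<omega>) \<in> B} \<in> sets (F t)"
proof -
  have [measurable]: "X t \<in> borel_measurable (F t)" "X s \<in> borel_measurable (F t)" using t by (auto intro: X_measurable_F)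
  have "{\<omega>\<in>space (F t). real_of_ereal (X t \<omega>) - real_of_ereal (X s \<omega>) \<in> B} \<in> sets (F t)" using B by measurable
  with alive_in_F[of t] t have "{\<omega>\<in>\<Omega>. ennreal t < \<zeta> \<omega>} \<inter> {\<omega>\<in>space (F t). real_of_ereal (X t \<omega>) - real_of_ereal (X s \<omega>) \<in> B} \<in> sets (F t)"
    by (intro sets.Int) auto
  moreover have "{\<omega>\<in>\<Omega>. ennreal t < \<zeta> \<omega>} \<inter> {\<omega>\<in>space (F t). real_of_ereal (X t \<omega>) - real_of_ereal (X s \<omega>) \<in> B}
    = {\<omega>\<in>\<Omega>. ennreal t < \<zeta> \<omega> \<and> real_of_ereal (X t \<omega>) - real_of_ereal (X s \<omega>) \<in> B}"
    using t by (auto simp: space_F)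
  ultimately show ?thesis by simp
qed

lemma emeasure_incr_law:
  assumes t: "0 \<le> t" and B: "B \<in> sets borel"
  shows "emeasure (incr_law x t) B
    = emeasure (P x) {\<omega>\<in>\<Omega>. ennreal t < \<zeta> \<omega> \<and> real_of_ereal (X t \<omega>) - real_of_ereal (X 0 \<omega>) \<in> B}"
proof -
  have S: "{\<omega>\<in>\<Omega>. ennreal t < \<zeta> \<omega> \<and> real_of_ereal (X t \<omega>) - real_of_ereal (X 0 \<omega>) \<in> B} \<in> sets (P x)"
    using F_in_P[OF t incr_set_measurable[OF order_refl t B]] .
  have "emeasure (incr_law x t) B = (\<integral>\<^sup>+y. indicator B y \<partial>incr_law x t)" using B by simp
  also have "\<dots> = (\<integral>\<^sup>+\<omega>. indicator B (real_of_ereal (X t \<omega>) - real_of_ereal (X 0 \<omega>)) * indicator {\<omega>\<in>\<Omega>. ennreal t < \<zeta> \<omega>} \<omega> \<partial>P x)"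
    using B t by (intro nn_integral_incr_law) auto
  also have "\<dots> = (\<integral>\<^sup>+\<omega>. indicator {\<omega>\<in>\<Omega>. ennreal t < \<zeta> \<omega> \<and> real_of_ereal (X t \<omega>) - real_of_ereal (X 0 \<omega>) \<in> B} \<omega> \<partial>P x)"
    by (intro nn_integral_cong) (auto split: split_indicator)
  finally show ?thesis using S by simp
qed

lemma finite_incr_law: "0 \<le> t \<Longrightarrow> finite_measure (incr_law x t)"
  by (rule finite_measureI) (simp add: emeasure_incr_law[of t UNIV x] sets_eq_imp_space_eq[OF sets_incr_law])

lemma incr_laplace:
  assumes q: "Q < q" and t: "0 \<le> t"
  shows "(\<integral>\<^sup>+y. ennreal (exp (- \<phi> q * y)) \<partial>incr_law x t) = ennreal (exp (q * t))"
proof -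
  let ?Z = "{\<omega>\<in>\<Omega>. ennreal t < \<zeta> \<omega>}"
  have [measurable]: "X t \<in> borel_measurable (P x)" by (rule X_measurable[OF t])
  have [measurable]: "?Z \<in> sets (P x)" by (rule alive_in_P[OF t])
  have "(\<integral>\<^sup>+y. ennreal (exp (- \<phi> q * y)) \<partial>incr_law x t)
    = (\<integral>\<^sup>+\<omega>. ennreal (exp (- \<phi> q * (real_of_ereal (X t \<omega>) - real_of_ereal (X 0 \<omega>)))) * indicator ?Z \<omega> \<partial>P x)"
    by (rule nn_integral_incr_law[OF t]) measurable
  also have "\<dots> = (\<integral>\<^sup>+\<omega>. ennreal (exp (\<phi> q * x)) * (ennreal (exp (- \<phi> q * real_of_ereal (X t \<omega>))) * indicator ?Z \<omega>) \<partial>P x)"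
  proof (rule nn_integral_cong_AE)
    show "AE \<omega> in P x. ennreal (exp (- \<phi> q * (real_of_ereal (X t \<omega>) - real_of_ereal (X 0 \<omega>)))) * indicator ?Z \<omega>
      = ennreal (exp (\<phi> q * x)) * (ennreal (exp (- \<phi> q * real_of_ereal (X t \<omega>))) * indicator ?Z \<omega>)"
      using AE_X_0[of x]
      by eventually_elim (auto simp: algebra_simps simp flip: exp_add ennreal_mult split: split_indicator)
  qed
  also have "\<dots> = ennreal (exp (\<phi> q * x)) * ennreal (exp (q * t - \<phi> q * x))"
    unfolding laplace_X[OF q t, symmetric] by (rule nn_integral_cmult) measurable
  also have "\<dots> = ennreal (exp (q * t))" by (simp flip: ennreal_mult exp_add)
  finally show ?thesis .
qed

text \<open>Agreement is available on the range of phi only. Monotonicity and continuity of phi give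
  an accumulation point phi (Q + 2), approached from above within phi (Q + 3) and hence inside the
  strip from phi (Q + 1) to phi (Q + 4).\<close>

lemma phi_laplace_unique:
  fixes M N :: "real measure"
  assumes S[measurable_cong]: "sets M = sets borel" "sets N = sets borel"
    and M: "\<And>q. Q < q \<Longrightarrow> (\<integral>\<^sup>+y. ennreal (exp (- \<phi> q * y)) \<partial>M) = ennreal (exp (c q))"
    and N: "\<And>q. Q < q \<Longrightarrow> (\<integral>\<^sup>+y. ennreal (exp (- \<phi> q * y)) \<partial>N) = ennreal (exp (c q))"
  shows "M = N"
proof -
  have hb: "has_bochner_integral K (\<lambda>y. exp (- \<phi> q * y)) (exp (c q))"
    if [measurable_cong]: "sets K = sets borel" and "(\<integral>\<^sup>+y. ennreal (exp (- \<phi> q * y)) \<partial>K) = ennreal (exp (c q))" for K q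
    using that(2) by (intro has_bochner_integral_nn_integral) auto
  have M': "has_bochner_integral M (\<lambda>y. exp (- \<phi> q * y)) (exp (c q))"
    and N': "has_bochner_integral N (\<lambda>y. exp (- \<phi> q * y)) (exp (c q))" if "Q < q" for q
    using hb[OF S(1) M[OF that]] hb[OF S(2) N[OF that]] by auto
  let ?c = "\<lambda>n. Q + 2 + 1 / real (Suc n)"
  have lt: "\<phi> (Q + 1) < \<phi> (Q + 2)" "\<phi> (Q + 2) < \<phi> (Q + 4)" "\<phi> (Q + 1) < \<phi> (?c n)" "\<phi> (?c n) < \<phi> (Q + 4)" "\<phi> (Q + 2) < \<phi> (?c n)" for n
    by (rule phi_strict_mono; simp add: add_strict_increasing divide_less_eq)+
  have "?c \<longlonglongrightarrow> Q + 2" by real_asymp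
  then have lim: "(\<lambda>n. \<phi> (?c n)) \<longlonglongrightarrow> \<phi> (Q + 2)" by (intro phi_tendsto) (auto simp: add_strict_increasing)
  show ?thesis
  proof (rule laplace_transform_unique[OF S _ _ _ _ lt(1) lt(2) lim])
    show "\<phi> (?c n) \<noteq> \<phi> (Q + 2)" for n using lt(5)[of n] by simp
    show "(\<integral>y. exp (- \<phi> (?c n) * y) \<partial>M) = (\<integral>y. exp (- \<phi> (?c n) * y) \<partial>N)" for n
      using M'[of "?c n"] N'[of "?c n"] by (simp add: has_bochner_integral_iff add_strict_increasing)
    show "0 < (\<integral>y. exp (- \<phi> (Q + 2) * y) \<partial>M)"
      using M'[of "Q + 2"] by (simp add: has_bochner_integral_iff)
  qed (use M'[of "Q + 1"] M'[of "Q + 4"] N'[of "Q + 1"] N'[of "Q + 4"] lt(3,4) in \<open>auto simp: has_bochner_integral_iff\<close>)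
qed

text \<open>Spatial homogeneity: the transform of the increment does not involve the starting
  point.\<close>

lemma incr_law_eq: "0 \<le> t \<Longrightarrow> incr_law x t = incr_law 0 t"
  by (rule phi_laplace_unique[where c="\<lambda>q. q * t"]) (simp_all only: sets_incr_law incr_laplace)

lemma alive_iff:
  assumes "\<omega> \<in> \<Omega>" "0 \<le> t"
  shows "X t \<omega> < \<infinity> \<longleftrightarrow> ennreal t < \<zeta> \<omega>"
  using cadlag_until_alive[OF cadlag_path[OF assms(1)] assms(2)]
    cadlag_until_finite[OF cadlag_path[OF assms(1)] assms(2)] by (cases "X t \<omega>") auto

text \<open>Given the past, the increment has the law belonging to the current position; by
  homogeneity this law is constant and leaves the integral over \<open>A\<close>.\<close>

lemma emeasure_increment:
  assumes s: "0 \<le> s" and t: "0 \<le> t" and A: "A \<in> sets (F s)" and B: "B \<in> sets borel"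
  shows "emeasure (P x) (A \<inter> {\<omega>. ennreal (s + t) < \<zeta> \<omega> \<and> real_of_ereal (X (s + t) \<omega>) - real_of_ereal (X s \<omega>) \<in> B})
    = emeasure (incr_law 0 t) B * emeasure (P x) (A \<inter> {\<omega>. ennreal s < \<zeta> \<omega>})"
proof -
  \<comment> \<open>Survival up to time t is expressed as w t < \<infinity>, since \<open>?H\<close>
    has to be a function of the path.\<close>
  let ?H = "\<lambda>w::real \<Rightarrow> ereal. indicator {w. w t < \<infinity> \<and> real_of_ereal (w t) - real_of_ereal (w 0) \<in> B} w :: ennreal"
  let ?E = "{\<omega>\<in>\<Omega>. ennreal (s + t) < \<zeta> \<omega> \<and> real_of_ereal (X (s + t) \<omega>) - real_of_ereal (X s \<omega>) \<in> B}"
  have AO: "A \<subseteq> \<Omega>" by (rule sets_F_subset[OF s A])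
  have E: "?E \<in> sets (P x)" by (rule F_in_P[OF _ incr_set_measurable[OF s _ B]]) (use s t in auto)
  have AP: "A \<in> sets (P x)" by (rule F_in_P[OF s A])
  have AE: "A \<inter> ?E = A \<inter> {\<omega>. ennreal (s + t) < \<zeta> \<omega> \<and> real_of_ereal (X (s + t) \<omega>) - real_of_ereal (X s \<omega>) \<in> B}"
    using AO by auto
  have AZ: "A \<inter> {\<omega>. ennreal s < \<zeta> \<omega>} \<in> sets (P x)"
  proof -
    have "A \<inter> {\<omega>. ennreal s < \<zeta> \<omega>} = A \<inter> {\<omega>\<in>\<Omega>. ennreal s < \<zeta> \<omega>}" using AO by auto
    then show ?thesis using AP alive_in_P[OF s] by auto
  qed
  have "emeasure (P x) (A \<inter> ?E) = (\<integral>\<^sup>+\<omega>. indicator (A \<inter> ?E) \<omega> \<partial>P x)" using AP E by simp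
  also have "\<dots> = (\<integral>\<^sup>+\<omega>. ?H (restrict (\<lambda>r. X (s + r) \<omega>) {0..}) * indicator (A \<inter> {\<omega>. ennreal s < \<zeta> \<omega>}) \<omega> \<partial>P x)"
  proof (rule nn_integral_cong)
    fix \<omega> assume "\<omega> \<in> space (P x)"
    then have \<omega>: "\<omega> \<in> \<Omega>" by (simp add: space_P)
    have "ennreal s < \<zeta> \<omega>" if "ennreal (s + t) < \<zeta> \<omega>"
      using that s t by (meson ennreal_leI le_add_same_cancel1 le_less_trans)
    then show "indicator (A \<inter> ?E) \<omega> = ?H (restrict (\<lambda>r. X (s + r) \<omega>) {0..}) * indicator (A \<inter> {\<omega>. ennreal s < \<zeta> \<omega>}) \<omega>"
      using \<omega> alive_iff[OF \<omega>, of "s + t"] s t by (auto split: split_indicator)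
  qed
  also have "\<dots> = (\<integral>\<^sup>+\<omega>. emeasure (incr_law 0 t) B * indicator (A \<inter> {\<omega>. ennreal s < \<zeta> \<omega>}) \<omega> \<partial>P x)"
  proof (rule markov_property[OF s A])
    have [measurable]: "(\<lambda>w. w t) \<in> borel_measurable path_space" "(\<lambda>w. w 0) \<in> borel_measurable path_space"
      using t unfolding path_space_def by (auto intro!: measurable_component_singleton)
    have "(\<lambda>w. if w t < \<infinity> \<and> real_of_ereal (w t) - real_of_ereal (w 0) \<in> B then 1 else 0 :: ennreal) \<in> borel_measurable path_space"
      using B by measurable
    then show "?H \<in> borel_measurable path_space" by (simp add: indicator_def[abs_def] of_bool_def)
    fix \<omega>
    define y where "y = real_of_ereal (X s \<omega>)"
    have "(\<integral>\<^sup>+\<omega>'. ?H (path_of X \<omega>') \<partial>P y)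
      = (\<integral>\<^sup>+\<omega>'. indicator {\<omega>\<in>\<Omega>. ennreal t < \<zeta> \<omega> \<and> real_of_ereal (X t \<omega>) - real_of_ereal (X 0 \<omega>) \<in> B} \<omega>' \<partial>P y)"
      using t alive_iff[of _ t] by (intro nn_integral_cong) (auto simp: path_of_def space_P split: split_indicator)
    also have "\<dots> = emeasure (incr_law y t) B"
      unfolding emeasure_incr_law[OF t B]
      using F_in_P[OF t incr_set_measurable[OF order_refl t B]] by (rule nn_integral_indicator)
    also have "\<dots> = emeasure (incr_law 0 t) B" by (subst incr_law_eq[OF t]) (rule refl)
    finally show "(\<integral>\<^sup>+\<omega>'. ?H (path_of X \<omega>') \<partial>P (real_of_ereal (X s \<omega>))) = emeasure (incr_law 0 t) B"
      unfolding y_def .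
  qed
  also have "\<dots> = emeasure (incr_law 0 t) B * emeasure (P x) (A \<inter> {\<omega>. ennreal s < \<zeta> \<omega>})"
    using AZ by (simp add: nn_integral_cmult)
  finally show ?thesis unfolding AE .
qed

lemma measure_increment:
  assumes "0 \<le> s" "0 \<le> t" "A \<in> sets (F s)" "B \<in> sets borel"
  shows "measure (P x) (A \<inter> {\<omega>. ennreal (s + t) < \<zeta> \<omega> \<and> real_of_ereal (X (s + t) \<omega>) - real_of_ereal (X s \<omega>) \<in> B})
    = measure (P x) (A \<inter> {\<omega>. ennreal s < \<zeta> \<omega>}) * measure (incr_law 0 t) B"
  unfolding measure_def emeasure_increment[OF assms] by (simp add: enn2real_mult mult.commute)

section \<open>The killing rate and the convolution semigroup\<close>

definition survival :: "real \<Rightarrow> real" where "survival t = measure (incr_law 0 t) UNIV"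

lemma survival_eq: "0 \<le> t \<Longrightarrow> survival t = measure (P x) {\<omega>\<in>\<Omega>. ennreal t < \<zeta> \<omega>}"
  unfolding survival_def incr_law_eq[of t x, symmetric] by (simp add: measure_def emeasure_incr_law)

lemma survival_le_1: "0 \<le> t \<Longrightarrow> survival t \<le> 1" by (simp add: survival_eq[of t 0])

lemma survival_pos: 
  assumes t: "0 \<le> t"
  shows "0 < survival t"
proof (rule ccontr)
  assume "\<not> 0 < survival t"
  then have "measure (incr_law 0 t) UNIV = 0" unfolding survival_def using measure_nonneg[of "incr_law 0 t" UNIV] by linarith
  with finite_measure.emeasure_eq_measure[OF finite_incr_law[OF t], of 0]
  have "emeasure (incr_law 0 t) (space (incr_law 0 t)) = 0"
    by (simp add: sets_eq_imp_space_eq[OF sets_incr_law])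
  then have "AE y in incr_law 0 t. False" by (intro AE_I[of _ _ "space (incr_law 0 t)"]) (auto simp del: sets_incr_law)
  then have "(\<integral>\<^sup>+y. ennreal (exp (- \<phi> (Q + 1) * y)) \<partial>incr_law 0 t) = (\<integral>\<^sup>+y. 0 \<partial>incr_law 0 t)"
    by (intro nn_integral_cong_AE) (auto elim: eventually_mono)
  then show False using incr_laplace[of "Q + 1" t 0] t by simp
qed

lemma survival_mult:
  assumes "0 \<le> s" "0 \<le> t"
  shows "survival (s + t) = survival s * survival t"
proof -
  have "{\<omega>\<in>\<Omega>. ennreal (s + t) < \<zeta> \<omega>} = \<Omega> \<inter> {\<omega>. ennreal (s + t) < \<zeta> \<omega> \<and> real_of_ereal (X (s + t) \<omega>) - real_of_ereal (X s \<omega>) \<in> UNIV}" by auto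
  moreover have "\<Omega> \<inter> {\<omega>. ennreal s < \<zeta> \<omega>} = {\<omega>\<in>\<Omega>. ennreal s < \<zeta> \<omega>}" by auto
  moreover have "\<Omega> \<in> sets (F s)" using sets.top[of "F s"] assms by (simp add: space_F)
  ultimately show ?thesis
    using measure_increment[OF assms, of \<Omega> UNIV 0] survival_eq[of "s + t" 0] survival_eq[of s 0] assms
    by (simp add: survival_def)
qed

definition kill_rate :: real where "kill_rate = - ln (survival 1)"

lemma kill_rate_nonneg: "0 \<le> kill_rate"
  using survival_le_1[of 1] survival_pos[of 1] by (simp add: kill_rate_def)

lemma survival_exp: "0 \<le> t \<Longrightarrow> survival t = exp (- kill_rate * t)"
  using multiplicative_bounded_imp_exp[of survival 1 t] survival_pos survival_mult survival_le_1
  by (simp add: kill_rate_def mult.commute)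

text \<open>Division by the survival probability exp (- kill_rate * t) gives the increment law
  conditioned on survival, that is, the law of the process without killing.\<close>

definition levy_law :: "real \<Rightarrow> real measure" where
  "levy_law t = scale_measure (ennreal (exp (kill_rate * t))) (incr_law 0 t)"

lemma sets_levy_law[simp, measurable_cong]: "sets (levy_law t) = sets borel"
  by (simp add: levy_law_def)

lemma space_levy_law[simp]: "space (levy_law t) = UNIV"
  using sets_eq_imp_space_eq[OF sets_levy_law] by simp

lemma measure_levy_law: "measure (levy_law t) B = exp (kill_rate * t) * measure (incr_law 0 t) B"
  unfolding levy_law_def measure_def by (simp add: enn2real_mult)

lemma measure_incr_law: "measure (incr_law 0 t) B = exp (- kill_rate * t) * measure (levy_law t) B"
  unfolding measure_levy_law by (simp add: mult.assoc[symmetric] exp_add[symmetric])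

lemma prob_levy_law:
  assumes "0 \<le> t"
  shows "prob_space (levy_law t)"
proof
  interpret finite_measure "incr_law 0 t" by (rule finite_incr_law[OF assms])
  have "emeasure (levy_law t) (space (levy_law t)) = ennreal (exp (kill_rate * t)) * ennreal (survival t)"
    unfolding space_levy_law by (simp add: levy_law_def survival_def emeasure_eq_measure)
  also have "\<dots> = 1" using assms by (simp add: survival_exp flip: ennreal_mult exp_add)
  finally show "emeasure (levy_law t) (space (levy_law t)) = 1" .
qed

lemma levy_laplace_phi:
  assumes "Q < q" "0 \<le> t"
  shows "(\<integral>\<^sup>+y. ennreal (exp (- \<phi> q * y)) \<partial>levy_law t) = ennreal (exp (t * (q + kill_rate)))"
proof -
  have "(\<integral>\<^sup>+y. ennreal (exp (- \<phi> q * y)) \<partial>levy_law t) = ennreal (exp (kill_rate * t)) * ennreal (exp (q * t))"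
    unfolding levy_law_def using incr_laplace[OF assms] by (subst nn_integral_scale_measure) auto
  then show ?thesis by (simp add: algebra_simps flip: ennreal_mult exp_add)
qed

lemma levy_law_convolution:
  assumes s: "0 \<le> s" and t: "0 \<le> t"
  shows "levy_law (s + t) = (levy_law s \<star> levy_law t)"
proof (rule phi_laplace_unique[where c="\<lambda>q. (s + t) * (q + kill_rate)"])
  interpret s: prob_space "levy_law s" by (rule prob_levy_law[OF s])
  interpret t: prob_space "levy_law t" by (rule prob_levy_law[OF t])
  fix q assume q: "Q < q"
  show "(\<integral>\<^sup>+y. ennreal (exp (- \<phi> q * y)) \<partial>levy_law (s + t)) = ennreal (exp ((s + t) * (q + kill_rate)))"
    using levy_laplace_phi[OF q, of "s + t"] s t by simp
  show "(\<integral>\<^sup>+y. ennreal (exp (- \<phi> q * y)) \<partial>(levy_law s \<star> levy_law t)) = ennreal (exp ((s + t) * (q + kill_rate)))"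
    using nn_laplace_convolution[OF s.finite_measure_axioms t.finite_measure_axioms, of "\<phi> q"]
      levy_laplace_phi[OF q s] levy_laplace_phi[OF q t]
    by (simp add: distrib_right exp_add ennreal_mult)
qed auto

section \<open>The Laplace exponent\<close>

definition laplace :: "real \<Rightarrow> real \<Rightarrow> ennreal" where
  "laplace z t = (\<integral>\<^sup>+y. ennreal (exp (- z * y)) \<partial>levy_law t)"

lemma laplace_mult: "0 \<le> s \<Longrightarrow> 0 \<le> t \<Longrightarrow> laplace z (s + t) = laplace z s * laplace z t"
  unfolding laplace_def levy_law_convolution
  using prob_space.finite_measure[OF prob_levy_law] by (intro nn_laplace_convolution) auto

text \<open>For y \<ge> 0 the kernel is at most 1, for y < 0 it grows with z. The bound is locally
  uniform in t, as required to solve the multiplicative equation.\<close>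

lemma laplace_bound:
  assumes z: "0 \<le> z" "z \<le> \<phi> q" and q: "Q < q" and t: "0 \<le> t"
  shows "laplace z t \<le> ennreal (1 + exp (t * (q + kill_rate)))"
proof -
  interpret prob_space "levy_law t" by (rule prob_levy_law[OF t])
  have "laplace z t \<le> (\<integral>\<^sup>+y. 1 + ennreal (exp (- \<phi> q * y)) \<partial>levy_law t)"
    unfolding laplace_def
  proof (rule nn_integral_mono)
    fix y :: real
    have "exp (- z * y) \<le> 1 + exp (- \<phi> q * y)"
    proof (cases "0 \<le> y")
      case True
      then have "exp (- z * y) \<le> 1" using z by simp
      then show ?thesis by (simp add: add_increasing2)
    next
      case False
      then have "- z * y \<le> - \<phi> q * y" using z by (simp add: mult_right_mono_neg)
      then have "exp (- z * y) \<le> exp (- \<phi> q * y)" by simp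
      then show ?thesis by linarith
    qed
    then have "ennreal (exp (- z * y)) \<le> ennreal (1 + exp (- \<phi> q * y))" by (rule ennreal_leI)
    then show "ennreal (exp (- z * y)) \<le> 1 + ennreal (exp (- \<phi> q * y))" by simp
  qed
  also have "\<dots> = 1 + ennreal (exp (t * (q + kill_rate)))"
    unfolding levy_laplace_phi[OF q t, symmetric] using emeasure_space_1 by (subst nn_integral_add) auto
  finally show ?thesis by simp
qed

definition psi :: "real \<Rightarrow> real" where "psi z = ln (enn2real (laplace z 1))"

lemma laplace_eq:
  assumes z: "0 \<le> z" and t: "0 \<le> t"
  shows "laplace z t = ennreal (exp (t * psi z))"
proof -
  \<comment> \<open>A value of phi to the right of z makes the transform at z finite.\<close>
  obtain q where q: "Q < q" "z \<le> \<phi> q" by (rule phi_unbounded)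
  have fin: "laplace z t < \<infinity>" if "0 \<le> t" for t
    using laplace_bound[OF z q(2,1) that] by (rule le_less_trans) simp
  have nz: "laplace z t \<noteq> 0" if t: "0 \<le> t" for t
  proof
    interpret prob_space "levy_law t" by (rule prob_levy_law[OF t])
    assume "laplace z t = 0"
    then have "AE y in levy_law t. ennreal (exp (- z * y)) = 0"
      unfolding laplace_def by (subst (asm) nn_integral_0_iff_AE) auto
    then have "AE y in levy_law t. False" by eventually_elim simp
    then show False by simp
  qed
  have eq: "ennreal (enn2real (laplace z t)) = laplace z t" if "0 \<le> t" for t using fin[OF that] by simp
  have "enn2real (laplace z t) = exp (t * ln (enn2real (laplace z 1)))"
  proof (rule multiplicative_bounded_imp_exp[OF _ _ _ t])
    show "0 < enn2real (laplace z t)" if "0 \<le> t" for t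
      using nz[OF that] fin[OF that] by (simp add: enn2real_positive_iff zero_less_iff_neq_zero)
    show "enn2real (laplace z (s + t)) = enn2real (laplace z s) * enn2real (laplace z t)" if "0 \<le> s" "0 \<le> t" for s t
      using laplace_mult[OF that] by (simp add: enn2real_mult)
    fix t :: real assume t: "0 \<le> t" "t \<le> 1"
    have "laplace z t \<le> ennreal (1 + exp (q + kill_rate))"
    proof (rule order_trans[OF laplace_bound[OF z q(2,1) t(1)]])
      have "t * (q + kill_rate) \<le> q + kill_rate"
        using t q Q_nonneg kill_rate_nonneg by (intro mult_left_le_one_le) auto
      then show "ennreal (1 + exp (t * (q + kill_rate))) \<le> ennreal (1 + exp (q + kill_rate))"
        by (intro ennreal_leI) simp
    qed
    then show "enn2real (laplace z t) \<le> 1 + exp (q + kill_rate)"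
      by (intro enn2real_leI) (auto intro: add_nonneg_nonneg)
  qed
  then show ?thesis using eq[OF t] unfolding psi_def by simp
qed

lemma psi_phi: "Q < q \<Longrightarrow> psi (\<phi> q) = kill_rate + q"
  using levy_laplace_phi[of q 1] by (simp add: psi_def laplace_def add.commute)

text \<open>The probability that all increments over a grid of mesh 1/(n+1) exceed -e factorises, and
  tends to the survival probability because paths have no negative jumps.\<close>

lemma negative_increments_negligible:
  assumes e: "0 < e"
  shows "(\<lambda>n. real (Suc n) * measure (levy_law (1 / real (Suc n))) {..- e}) \<longlonglongrightarrow> 0"
proof -
  define a where "a n = measure (levy_law (1 / real (Suc n))) {..- e}" for n
  \<comment> \<open>The event that the path is alive at the j-th grid time and each of the first j
    increments exceeds -e. Each further grid step adds one independent increment, so its probability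
    is a power.\<close>
  define E where "E n j = {\<omega>\<in>\<Omega>. ennreal (real j / real (Suc n)) < \<zeta> \<omega> \<and>
    (\<forall>k<j. - e < real_of_ereal (X (real (Suc k) / real (Suc n)) \<omega>) - real_of_ereal (X (real k / real (Suc n)) \<omega>))}" for n j
  have a01: "0 \<le> a n" "a n \<le> 1" for n
    unfolding a_def using prob_space.prob_le_1[OF prob_levy_law] by auto
  have mono: "ennreal (real j / real (Suc n)) < \<zeta> \<omega>" if "ennreal (real (Suc j) / real (Suc n)) < \<zeta> \<omega>" for j n \<omega>
    by (rule le_less_trans[OF ennreal_leI that]) (simp add: divide_right_mono)
  have E_Suc: "E n (Suc j) = E n j \<inter> {\<omega>. ennreal (real j / real (Suc n) + 1 / real (Suc n)) < \<zeta> \<omega> \<and>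
      real_of_ereal (X (real j / real (Suc n) + 1 / real (Suc n)) \<omega>) - real_of_ereal (X (real j / real (Suc n)) \<omega>) \<in> {- e<..}}" for n j
  proof -
    have s: "real j / real (Suc n) + 1 / real (Suc n) = real (Suc j) / real (Suc n)" by (simp add: add_divide_distrib)
    show ?thesis unfolding s E_def using mono by (auto simp: less_Suc_eq simp del: of_nat_Suc)
  qed
  have E_F: "E n j \<in> sets (F (real j / real (Suc n)))" for n j
  proof (induction j)
    case 0
    then show ?case using alive_in_F[of 0] by (simp add: E_def)
  next
    case (Suc j)
    let ?s = "real j / real (Suc n)" and ?d = "1 / real (Suc n)"
    have s: "real (Suc j) / real (Suc n) = ?s + ?d" by (simp add: add_divide_distrib)
    have "E n j \<in> sets (F (?s + ?d))" by (rule F_mono[OF _ _ Suc]) auto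
    moreover have "{\<omega>\<in>\<Omega>. ennreal (?s + ?d) < \<zeta> \<omega> \<and> real_of_ereal (X (?s + ?d) \<omega>) - real_of_ereal (X ?s \<omega>) \<in> {- e<..}} \<in> sets (F (?s + ?d))"
      by (rule incr_set_measurable) auto
    ultimately have "E n j \<inter> {\<omega>\<in>\<Omega>. ennreal (?s + ?d) < \<zeta> \<omega> \<and> real_of_ereal (X (?s + ?d) \<omega>) - real_of_ereal (X ?s \<omega>) \<in> {- e<..}} \<in> sets (F (?s + ?d))"
      by (rule sets.Int)
    moreover have "E n j \<inter> {\<omega>\<in>\<Omega>. ennreal (?s + ?d) < \<zeta> \<omega> \<and> real_of_ereal (X (?s + ?d) \<omega>) - real_of_ereal (X ?s \<omega>) \<in> {- e<..}} = E n (Suc j)"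
      unfolding E_Suc using E_def[of n j] by blast
    ultimately show ?case unfolding s by simp
  qed
  have incr: "measure (incr_law 0 (1 / real (Suc n))) {- e<..} = exp (- kill_rate / real (Suc n)) * (1 - a n)" for n
  proof -
    interpret prob_space "levy_law (1 / real (Suc n))" by (rule prob_levy_law) simp
    have "UNIV - {..- e} = {- e<..}" by auto
    then have "measure (levy_law (1 / real (Suc n))) {- e<..} = 1 - a n"
      unfolding a_def using prob_compl[of "{..- e}"] by simp
    then show ?thesis unfolding measure_incr_law by simp
  qed
  have E_meas: "measure (P 0) (E n j) = (exp (- kill_rate / real (Suc n)) * (1 - a n)) ^ j" for n j
  proof (induction j)
    case 0
    have "measure (P 0) (E n 0) = survival 0" using survival_eq[of 0 0] by (simp add: E_def)
    then show ?case by (simp add: survival_exp)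
  next
    case (Suc j)
    have "E n j \<inter> {\<omega>. ennreal (real j / real (Suc n)) < \<zeta> \<omega>} = E n j" unfolding E_def by blast
    then have "measure (P 0) (E n (Suc j)) = measure (P 0) (E n j) * measure (incr_law 0 (1 / real (Suc n))) {- e<..}"
      unfolding E_Suc using measure_increment[OF _ _ E_F, of j n "1 / real (Suc n)" "{- e<..}" 0] by simp
    then show ?case using Suc incr by (simp add: mult.commute)
  qed
  have [measurable]: "E n (Suc n) \<in> sets (P 0)" for n by (rule F_in_P[OF _ E_F]) simp
  have Z[measurable]: "{\<omega>\<in>\<Omega>. ennreal 1 < \<zeta> \<omega>} \<in> sets (P 0)" by (rule alive_in_P) simp
  \<comment> \<open>A path alive at time 1 has all its grid increments above -e once the mesh is
    fine enough, while a path dead at time 1 is in none of the events.\<close>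
  have lim: "(\<lambda>n. \<integral>\<omega>. indicator (E n (Suc n)) \<omega> \<partial>P 0) \<longlonglongrightarrow> (\<integral>\<omega>. indicator {\<omega>\<in>\<Omega>. ennreal 1 < \<zeta> \<omega>} \<omega> \<partial>P 0 :: real)"
  proof (rule integral_dominated_convergence[where w="\<lambda>_. 1"])
    have sp: "AE \<omega> in P 0. \<omega> \<in> \<Omega>" by (intro AE_I2) (simp add: space_P)
    have nn: "AE \<omega> in P 0. \<forall>t>0. ennreal t < \<zeta> \<omega> \<longrightarrow>
        Lim (at_left t) (\<lambda>s. real_of_ereal (X s \<omega>)) \<le> real_of_ereal (X t \<omega>)"
      using nnj unfolding no_negative_jumps_def by blast
    show "AE \<omega> in P 0. (\<lambda>n. indicator (E n (Suc n)) \<omega> :: real) \<longlonglongrightarrow> indicator {\<omega>\<in>\<Omega>. ennreal 1 < \<zeta> \<omega>} \<omega>"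
      using sp nn
    proof eventually_elim
      fix \<omega> assume \<omega>: "\<omega> \<in> \<Omega>" and nn: "\<forall>t>0. ennreal t < \<zeta> \<omega> \<longrightarrow>
        Lim (at_left t) (\<lambda>s. real_of_ereal (X s \<omega>)) \<le> real_of_ereal (X t \<omega>)"
      show "(\<lambda>n. indicator (E n (Suc n)) \<omega> :: real) \<longlonglongrightarrow> indicator {\<omega>\<in>\<Omega>. ennreal 1 < \<zeta> \<omega>} \<omega>"
      proof (cases "ennreal 1 < \<zeta> \<omega>")
        case True
        have up: "Lim (at_left t) (\<lambda>s. real_of_ereal (X s \<omega>)) \<le> real_of_ereal (X t \<omega>)" if "0 < t" "t \<le> 1" for t
          using nn that True by (meson ennreal_leI le_less_trans)
        obtain d where d: "0 < d" "\<And>s u. 0 \<le> s \<Longrightarrow> s \<le> u \<Longrightarrow> u \<le> 1 \<Longrightarrow> u - s < d \<Longrightarrow> - e < real_of_ereal (X u \<omega>) - real_of_ereal (X s \<omega>)"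
          using no_negative_jump_increments[OF cadlag_path[OF \<omega>] True e up] by blast
        obtain n0 where n0: "1 / real (Suc n0) < d" using nat_approx_posE[OF d(1)] by blast
        have "\<omega> \<in> E n (Suc n)" if n: "n0 \<le> n" for n
        proof -
          have dn: "1 / real (Suc n) < d" using n n0 by (smt (verit) frac_le of_nat_0_less_iff of_nat_mono Suc_le_mono zero_less_Suc)
          have "- e < real_of_ereal (X (real (Suc k) / real (Suc n)) \<omega>) - real_of_ereal (X (real k / real (Suc n)) \<omega>)" if "k < Suc n" for k
          proof (rule d(2))
            show "real k / real (Suc n) \<le> real (Suc k) / real (Suc n)" by (intro divide_right_mono) auto
            show "real (Suc k) / real (Suc n) \<le> 1" using that by (simp add: divide_le_eq)
            have "real (Suc k) / real (Suc n) - real k / real (Suc n) = 1 / real (Suc n)" by (simp flip: diff_divide_distrib)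
            then show "real (Suc k) / real (Suc n) - real k / real (Suc n) < d" using dn by simp
          qed simp
          moreover have "real (Suc n) / real (Suc n) = 1" by simp
          ultimately show ?thesis unfolding E_def using \<omega> True by (simp only: mem_Collect_eq) blast
        qed
        then have "eventually (\<lambda>n. (indicator (E n (Suc n)) \<omega> :: real) = indicator {\<omega>\<in>\<Omega>. ennreal 1 < \<zeta> \<omega>} \<omega>) sequentially"
          unfolding eventually_sequentially using \<omega> True by (intro exI[of _ n0]) simp
        then show ?thesis by (rule tendsto_eventually)
      next
        case False
        then have "\<omega> \<notin> E n (Suc n)" for n by (simp add: E_def)
        then show ?thesis using False by simp
      qed
    qed
    show "AE \<omega> in P 0. norm (indicator (E n (Suc n)) \<omega> :: real) \<le> 1" for n by (simp add: indicator_def)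
  qed (use Z in \<open>simp_all del: ennreal_1\<close>)
  have "E n (Suc n) \<inter> \<Omega> = E n (Suc n)" for n by (auto simp: E_def)
  moreover have "{\<omega>\<in>\<Omega>. 1 < \<zeta> \<omega>} \<inter> \<Omega> = {\<omega>\<in>\<Omega>. 1 < \<zeta> \<omega>}" by auto
  ultimately have "(\<lambda>n. measure (P 0) (E n (Suc n))) \<longlonglongrightarrow> survival 1"
    using lim survival_eq[of 1 0] by (simp add: space_P)
  then have "(\<lambda>n. (exp (- kill_rate / real (Suc n)) * (1 - a n)) ^ Suc n) \<longlonglongrightarrow> exp (- kill_rate)"
    unfolding E_meas survival_exp[OF zero_le_one] by simp
  moreover have "(exp (- kill_rate / real (Suc n)) * (1 - a n)) ^ Suc n = exp (- kill_rate) * (1 - a n) ^ Suc n" for n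
    unfolding power_mult_distrib exp_of_nat_mult[symmetric] by (simp del: power_Suc of_nat_Suc)
  ultimately have "(\<lambda>n. exp (- kill_rate) * (1 - a n) ^ Suc n) \<longlonglongrightarrow> exp (- kill_rate)" by (simp only:)
  from tendsto_mult[OF tendsto_const this, of "exp kill_rate"]
  have y: "(\<lambda>n. (1 - a n) ^ Suc n) \<longlonglongrightarrow> 1"
    by (simp add: mult.assoc[symmetric] exp_add[symmetric] del: power_Suc)
  show ?thesis
  proof (rule tendsto_sandwich[OF _ _ tendsto_const])
    show "(\<lambda>n. - ln ((1 - a n) ^ Suc n)) \<longlonglongrightarrow> 0" using tendsto_minus[OF tendsto_ln[OF y]] by simp
    show "eventually (\<lambda>n. 0 \<le> real (Suc n) * measure (levy_law (1 / real (Suc n))) {..- e}) sequentially" by simp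
    have "eventually (\<lambda>n. 0 < (1 - a n) ^ Suc n) sequentially" using order_tendstoD(1)[OF y, of 0] by simp
    then show "eventually (\<lambda>n. real (Suc n) * measure (levy_law (1 / real (Suc n))) {..- e} \<le> - ln ((1 - a n) ^ Suc n)) sequentially"
    proof eventually_elim
      fix n assume p: "0 < (1 - a n) ^ Suc n"
      \<comment> \<open>Turns the power into exp (- n a n), so that n times the probability is at
        most minus the logarithm of a sequence tending to 1.\<close>
      have "1 - a n \<le> exp (- a n)" using exp_ge_add_one_self[of "- a n"] by simp
      then have "(1 - a n) ^ Suc n \<le> exp (- a n) ^ Suc n" using a01[of n] by (intro power_mono) auto
      also have "\<dots> = exp (- (real (Suc n) * a n))" unfolding exp_of_nat_mult[symmetric] by simp
      finally have "ln ((1 - a n) ^ Suc n) \<le> - (real (Suc n) * a n)" using p by (simp add: ln_le_cancel_iff[of _ "exp _", simplified] del: power_Suc of_nat_Suc)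
      then show "real (Suc n) * measure (levy_law (1 / real (Suc n))) {..- e} \<le> - ln ((1 - a n) ^ Suc n)"
        unfolding a_def[symmetric] by linarith
    qed
  qed
qed

text \<open>Under u = exp (- y) the increments over time 1 / Suc n meet the moment assumptions, and
  increments below - ln a become the upper tail u \<ge> a.\<close>

lemma psi_laplace_exponent: "sp_laplace_exponent psi"
proof -
  let ?N = "\<lambda>n. distr (levy_law (1 / real (Suc n))) borel (\<lambda>y. exp (- y))"
  interpret infinitely_divisible_moments ?N psi
  proof (rule infinitely_divisible_moments.intro)
    fix n
    interpret prob_space "levy_law (1 / real (Suc n))" by (rule prob_levy_law) simp
    show "prob_space (?N n)" by (rule prob_space_distr) measurable
    show "sets (?N n) = sets borel" by simp
    show "AE u in ?N n. 0 < u" by (subst AE_distr_iff) auto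
    fix z :: real assume z: "0 \<le> z"
    show "has_bochner_integral (?N n) (\<lambda>u. u powr z) (exp (psi z / real (Suc n)))"
    proof (rule has_bochner_integral_nn_integral)
      have "(\<integral>\<^sup>+u. ennreal (u powr z) \<partial>?N n) = (\<integral>\<^sup>+y. ennreal (exp (- y) powr z) \<partial>levy_law (1 / real (Suc n)))"
        by (rule nn_integral_distr) measurable
      also have "\<dots> = laplace z (1 / real (Suc n))" unfolding laplace_def by (simp add: powr_def)
      also have "\<dots> = ennreal (exp (psi z / real (Suc n)))" using laplace_eq[OF z, of "1 / real (Suc n)"] by simp
      finally show "(\<integral>\<^sup>+u. ennreal (u powr z) \<partial>?N n) = ennreal (exp (psi z / real (Suc n)))" .
    qed auto
  next
    fix a :: real assume a: "1 < a"
    have "(\<lambda>y::real. exp (- y)) -` {a..} = {..- ln a}"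
    proof (intro set_eqI)
      fix y :: real
      have "a \<le> exp (- y) \<longleftrightarrow> ln a \<le> - y" using a ln_ge_iff[of a "- y"] by (metis exp_ln ln_exp exp_le_cancel_iff less_trans zero_less_one)
      then show "y \<in> (\<lambda>y::real. exp (- y)) -` {a..} \<longleftrightarrow> y \<in> {..- ln a}" by auto
    qed
    then have "measure (?N n) {a..} = measure (levy_law (1 / real (Suc n))) {..- ln a}" for n
      by (subst measure_distr) auto
    then show "(\<lambda>n. real (Suc n) * measure (?N n) {a..}) \<longlonglongrightarrow> 0"
      using negative_increments_negligible[of "ln a"] a by simp
  qed
  show ?thesis by (rule levy_khintchine)
qed

lemma killed_levy: "killed_sp_levy \<Omega> F P \<zeta> X psi kill_rate"
  unfolding killed_sp_levy_def
proof (intro conjI exI[of _ levy_law] allI impI kill_rate_nonneg psi_laplace_exponent sets_levy_law prob_levy_law)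
  show "(\<integral>\<^sup>+y. ennreal (exp (- z * y)) \<partial>levy_law t) = ennreal (exp (t * psi z))" if "0 \<le> t" "0 \<le> z" for t z
    using laplace_eq[OF that(2,1)] by (simp add: laplace_def)
  \<comment> \<open>Without negative values the transform at phi (Q + 1) > 0 would be at most 1, but
    it equals exp (Q + 1 + kill_rate) > 1.\<close>
  show "\<not> (\<forall>t\<ge>0. emeasure (levy_law t) {..<0} = 0)"
  proof
    assume "\<forall>t\<ge>0. emeasure (levy_law t) {..<0} = 0"
    then have "emeasure (levy_law 1) {..<0} = 0" by simp
    then have "AE y in levy_law 1. y \<notin> {..<0}" by (intro AE_not_in) (simp add: null_sets_def)
    then have "AE y in levy_law 1. ennreal (exp (- \<phi> (Q + 1) * y)) \<le> 1"
      by eventually_elim (use phi_pos[of "Q + 1"] in \<open>simp add: mult_nonneg_nonneg\<close>)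
    then have "(\<integral>\<^sup>+y. ennreal (exp (- \<phi> (Q + 1) * y)) \<partial>levy_law 1) \<le> (\<integral>\<^sup>+y. 1 \<partial>levy_law 1)"
      by (rule nn_integral_mono_AE)
    also have "\<dots> = 1" using prob_space.emeasure_space_1[OF prob_levy_law[of 1]] by simp
    finally have "exp (Q + 1 + kill_rate) \<le> 1" using levy_laplace_phi[of "Q + 1" 1] by simp
    then show False using Q_nonneg kill_rate_nonneg by simp
  qed
  fix x s t :: real and A B assume "0 \<le> s \<and> 0 \<le> t \<and> A \<in> sets (F s) \<and> B \<in> sets (borel :: real measure)"
  then show "measure (P x) (A \<inter> {\<omega>. ennreal (s + t) < \<zeta> \<omega> \<and> real_of_ereal (X (s + t) \<omega>) - real_of_ereal (X s \<omega>) \<in> B})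
    = measure (P x) (A \<inter> {\<omega>. ennreal s < \<zeta> \<omega>}) * exp (- kill_rate * t) * measure (levy_law t) B"
    using measure_increment[of s t A B x] by (simp add: measure_incr_law mult.assoc)
qed auto

text \<open>For z below phi q the convexity of the exponential bounds exp (psi z) by an average of 1
  and exp (q + kill_rate), so psi z cannot exceed kill_rate + q. From above, psi takes the value
  kill_rate + q + 1/n at phi (q + 1/n), and phi is continuous.\<close>

lemma rc_inverse_psi:
  assumes q: "Q < q"
  shows "rc_inverse psi (kill_rate + q) = \<phi> q"
proof -
  let ?S = "{z. 0 \<le> z \<and> kill_rate + q < psi z}"
  interpret prob_space "levy_law 1" by (rule prob_levy_law) simp
  have lower: "\<phi> q \<le> z" if "z \<in> ?S" for z
  proof (rule ccontr)
    assume "\<not> \<phi> q \<le> z"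
    then have z: "0 \<le> z" "z < \<phi> q" "kill_rate + q < psi z" using that by auto
    define c where "c = z / \<phi> q"
    have c: "0 \<le> c" "c \<le> 1" "z = c * \<phi> q" using z by (auto simp: c_def)
    have "exp (- z * y) \<le> (1 - c) + c * exp (- \<phi> q * y)" for y
      using convex_onD[OF exp_convex, of c 0 "- \<phi> q * y"] c(1,2) unfolding c(3) by (simp add: mult.assoc)
    then have "laplace z 1 \<le> (\<integral>\<^sup>+y. ennreal (1 - c) + ennreal c * ennreal (exp (- \<phi> q * y)) \<partial>levy_law 1)"
      unfolding laplace_def using c by (intro nn_integral_mono) (simp flip: ennreal_mult ennreal_plus add: ennreal_leI)
    also have "\<dots> = ennreal (1 - c) + ennreal c * ennreal (exp (q + kill_rate))"
      using levy_laplace_phi[OF q, of 1] emeasure_space_1 by (subst nn_integral_add) (auto simp: nn_integral_cmult)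
    also have "\<dots> = ennreal ((1 - c) + c * exp (q + kill_rate))"
      using c by (simp flip: ennreal_mult ennreal_plus)
    finally have "ennreal (exp (1 * psi z)) \<le> ennreal ((1 - c) + c * exp (q + kill_rate))"
      using laplace_eq[OF z(1), of 1] by (simp only: zero_le_one)
    then have "exp (psi z) \<le> (1 - c) * 1 + c * exp (q + kill_rate)"
      by (subst (asm) ennreal_le_iff) (use c in \<open>auto intro!: add_nonneg_nonneg\<close>)
    also have "\<dots> \<le> (1 - c) * exp (q + kill_rate) + c * exp (q + kill_rate)"
      using c q Q_nonneg kill_rate_nonneg by (intro add_right_mono mult_left_mono) auto
    also have "\<dots> = exp (q + kill_rate)" by (simp add: algebra_simps)
    finally show False using z by simp
  qed
  have q': "Q < q + 1 / real (Suc n)" for n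
  proof -
    have "0 < 1 / real (Suc n)" by simp
    then show ?thesis using q by linarith
  qed
  have mem: "\<phi> (q + 1 / real (Suc n)) \<in> ?S" for n
    using phi_pos[OF q'[of n]] psi_phi[OF q'[of n]] by simp
  show ?thesis unfolding rc_inverse_def
  proof (rule antisym)
    show "\<phi> q \<le> Inf ?S" using mem lower by (intro cInf_greatest) blast+
    have "Inf ?S \<le> \<phi> (q + 1 / real (Suc n))" for n
      by (rule cInf_lower[OF mem bdd_belowI[OF lower]])
    moreover have "(\<lambda>n. q + 1 / real (Suc n)) \<longlonglongrightarrow> q" by real_asymp
    then have "(\<lambda>n. \<phi> (q + 1 / real (Suc n))) \<longlonglongrightarrow> \<phi> q"
      using q q' by (intro phi_tendsto) auto
    ultimately show "Inf ?S \<le> \<phi> q" by (intro LIMSEQ_le_const) auto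
  qed
qed

section \<open>Finite-dimensional laws\<close>

lemma X_dead: "\<omega> \<in> \<Omega> \<Longrightarrow> 0 \<le> t \<Longrightarrow> \<not> ennreal t < \<zeta> \<omega> \<Longrightarrow> X t \<omega> = \<infinity>"
  using cadlag_until_dead[OF cadlag_path] by (simp add: not_less)

text \<open>While alive, X t is the starting point plus the increment; afterwards it is \<infinity>,
  and the probability of that is the mass missing from \<open>incr_law\<close>.\<close>

lemma emeasure_X:
  assumes t: "0 \<le> t" and B[measurable]: "B \<in> sets borel"
  shows "emeasure (P y) {\<omega>\<in>\<Omega>. X t \<omega> \<in> B} = killed_kernel (incr_law 0 t) (ereal y) B"
proof -
  let ?Z = "{\<omega>\<in>\<Omega>. ennreal t < \<zeta> \<omega>}"
  have [measurable]: "X t \<in> borel_measurable (P y)" by (rule X_measurable[OF t])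
  have Z[measurable]: "?Z \<in> sets (P y)" by (rule alive_in_P[OF t])
  have O[measurable]: "\<Omega> \<in> sets (P y)" using sets.top[of "P y"] by (simp add: space_P)
  have "{\<omega>\<in>space (P y). X t \<omega> \<in> B} \<in> sets (P y)" by measurable
  then have XB[measurable]: "{\<omega>\<in>\<Omega>. X t \<omega> \<in> B} \<in> sets (P y)" by (simp add: space_P)
  have "emeasure (P y) {\<omega>\<in>\<Omega>. X t \<omega> \<in> B} = (\<integral>\<^sup>+\<omega>. indicator {\<omega>\<in>\<Omega>. X t \<omega> \<in> B} \<omega> \<partial>P y)" by simp
  also have "\<dots> = (\<integral>\<^sup>+\<omega>. indicator B (ereal (y + (real_of_ereal (X t \<omega>) - real_of_ereal (X 0 \<omega>)))) * indicator ?Z \<omega>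
      + indicator B \<infinity> * indicator (\<Omega> - ?Z) \<omega> \<partial>P y)"
  proof (rule nn_integral_cong_AE)
    have sp: "AE \<omega> in P y. \<omega> \<in> \<Omega>" by (intro AE_I2) (simp add: space_P)
    show "AE \<omega> in P y. indicator {\<omega>\<in>\<Omega>. X t \<omega> \<in> B} \<omega>
      = indicator B (ereal (y + (real_of_ereal (X t \<omega>) - real_of_ereal (X 0 \<omega>)))) * indicator ?Z \<omega>
        + (indicator B \<infinity> * indicator (\<Omega> - ?Z) \<omega> :: ennreal)"
      using AE_X_0[of y] sp
    proof eventually_elim
      fix \<omega> assume X0: "X 0 \<omega> = ereal y" and \<omega>: "\<omega> \<in> \<Omega>"
      show "indicator {\<omega>\<in>\<Omega>. X t \<omega> \<in> B} \<omega>
        = indicator B (ereal (y + (real_of_ereal (X t \<omega>) - real_of_ereal (X 0 \<omega>)))) * indicator ?Z \<omega>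
        + (indicator B \<infinity> * indicator (\<Omega> - ?Z) \<omega> :: ennreal)"
      proof (cases "ennreal t < \<zeta> \<omega>")
        case True
        then have "ereal (real_of_ereal (X t \<omega>)) = X t \<omega>"
          using cadlag_until_finite[OF cadlag_path[OF \<omega>] t] by (simp add: ereal_real)
        then show ?thesis using True \<omega> X0 by (simp add: indicator_def)
      next
        case False
        then show ?thesis using X_dead[OF \<omega> t] \<omega> by (simp add: indicator_def)
      qed
    qed
  qed
  also have "\<dots> = (\<integral>\<^sup>+\<omega>. indicator B (ereal (y + (real_of_ereal (X t \<omega>) - real_of_ereal (X 0 \<omega>)))) * indicator ?Z \<omega> \<partial>P y)
      + (\<integral>\<^sup>+\<omega>. indicator B \<infinity> * indicator (\<Omega> - ?Z) \<omega> \<partial>P y)"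
  proof (rule nn_integral_add)
    have [measurable]: "X 0 \<in> borel_measurable (P y)" by (rule X_measurable) simp
    show "(\<lambda>\<omega>. indicator B (ereal (y + (real_of_ereal (X t \<omega>) - real_of_ereal (X 0 \<omega>)))) * indicator ?Z \<omega> :: ennreal) \<in> borel_measurable (P y)" by measurable
    show "(\<lambda>\<omega>. indicator B \<infinity> * indicator (\<Omega> - ?Z) \<omega> :: ennreal) \<in> borel_measurable (P y)" by measurable
  qed
  also have "(\<integral>\<^sup>+\<omega>. indicator B (ereal (y + (real_of_ereal (X t \<omega>) - real_of_ereal (X 0 \<omega>)))) * indicator ?Z \<omega> \<partial>P y)
      = (\<integral>\<^sup>+r. indicator B (ereal (y + r)) \<partial>incr_law y t)"
    by (rule nn_integral_incr_law[OF t, symmetric]) measurable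
  also have "(\<integral>\<^sup>+\<omega>. indicator B \<infinity> * indicator (\<Omega> - ?Z) \<omega> \<partial>P y) = indicator B \<infinity> * emeasure (P y) (\<Omega> - ?Z)"
    by (rule nn_integral_cmult_indicator) measurable
  also have "emeasure (P y) (\<Omega> - ?Z) = 1 - emeasure (incr_law y t) UNIV"
    using emeasure_compl[OF Z] P.emeasure_space_1[of y] by (simp add: space_P emeasure_incr_law[OF t])
  also have "incr_law y t = incr_law 0 t" by (rule incr_law_eq[OF t])
  finally show ?thesis by (simp add: killed_kernel_def mult.commute)
qed

text \<open>On survival up to s this is the Markov property. On the rest of \<open>A\<close> the
  path is at \<infinity> at both times, and \<open>killed_kernel\<close> started there is the point
  mass at \<infinity>.\<close>

lemma one_step:
  assumes s: "0 \<le> s" and t: "0 \<le> t" and A: "A \<in> sets (F s)" and B[measurable]: "B \<in> sets borel"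
  shows "emeasure (P x) {\<omega>\<in>A. X (s + t) \<omega> \<in> B} = (\<integral>\<^sup>+\<omega>. killed_kernel (incr_law 0 t) (X s \<omega>) B * indicator A \<omega> \<partial>P x)"
proof -
  let ?Z = "{\<omega>. ennreal s < \<zeta> \<omega>}"
  let ?K = "\<lambda>\<omega>. killed_kernel (incr_law 0 t) (X s \<omega>) B"
  let ?H = "\<lambda>w::real \<Rightarrow> ereal. indicator B (w t) :: ennreal"
  have AO: "A \<subseteq> \<Omega>" by (rule sets_F_subset[OF s A])
  have AP[measurable]: "A \<in> sets (P x)" by (rule F_in_P[OF s A])
  have AZ_eq: "A \<inter> ?Z = A \<inter> {\<omega>\<in>\<Omega>. ennreal s < \<zeta> \<omega>}" using AO by auto
  have AZ[measurable]: "A \<inter> ?Z \<in> sets (P x)" unfolding AZ_eq using AP alive_in_P[OF s] by (rule sets.Int)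
  have [measurable]: "X (s + t) \<in> borel_measurable (P x)" "X s \<in> borel_measurable (P x)" using s t by (auto intro: X_measurable)
  have Kmeas[measurable]: "?K \<in> borel_measurable (P x)"
    by (rule measurable_compose[OF X_measurable[OF s] measurable_killed_kernel[OF finite_incr_law[OF t] sets_incr_law B]])
  have "A \<inter> {\<omega>\<in>space (P x). X (s + t) \<omega> \<in> B} \<in> sets (P x)" by measurable
  moreover have "A \<inter> {\<omega>\<in>space (P x). X (s + t) \<omega> \<in> B} = {\<omega>\<in>A. X (s + t) \<omega> \<in> B}" using AO by (auto simp: space_P)
  ultimately have AB: "{\<omega>\<in>A. X (s + t) \<omega> \<in> B} \<in> sets (P x)" by simp
  have dead: "X r \<omega> = \<infinity>" if "\<omega> \<in> A - ?Z" "s \<le> r" for r \<omega>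
  proof -
    have "\<not> ennreal r < \<zeta> \<omega>" using that by (auto simp: not_less intro: order_trans[OF _ ennreal_leI])
    then show ?thesis using X_dead[of \<omega> r] that AO s by auto
  qed
  have "emeasure (P x) {\<omega>\<in>A. X (s + t) \<omega> \<in> B} = (\<integral>\<^sup>+\<omega>. indicator {\<omega>\<in>A. X (s + t) \<omega> \<in> B} \<omega> \<partial>P x)" using AB by simp
  also have "\<dots> = (\<integral>\<^sup>+\<omega>. ?H (restrict (\<lambda>r. X (s + r) \<omega>) {0..}) * indicator (A \<inter> ?Z) \<omega> + ?K \<omega> * indicator (A - A \<inter> ?Z) \<omega> \<partial>P x)"
  proof (rule nn_integral_cong)
    fix \<omega>
    show "indicator {\<omega>\<in>A. X (s + t) \<omega> \<in> B} \<omega>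
      = ?H (restrict (\<lambda>r. X (s + r) \<omega>) {0..}) * indicator (A \<inter> ?Z) \<omega> + ?K \<omega> * indicator (A - A \<inter> ?Z) \<omega>"
    proof (cases "\<omega> \<in> A - ?Z")
      case True
      then show ?thesis using dead[OF True, of "s + t"] dead[OF True, of s] t by (simp add: killed_kernel_def indicator_def)
    next
      case False
      then show ?thesis using t by (auto simp: indicator_def)
    qed
  qed
  also have "\<dots> = (\<integral>\<^sup>+\<omega>. ?H (restrict (\<lambda>r. X (s + r) \<omega>) {0..}) * indicator (A \<inter> ?Z) \<omega> \<partial>P x) + (\<integral>\<^sup>+\<omega>. ?K \<omega> * indicator (A - A \<inter> ?Z) \<omega> \<partial>P x)"
  proof (rule nn_integral_add)
    have "(\<lambda>\<omega>. indicator B (X (s + t) \<omega>) * indicator (A \<inter> ?Z) \<omega> :: ennreal) \<in> borel_measurable (P x)" by measurable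
    then show "(\<lambda>\<omega>. ?H (restrict (\<lambda>r. X (s + r) \<omega>) {0..}) * indicator (A \<inter> ?Z) \<omega>) \<in> borel_measurable (P x)" using t by simp
  qed measurable
  also have "(\<integral>\<^sup>+\<omega>. ?H (restrict (\<lambda>r. X (s + r) \<omega>) {0..}) * indicator (A \<inter> ?Z) \<omega> \<partial>P x) = (\<integral>\<^sup>+\<omega>. ?K \<omega> * indicator (A \<inter> ?Z) \<omega> \<partial>P x)"
  proof (rule markov_property[OF s A])
    have [measurable]: "(\<lambda>w. w t) \<in> borel_measurable path_space"
      using t unfolding path_space_def by (auto intro!: measurable_component_singleton)
    show "?H \<in> borel_measurable path_space" by measurable
    fix \<omega> assume \<omega>: "\<omega> \<in> A" "ennreal s < \<zeta> \<omega>"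
    define y where "y = real_of_ereal (X s \<omega>)"
    have y: "X s \<omega> = ereal y"
      unfolding y_def using cadlag_until_finite[OF cadlag_path s \<omega>(2)] \<omega> AO by (auto simp: ereal_real)
    have [measurable]: "X t \<in> borel_measurable (P y)" by (rule X_measurable[OF t])
    have "{\<omega>\<in>space (P y). X t \<omega> \<in> B} \<in> sets (P y)" by measurable
    then have XB: "{\<omega>\<in>\<Omega>. X t \<omega> \<in> B} \<in> sets (P y)" by (simp add: space_P)
    have "(\<integral>\<^sup>+\<omega>'. ?H (path_of X \<omega>') \<partial>P y) = (\<integral>\<^sup>+\<omega>'. indicator {\<omega>\<in>\<Omega>. X t \<omega> \<in> B} \<omega>' \<partial>P y)"
      using t by (intro nn_integral_cong) (auto simp: path_of_def space_P indicator_def)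
    also have "\<dots> = killed_kernel (incr_law 0 t) (ereal y) B" using XB emeasure_X[OF t B, of y] by simp
    finally show "(\<integral>\<^sup>+\<omega>'. ?H (path_of X \<omega>') \<partial>P (real_of_ereal (X s \<omega>))) = ?K \<omega>" unfolding y by simp
  qed
  also have "(\<integral>\<^sup>+\<omega>. ?K \<omega> * indicator (A \<inter> ?Z) \<omega> \<partial>P x) + (\<integral>\<^sup>+\<omega>. ?K \<omega> * indicator (A - A \<inter> ?Z) \<omega> \<partial>P x)
      = (\<integral>\<^sup>+\<omega>. ?K \<omega> * indicator (A \<inter> ?Z) \<omega> + ?K \<omega> * indicator (A - A \<inter> ?Z) \<omega> \<partial>P x)"
    by (rule nn_integral_add[symmetric]) measurable
  also have "\<dots> = (\<integral>\<^sup>+\<omega>. ?K \<omega> * indicator A \<omega> \<partial>P x)"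
    by (intro nn_integral_cong) (auto simp: indicator_def)
  finally show ?thesis .
qed

definition fd_law :: "real \<Rightarrow> real set \<Rightarrow> (real \<Rightarrow> ereal) measure" where
  "fd_law x I = distr (P x) (Pi\<^sub>M I (\<lambda>_. borel)) (\<lambda>\<omega>. restrict (\<lambda>i. X i \<omega>) I)"

lemma sets_fd_law: "sets (fd_law x I) = sets (Pi\<^sub>M I (\<lambda>_. borel))"
  by (simp add: fd_law_def)

lemma fd_measurable: "I \<subseteq> {0..} \<Longrightarrow> (\<lambda>\<omega>. restrict (\<lambda>i. X i \<omega>) I) \<in> measurable (P x) (Pi\<^sub>M I (\<lambda>_. borel))"
  by (intro measurable_restrict X_measurable) auto

lemma prob_fd_law: "I \<subseteq> {0..} \<Longrightarrow> prob_space (fd_law x I)"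
  unfolding fd_law_def by (intro P.prob_space_distr fd_measurable)

lemma emeasure_fd_law:
  assumes I: "finite I" "I \<subseteq> {0..}" and A: "\<And>i. i \<in> I \<Longrightarrow> A i \<in> sets borel"
  shows "emeasure (fd_law x I) (Pi\<^sub>E I A) = emeasure (P x) {\<omega>\<in>\<Omega>. \<forall>i\<in>I. X i \<omega> \<in> A i}"
proof -
  have "(\<lambda>\<omega>. restrict (\<lambda>i. X i \<omega>) I) -` (Pi\<^sub>E I A) \<inter> space (P x) = {\<omega>\<in>\<Omega>. \<forall>i\<in>I. X i \<omega> \<in> A i}"
    by (auto simp: space_P PiE_def Pi_def)
  moreover have "Pi\<^sub>E I A \<in> sets (Pi\<^sub>M I (\<lambda>_. borel))" using I A by (intro sets_PiM_I_finite) auto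
  ultimately show ?thesis unfolding fd_law_def using fd_measurable[OF I(2)] by (subst emeasure_distr) auto
qed

text \<open>Adding a time b after the last time s: the past enters only through w s, so the law on
  the larger time set is a function of the law on \<open>I\<close> and of one increment law.\<close>

lemma fd_law_step:
  assumes I: "finite I" "I \<subseteq> {0..}" and s: "s \<in> I" "\<And>i. i \<in> I \<Longrightarrow> i \<le> s" and b: "s < b"
    and A: "\<And>i. i \<in> insert b I \<Longrightarrow> A i \<in> sets borel"
  shows "emeasure (fd_law x (insert b I)) (Pi\<^sub>E (insert b I) A)
    = (\<integral>\<^sup>+w. killed_kernel (incr_law 0 (b - s)) (w s) (A b) * indicator (Pi\<^sub>E I A) w \<partial>fd_law x I)"
proof -
  let ?C = "{\<omega>\<in>\<Omega>. \<forall>i\<in>I. X i \<omega> \<in> A i}"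
  have s0: "0 \<le> s" using s I by auto
  have bs: "0 \<le> b - s" using b by simp
  have C: "?C \<in> sets (F s)"
  proof -
    have "{\<omega>\<in>space (F s). \<forall>i\<in>I. X i \<omega> \<in> A i} \<in> sets (F s)"
    proof (rule sets.sets_Collect_finite_All[OF _ I(1)])
      fix i assume i: "i \<in> I"
      have [measurable]: "X i \<in> borel_measurable (F s)" using i I s by (intro X_measurable_F) auto
      have [measurable]: "A i \<in> sets borel" using A i by simp
      show "{\<omega>\<in>space (F s). X i \<omega> \<in> A i} \<in> sets (F s)" by measurable
    qed
    then show ?thesis by (simp add: space_F[OF s0])
  qed
  have PE: "Pi\<^sub>E I A \<in> sets (Pi\<^sub>M I (\<lambda>_. borel))" using I A by (intro sets_PiM_I_finite) auto
  have Km: "(\<lambda>w. killed_kernel (incr_law 0 (b - s)) (w s) (A b)) \<in> borel_measurable (Pi\<^sub>M I (\<lambda>_. borel))"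
    by (rule measurable_compose[OF measurable_component_singleton[OF s(1)]
          measurable_killed_kernel[OF finite_incr_law[OF bs] sets_incr_law A]]) simp
  have "emeasure (fd_law x (insert b I)) (Pi\<^sub>E (insert b I) A) = emeasure (P x) {\<omega>\<in>\<Omega>. \<forall>i\<in>insert b I. X i \<omega> \<in> A i}"
    using I s0 b A by (intro emeasure_fd_law) auto
  also have "{\<omega>\<in>\<Omega>. \<forall>i\<in>insert b I. X i \<omega> \<in> A i} = {\<omega>\<in>?C. X (s + (b - s)) \<omega> \<in> A b}" by auto
  also have "emeasure (P x) \<dots> = (\<integral>\<^sup>+\<omega>. killed_kernel (incr_law 0 (b - s)) (X s \<omega>) (A b) * indicator ?C \<omega> \<partial>P x)"
    using A by (intro one_step[OF s0 bs C]) auto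
  also have "\<dots> = (\<integral>\<^sup>+\<omega>. killed_kernel (incr_law 0 (b - s)) (restrict (\<lambda>i. X i \<omega>) I s) (A b) * indicator (Pi\<^sub>E I A) (restrict (\<lambda>i. X i \<omega>) I) \<partial>P x)"
    using s(1) by (intro nn_integral_cong) (auto simp: space_P PiE_def Pi_def indicator_def)
  also have "\<dots> = (\<integral>\<^sup>+w. killed_kernel (incr_law 0 (b - s)) (w s) (A b) * indicator (Pi\<^sub>E I A) w \<partial>fd_law x I)"
    unfolding fd_law_def using Km PE by (intro nn_integral_distr[OF fd_measurable[OF I(2)], symmetric]) auto
  finally show ?thesis .
qed

end


section \<open>Uniqueness of the law on path space\<close>

lemma prob_PiM_eqI:
  assumes I: "finite I" and M: "prob_space M" "sets M = sets (Pi\<^sub>M I (\<lambda>_. borel))"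
    and N: "sets N = sets (Pi\<^sub>M I (\<lambda>_. borel))"
    and eq: "\<And>A. (\<And>i. i \<in> I \<Longrightarrow> A i \<in> sets borel) \<Longrightarrow> emeasure M (Pi\<^sub>E I A) = emeasure N (Pi\<^sub>E I A)"
  shows "M = N"
proof (rule measure_eqI_PiM_finite[OF I M(2) N eq])
  show "range (\<lambda>_::nat. Pi\<^sub>E I (\<lambda>_. UNIV)) \<subseteq> prod_algebra I (\<lambda>_. borel)"
    using I by (auto intro!: prod_algebraI_finite)
  show "(\<Union>i::nat. Pi\<^sub>E I (\<lambda>_. UNIV)) = space (Pi\<^sub>M I (\<lambda>_. borel))" by (simp add: space_PiM)
  interpret prob_space M by fact
  show "emeasure M (Pi\<^sub>E I (\<lambda>_. UNIV)) \<noteq> \<infinity>" by simp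
qed

text \<open>The increment laws have the same transforms in both settings and hence coincide. They
  determine the finite-dimensional laws recursively, and these generate the path law.\<close>

lemma path_law_unique:
  fixes \<Omega> :: "'a set" and \<Omega>' :: "'b set"
  assumes a: "passage_setting \<Omega> F P \<zeta> X Q \<phi>" and b: "passage_setting \<Omega>' F' P' \<zeta>' X' Q \<phi>"
  shows "distr (P x) path_space (path_of X) = distr (P' x) path_space (path_of X')"
proof -
  interpret A: passage_setting \<Omega> F P \<zeta> X Q \<phi> by (rule a)
  interpret B: passage_setting \<Omega>' F' P' \<zeta>' X' Q \<phi> by (rule b)
  have incr: "A.incr_law 0 t = B.incr_law 0 t" if "0 \<le> t" for t
    by (rule A.phi_laplace_unique[where c="\<lambda>q. q * t"])
      (simp_all only: A.sets_incr_law B.sets_incr_law A.incr_laplace B.incr_laplace that)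
  \<comment> \<open>Time 0 is always included: it supplies the base case, the starting point, and
    guarantees a last time from which the new largest time is reached.\<close>
  have fd: "A.fd_law x (insert 0 J) = B.fd_law x (insert 0 J)" if "finite J" "J \<subseteq> {0<..}" for J
    using that
  proof (induction J rule: finite_linorder_max_induct)
    case empty
    show ?case
    proof (rule prob_PiM_eqI)
      fix A :: "real \<Rightarrow> ereal set" assume A: "\<And>i. i \<in> {0} \<Longrightarrow> A i \<in> sets borel"
      have "emeasure (A.fd_law x {0}) (Pi\<^sub>E {0} A) = killed_kernel (A.incr_law 0 0) (ereal x) (A 0)"
        using A by (subst A.emeasure_fd_law) (auto simp: A.emeasure_X)
      also have "\<dots> = emeasure (B.fd_law x {0}) (Pi\<^sub>E {0} A)"
        using A by (subst B.emeasure_fd_law) (auto simp: B.emeasure_X incr)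
      finally show "emeasure (A.fd_law x {0}) (Pi\<^sub>E {0} A) = emeasure (B.fd_law x {0}) (Pi\<^sub>E {0} A)" .
    qed (auto intro!: A.prob_fd_law simp: A.sets_fd_law B.sets_fd_law)
  next
    case (insert b J)
    let ?I = "insert 0 J"
    define s where "s = Max ?I"
    have I: "finite ?I" "?I \<subseteq> {0..}" using insert by auto
    have s: "s \<in> ?I" "\<And>i. i \<in> ?I \<Longrightarrow> i \<le> s" unfolding s_def using Max_in[OF I(1)] Max_ge[OF I(1)] by auto
    have sb: "s < b" using s(1) insert by auto
    have I': "insert 0 (insert b J) = insert b ?I" by auto
    show ?case unfolding I'
    proof (rule prob_PiM_eqI)
      fix A :: "real \<Rightarrow> ereal set" assume A: "\<And>i. i \<in> insert b ?I \<Longrightarrow> A i \<in> sets borel"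
      have IH: "A.fd_law x ?I = B.fd_law x ?I" using insert by auto
      show "emeasure (A.fd_law x (insert b ?I)) (Pi\<^sub>E (insert b ?I) A) = emeasure (B.fd_law x (insert b ?I)) (Pi\<^sub>E (insert b ?I) A)"
        using A.fd_law_step[OF I s sb A, where x=x] B.fd_law_step[OF I s sb A, where x=x] IH incr[of "b - s"] sb by simp
    qed (use I insert in \<open>auto intro!: A.prob_fd_law simp: A.sets_fd_law B.sets_fd_law\<close>)
  qed
  show ?thesis
  proof (rule measure_eqI_PiM_infinite[where I="{0..}" and M="\<lambda>_. borel"])
    show "finite_measure (distr (P x) path_space (path_of X))"
      by (rule prob_space.finite_measure[OF A.P.prob_space_distr[OF A.path_measurable]])
    fix A :: "real \<Rightarrow> ereal set" and J assume J: "finite J" "J \<subseteq> {0..}" and A: "\<And>i. i \<in> J \<Longrightarrow> A i \<in> sets borel"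
    let ?E = "prod_emb {0..} (\<lambda>_. borel) J (Pi\<^sub>E J A)"
    have E: "?E \<in> sets path_space" unfolding path_space_def using J A by (intro sets_PiM_I) auto
    \<comment> \<open>Makes time 0 available to the cylinder without constraining it when it is not
      in \<open>J\<close>.\<close>
    define A' where "A' i = (if i \<in> J then A i else UNIV)" for i
    have A': "A' i \<in> sets borel" for i using A by (auto simp: A'_def)
    have I: "finite (insert 0 J)" "insert 0 J \<subseteq> {0..}" using J by auto
    have J0: "insert 0 (J - {0}) = insert 0 J" by auto
    have eqfd: "A.fd_law x (insert 0 J) = B.fd_law x (insert 0 J)"
      using fd[of "J - {0}"] J unfolding J0 by force
    have emb: "path_of Y -` ?E \<inter> S = {\<omega>\<in>S. \<forall>i\<in>insert 0 J. Y i \<omega> \<in> A' i}" for Y :: "real \<Rightarrow> 'c \<Rightarrow> ereal" and S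
      using J by (auto simp: prod_emb_def path_of_def A'_def PiE_def Pi_def extensional_def subset_eq)
    have "emeasure (distr (P x) path_space (path_of X)) ?E = emeasure (P x) {\<omega>\<in>\<Omega>. \<forall>i\<in>insert 0 J. X i \<omega> \<in> A' i}"
      using E by (simp add: emeasure_distr[OF A.path_measurable] emb A.space_P)
    also have "\<dots> = emeasure (A.fd_law x (insert 0 J)) (Pi\<^sub>E (insert 0 J) A')"
      using A' by (intro A.emeasure_fd_law[OF I, symmetric])
    also have "\<dots> = emeasure (P' x) {\<omega>\<in>\<Omega>'. \<forall>i\<in>insert 0 J. X' i \<omega> \<in> A' i}"
      unfolding eqfd using A' by (intro B.emeasure_fd_law[OF I])
    also have "\<dots> = emeasure (distr (P' x) path_space (path_of X')) ?E"
      using E by (simp add: emeasure_distr[OF B.path_measurable] emb B.space_P)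
    finally show "emeasure (distr (P x) path_space (path_of X)) ?E = emeasure (distr (P' x) path_space (path_of X')) ?E" .
  qed (simp_all add: path_space_def)
qed

theorem mainTheorem6:
  fixes \<Omega> :: "'a set" and F P :: "real \<Rightarrow> 'a measure" and \<zeta> :: "'a \<Rightarrow> ennreal"
    and X :: "real \<Rightarrow> 'a \<Rightarrow> ereal" and Q :: real and \<phi> :: "real \<Rightarrow> real"
  assumes "standing_setting \<Omega> F P \<zeta> X"
    and "no_negative_jumps P \<zeta> X"
    and "passage_hyp P \<zeta> X Q \<phi>"
  shows "(\<exists>\<psi> p. killed_sp_levy \<Omega> F P \<zeta> X \<psi> p \<and> (\<forall>q>Q. rc_inverse \<psi> (p + q) = \<phi> q))
       \<and> (\<forall>(\<Omega>'::'b set) F' P' \<zeta>' X'.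
            standing_setting \<Omega>' F' P' \<zeta>' X' \<and> no_negative_jumps P' \<zeta>' X' \<and> passage_hyp P' \<zeta>' X' Q \<phi>
            \<longrightarrow> (\<forall>x. distr (P x) path_space (path_of X) = distr (P' x) path_space (path_of X')))"
proof -
  have ps: "passage_setting \<Omega> F P \<zeta> X Q \<phi>"
    using assms by (simp add: passage_setting_def standing_def passage_setting_axioms_def)
  interpret passage_setting \<Omega> F P \<zeta> X Q \<phi> by (rule ps)
  show ?thesis
  proof (intro conjI allI impI)
    show "\<exists>\<psi> p. killed_sp_levy \<Omega> F P \<zeta> X \<psi> p \<and> (\<forall>q>Q. rc_inverse \<psi> (p + q) = \<phi> q)"
      using killed_levy rc_inverse_psi by blast
    fix \<Omega>' :: "'b set" and F' P' \<zeta>' X' x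
    assume "standing_setting \<Omega>' F' P' \<zeta>' X' \<and> no_negative_jumps P' \<zeta>' X' \<and> passage_hyp P' \<zeta>' X' Q \<phi>"
    then have "passage_setting \<Omega>' F' P' \<zeta>' X' Q \<phi>"
      by (simp add: passage_setting_def standing_def passage_setting_axioms_def)
    then show "distr (P x) path_space (path_of X) = distr (P' x) path_space (path_of X')"
      by (rule path_law_unique[OF ps])
  qed
qed

end
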